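(* Consider the combined heat and power network with general generation dynamics (described in the context), operating either under Mode 1 or under Mode 2, with constant loads $p^L,h^L$. Consider an equilibrium point of this system with $|\eta^*_{ij}|<\frac\pi2$ for all $(i,j)\in E_e$, and suppose that each of the electric generation systems ($j\in N_e^G$, input $\omega_j$, output $p^G_j$) and each of the heat generation systems ($j\in E_h^G$, input $\bar T$, output $h^G_j$) is locally input strictly passive (in the sense defined in the context) about the values associated with this equilibrium point, with storage functions that have strict local minima at this equilibrium point. Then there exists an open neighborhood of this equilibrium point such that all solutions of the system starting in this neighborhood converge to an equilibrium point. (The assertion is made for each of the two modes separately.)
   Context: **Electric network.** $(N_e,E_e)$ is a finite connected directed graph; $N_e$ is the set of buses, $E_e\subseteq N_e\times N_e$ the set of transmission lines. $N_e^G\subseteq N_e$ is the set of generator buses, $H_e\subseteq N_e$ the set of buses to which heat pumps are connected. For each bus $j\in N_e$, $$M_j\dot\omega_j=-p^L_j-p^P_j+p^G_j-p^U_j+\sum_{i:\,i\to j}p_{ij}-\sum_{k:\,j\to k}p_{jk},$$ and for each line $(i,j)\in E_e$, $\dot\eta_{ij}=\omega_i-\omega_j$, $p_{ij}=B_{ij}\sin(\eta_{ij})$ with $B_{ij}>0$. Here $\omega_j$ is the frequency deviation at bus $j$, $\eta_{ij}$ the angle difference between buses $i$ and $j$, $p^U_j=D_j\omega_j$ with $D_j>0$, $p^L_j$ is a constant load, $p^P_j$ is the heat pump consumption ($p^P_j=0$ if $j\notin H_e$), $p^G_j$ is the generation. If $j\in N_e^G$ then $M_j>0$; if $j$ is a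 load bus, $M_j=0$ and $p^G_j=0$, so that the equation at $j$ is an algebraic constraint (solutions are understood to satisfy these constraints). **Heating network.** $(N_h,E_h)$ is a finite directed graph with nodes $N_h$ and edges $E_h$; $H_h\subseteq E_h$ are the edges carrying heat pumps, $E_h^G\subseteq E_h$ those carrying conventional heat sources, $E_h^L\subseteq E_h$ those carrying heat loads. With $T=\mathrm{col}(T^E,T^N)$ the vector of edge and node temperature deviations, $$V\dot T=-A_hT+\begin{bmatrix}h^G+h^P-h^L\\ \mathbf 0\end{bmatrix},\qquad A_h=\begin{bmatrix}\mathrm{diag}(q^E)&-\mathrm{diag}(q^E)B_{sh}^T\\-B_{th}\mathrm{diag}(q^E)&\mathrm{diag}(B_{th}q^E)\end{bmatrix},$$ where $V=\mathrm{diag}(\{V^E_j\},\{V^N_k\})$ has positive volumes on the diagonal, $q^E$ is a given constant vector of edge mass flows, $B_h$ is the incidence matrix ($B_{h,ij}=1$ if the flow through edge $j$ enters node $i$, $-1$ if it originates from node $i$, $0$ otherwise), $B_{th}=\frac12(|B_h|+B_h)$, $B_{sh}=\frac12(|B_h|-B_h)$ (entrywise absolute value). $h^P,h^G,h^L\in\mathbb R^{E_h}$ are supported on $H_h$, $E_h^G$, $E_h^L$ respectively, and $h^L$ is constant. The matrix $A_h$ satisfies: $A_h+A_h^T$ is positive semidefinite with a simple eigenvalue at $0$, $A_h\mathbf 1=0$, $\mathbf 1^TA_h=0$. The average temperature is $\bar T=\frac{\mathbf 1^TVT}{\mathcal V}$ with $\mathcal V=\mathbf 1^TV\mathbf 1$.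 **General generation dynamics.** For $j\in N_e^G$, $p^G_j$ is the output of $$\dot x^s_{e,j}=-f_{e,j}(x^s_{e,j},\omega_j),\qquad p^G_j=-g_{e,j}(x^s_{e,j},\omega_j),$$ and for $j\in E_h^G$, $h^G_j$ is the output of $$\dot x^s_{h,j}=-f_{h,j}(x^s_{h,j},\bar T),\qquad h^G_j=-g_{h,j}(x^s_{h,j},\bar T),$$ with finite-dimensional states $x^s_{e,j},x^s_{h,j}$ and locally Lipschitz functions $f_{e,j},g_{e,j},f_{h,j},g_{h,j}$. It is assumed that for a given constant input $\omega^*$ (resp. $\bar T^*$) the equilibrium output $p^{G*}_j$ (resp. $h^{G*}_j$) is unique, and that the equilibrium state $x^{s*}_{e,j}$ (resp. $x^{s*}_{h,j}$) is asymptotically stable for its own subsystem when the input is held constant at $\omega^*$ (resp. $\bar T^*$). **Local input strict passivity.** The electric system $j$ is locally input strictly passive around $(\omega^*,x^{s*}_{e,j})$ if there exist open neighborhoods $\Omega_j$ of $\omega^*$ and $X^s_{e,j}$ of $x^{s*}_{e,j}$ and a continuously differentiable positive semidefinite function $V^s_{e,j}(x^s_{e,j})$ (the storage function) such that for all $\omega_j\in\Omega_j$, $x^s_{e,j}\in X^s_{e,j}$, the derivative along the dynamics satisfies $$\dot V^s_{e,j}\le(-\omega_j+\omega^* )(p^G_j-p^{G*}_j)-\phi_{e,j}(-\omega_j+\omega^* )$$ with $\phi_{e,j}$ a positive definite function. Similarly, the heat system $j$ is locally input strictly passive around $(\bar T^*,x^{s*}_{h,j})$ if there exist open neighborhoods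 $\mathcal T_j$ of $\bar T^*$ and $X^s_{h,j}$ of $x^{s*}_{h,j}$ and a continuously differentiable positive semidefinite $V^s_{h,j}(x^s_{h,j})$ with, for all $\bar T\in\mathcal T_j$, $x^s_{h,j}\in X^s_{h,j}$, $$\dot V^s_{h,j}\le(-\bar T+\bar T^* )(h^G_j-h^{G*}_j)-\phi_{h,j}(-\bar T+\bar T^* ),$$ $\phi_{h,j}$ positive definite. **Heat pumps.** Each $j\in H_e$ is associated with an edge $k_j\in H_h$ (a one-to-one correspondence), and $h^P_{k_j}=C_{o,j}p^P_j$ with constant $C_{o,j}>0$. *Mode 1:* $p^P_j=a_{1,j}\omega_j$ for $j\in H_e$, with constants $a_{1,j}>0$. *Mode 2:* the heating network is connected to the power network through a single heat pump bus, $H_e=\{j\}$, which is a separate bus with zero inertia, no load, no generation and no damping term. At this bus the swing equation is replaced by $$0=-p^P_j+\sum_{i:\,i\to j}p_{ij}-\sum_{k:\,j\to k}p_{jk},\qquad \omega_j=m_j\bar T,$$ with constant $m_j>0$. All other buses satisfy the swing equation above with $p^P=0$ and $D>0$. **Equilibrium.** The state of the system is $(\eta,\omega,x^s_e,T,x^s_h)$, where $x^s_e,x^s_h$ collect the generation states; an equilibrium point is a point at which all these variables are constant in time. At an equilibrium all bus frequencies equal a common value, also denoted $\omega^*$; starred quantities denote equilibrium values.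
   Formalization: In Mode 1 the heating network is assumed to have at least one conventional heat source (E_h^G nonempty); without one the claim can fail, since slowly settling generation (x' = -x^3, output x^2 - ω) makes the average temperature drift logarithmically. *)

theory Defs
  imports "HOL-Analysis.Analysis" "HOL-Computational_Algebra.Polynomial"
begin

section \<open>Solutions of (differential-algebraic) equations\<close>

text \<open>
  An autonomous system is given by a relation \<open>R x v\<close> between a state \<open>x\<close> and its time derivative
  \<open>v\<close>; algebraic constraints are conjuncts of \<open>R\<close> that do not mention \<open>v\<close>. Solutions live on
  \<open>[0,\<tau>)\<close> with \<open>0 < \<tau> \<le> \<infinity>\<close>, so that finite escape times are not excluded by definition.
\<close>

definition forward_interval :: "real set \<Rightarrow> bool" where
  "forward_interval I \<longleftrightarrow> I = {0..} \<or> (\<exists>\<tau>>0. I = {0..<\<tau>})"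

definition solution_of ::
    "('a::real_normed_vector \<Rightarrow> 'a \<Rightarrow> bool) \<Rightarrow> real set \<Rightarrow> (real \<Rightarrow> 'a) \<Rightarrow> bool" where
  "solution_of R I x \<longleftrightarrow> forward_interval I \<and>
     (\<forall>t\<in>I. \<exists>v. (x has_vector_derivative v) (at t within I) \<and> R (x t) v)"

definition maximal_solution ::
    "('a::real_normed_vector \<Rightarrow> 'a \<Rightarrow> bool) \<Rightarrow> real set \<Rightarrow> (real \<Rightarrow> 'a) \<Rightarrow> bool" where
  "maximal_solution R I x \<longleftrightarrow> solution_of R I x \<and>
     (\<forall>J y. solution_of R J y \<and> I \<subseteq> J \<and> (\<forall>t\<in>I. y t = x t) \<longrightarrow> J = I)"

definition equilibrium :: "('a::real_normed_vector \<Rightarrow> 'a \<Rightarrow> bool) \<Rightarrow> 'a \<Rightarrow> bool" where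
  "equilibrium R x \<longleftrightarrow> R x 0"

definition asymptotically_stable :: "('a::real_normed_vector \<Rightarrow> 'a \<Rightarrow> bool) \<Rightarrow> 'a \<Rightarrow> bool" where
  "asymptotically_stable R xs \<longleftrightarrow> equilibrium R xs \<and>
     (\<forall>\<epsilon>>0. \<exists>\<delta>>0. \<forall>I x. maximal_solution R I x \<and> dist (x 0) xs < \<delta> \<longrightarrow>
        (\<forall>t\<in>I. dist (x t) xs < \<epsilon>)) \<and>
     (\<exists>\<delta>>0. \<forall>I x. maximal_solution R I x \<and> dist (x 0) xs < \<delta> \<longrightarrow>
        I = {0..} \<and> (x \<longlongrightarrow> xs) at_top)"


section \<open>Generation systems\<close>

text \<open>
  A generation system has dynamics \<open>x' = - f x u\<close> and output \<open>y = - g x u\<close>. Its state space is a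
  linear subspace \<open>S\<close> of a Euclidean space, so that a family of systems with different state
  dimensions (including 0) can be indexed over one type.
\<close>

definition locally_lipschitz_on ::
    "'a::metric_space set \<Rightarrow> ('a \<Rightarrow> 'b::metric_space) \<Rightarrow> bool" where
  "locally_lipschitz_on S f \<longleftrightarrow> (\<forall>p\<in>S. \<exists>\<epsilon>>0. \<exists>L. L-lipschitz_on (ball p \<epsilon> \<inter> S) f)"

definition generation_system ::
    "'s::euclidean_space set \<Rightarrow> ('s \<Rightarrow> real \<Rightarrow> 's) \<Rightarrow> ('s \<Rightarrow> real \<Rightarrow> real) \<Rightarrow> bool" where
  "generation_system S f g \<longleftrightarrow> subspace S \<and> (\<forall>x\<in>S. \<forall>u. f x u \<in> S) \<and>
     locally_lipschitz_on (S \<times> UNIV) (\<lambda>(x, u). f x u) \<and>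
     locally_lipschitz_on (S \<times> UNIV) (\<lambda>(x, u). g x u)"

definition generation_dynamics ::
    "'s::euclidean_space set \<Rightarrow> ('s \<Rightarrow> real \<Rightarrow> 's) \<Rightarrow> real \<Rightarrow> 's \<Rightarrow> 's \<Rightarrow> bool" where
  "generation_dynamics S f u x v \<longleftrightarrow> x \<in> S \<and> v = - f x u"

definition unique_equilibrium_output ::
    "'s::euclidean_space set \<Rightarrow> ('s \<Rightarrow> real \<Rightarrow> 's) \<Rightarrow> ('s \<Rightarrow> real \<Rightarrow> real) \<Rightarrow> real \<Rightarrow> bool" where
  "unique_equilibrium_output S f g us \<longleftrightarrow>
     (\<forall>x y. equilibrium (generation_dynamics S f us) x \<and> equilibrium (generation_dynamics S f us) y
        \<longrightarrow> - g x us = - g y us)"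

text \<open>
  The storage function \<open>Vs\<close> is an argument, as further conditions are imposed on it. Its gradient
  \<open>dV\<close> is determined up to components orthogonal to \<open>S\<close>, which do not affect its inner product with
  \<open>f x u \<in> S\<close>. The passive input is \<open>- u\<close>.
\<close>

definition locally_input_strictly_passive ::
    "'s::euclidean_space set \<Rightarrow> ('s \<Rightarrow> real \<Rightarrow> 's) \<Rightarrow> ('s \<Rightarrow> real \<Rightarrow> real) \<Rightarrow> real \<Rightarrow> 's \<Rightarrow>
     ('s \<Rightarrow> real) \<Rightarrow> bool" where
  "locally_input_strictly_passive S f g us xs Vs \<longleftrightarrow>
     (\<exists>\<Omega> X dV \<phi>. open \<Omega> \<and> us \<in> \<Omega> \<and> openin (top_of_set S) X \<and> xs \<in> X \<and>
        Vs xs = 0 \<and> (\<forall>x\<in>X. 0 \<le> Vs x) \<and>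
        continuous_on X dV \<and> (\<forall>x\<in>X. (Vs has_derivative (\<lambda>h. dV x \<bullet> h)) (at x within S)) \<and>
        \<phi> 0 = (0::real) \<and> (\<forall>s. s \<noteq> 0 \<longrightarrow> 0 < \<phi> s) \<and>
        (\<forall>u\<in>\<Omega>. \<forall>x\<in>X.
           dV x \<bullet> (- f x u) \<le> (- u + us) * ((- g x u) - (- g xs us)) - \<phi> (- u + us)))"

definition strict_local_min_on ::
    "'s::metric_space set \<Rightarrow> ('s \<Rightarrow> real) \<Rightarrow> 's \<Rightarrow> bool" where
  "strict_local_min_on S h xs \<longleftrightarrow> (\<forall>\<^sub>F x in at xs within S. h xs < h x)"


section \<open>Combined heat and power networks\<close>

text \<open>
  Buses, heating edges and heating nodes are the elements of the finite types \<open>'n\<close>, \<open>'k\<close>, \<open>'m\<close>.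
  Heating edge \<open>k\<close> leads from \<open>src k\<close> to \<open>tgt k\<close>.
\<close>

record ('n, 'k::finite, 'm, 's, 'r) chp =
  lines :: "('n \<times> 'n) set"
  gen_buses :: "'n set"
  pump_buses :: "'n set"
  inertia :: "'n \<Rightarrow> real"
  damping :: "'n \<Rightarrow> real"
  elec_load :: "'n \<Rightarrow> real"
  susc :: "'n \<times> 'n \<Rightarrow> real"
  S_e :: "'n \<Rightarrow> 's set"
  f_e :: "'n \<Rightarrow> 's \<Rightarrow> real \<Rightarrow> 's"
  g_e :: "'n \<Rightarrow> 's \<Rightarrow> real \<Rightarrow> real"
  src :: "'k \<Rightarrow> 'm"
  tgt :: "'k \<Rightarrow> 'm"
  pump_edges :: "'k set"
  source_edges :: "'k set"
  load_edges :: "'k set"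
  mass_flow :: "real^'k"
  volume :: "'k + 'm \<Rightarrow> real"
  heat_load :: "'k \<Rightarrow> real"
  S_h :: "'k \<Rightarrow> 'r set"
  f_h :: "'k \<Rightarrow> 'r \<Rightarrow> real \<Rightarrow> 'r"
  g_h :: "'k \<Rightarrow> 'r \<Rightarrow> real \<Rightarrow> real"
  pump_edge :: "'n \<Rightarrow> 'k"
  cop :: "'n \<Rightarrow> real"

text \<open>
  \<open>Mode1 a\<close>: consumption \<open>a j * \<omega> j\<close> at each pump bus \<open>j\<close>. \<open>Mode2 j m\<close>: the frequency of the only
  pump bus \<open>j\<close> is \<open>m\<close> times the average temperature.
\<close>

datatype 'n hp_mode = Mode1 "'n \<Rightarrow> real" | Mode2 'n real

definition incidence :: "('n::finite, 'k::finite, 'm::finite, 's, 'r) chp \<Rightarrow> real^'k^'m" where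
  "incidence N = (\<chi> i k. if tgt N k = i then 1 else if src N k = i then - 1 else 0)"

definition B_th :: "('n::finite, 'k::finite, 'm::finite, 's, 'r) chp \<Rightarrow> real^'k^'m" where
  "B_th N = (\<chi> i k. (\<bar>incidence N $ i $ k\<bar> + incidence N $ i $ k) / 2)"

definition B_sh :: "('n::finite, 'k::finite, 'm::finite, 's, 'r) chp \<Rightarrow> real^'k^'m" where
  "B_sh N = (\<chi> i k. (\<bar>incidence N $ i $ k\<bar> - incidence N $ i $ k) / 2)"

definition A_h :: "('n::finite, 'k::finite, 'm::finite, 's, 'r) chp \<Rightarrow> real^('k + 'm)^('k + 'm)" where
  "A_h N = (\<chi> a b. case (a, b) of
      (Inl k, Inl l) \<Rightarrow> (if k = l then mass_flow N $ k else 0)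
    | (Inl k, Inr i) \<Rightarrow> - (mass_flow N $ k * B_sh N $ i $ k)
    | (Inr i, Inl k) \<Rightarrow> - (B_th N $ i $ k * mass_flow N $ k)
    | (Inr i, Inr j) \<Rightarrow> (if i = j then (B_th N *v mass_flow N) $ i else 0))"

definition average_temperature ::
    "('n::finite, 'k::finite, 'm::finite, 's, 'r) chp \<Rightarrow> real^('k + 'm) \<Rightarrow> real" where
  "average_temperature N T = (\<Sum>i\<in>UNIV. volume N i * T $ i) / (\<Sum>i\<in>UNIV. volume N i)"

definition char_polynomial :: "real^'a::finite^'a \<Rightarrow> real poly" where
  "char_polynomial A = det (\<chi> i j. if i = j then [:- A $ i $ j, 1:] else [:- A $ i $ j:])"

definition simple_eigenvalue :: "real^'a::finite^'a \<Rightarrow> real \<Rightarrow> bool" where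
  "simple_eigenvalue A c \<longleftrightarrow> order c (char_polynomial A) = 1"

definition positive_semidefinite :: "real^'a::finite^'a \<Rightarrow> bool" where
  "positive_semidefinite A \<longleftrightarrow> transpose A = A \<and> (\<forall>x. 0 \<le> x \<bullet> (A *v x))"

definition chp_network ::
    "('n::finite, 'k::finite, 'm::finite, 's::euclidean_space, 'r::euclidean_space) chp \<Rightarrow> bool" where
  "chp_network N \<longleftrightarrow>
     (\<forall>i j. (i, j) \<in> (lines N \<union> (lines N)\<inverse>)\<^sup>*) \<and>
     (\<forall>e\<in>lines N. 0 < susc N e) \<and>
     (\<forall>j\<in>gen_buses N. 0 < inertia N j) \<and> (\<forall>j. j \<notin> gen_buses N \<longrightarrow> inertia N j = 0) \<and>
     (\<forall>j\<in>gen_buses N. generation_system (S_e N j) (f_e N j) (g_e N j)) \<and>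
     (\<forall>i. 0 < volume N i) \<and>
     (\<forall>k. k \<notin> load_edges N \<longrightarrow> heat_load N k = 0) \<and>
     positive_semidefinite (A_h N + transpose (A_h N)) \<and>
     simple_eigenvalue (A_h N + transpose (A_h N)) 0 \<and>
     A_h N *v 1 = 0 \<and> 1 v* A_h N = 0 \<and>
     (\<forall>k\<in>source_edges N. generation_system (S_h N k) (f_h N k) (g_h N k)) \<and>
     bij_betw (pump_edge N) (pump_buses N) (pump_edges N) \<and>
     (\<forall>j\<in>pump_buses N. 0 < cop N j)"

text \<open>
  A conventional heat source is required in Mode 1. Without one, nothing acts on the average
  temperature except the heat pumps, and it integrates the frequency deviations from equilibrium;
  their integral need not converge, as asymptotically stable generation may settle too slowly
  (e.g. \<open>x' = - x\<^sup>3\<close> with output \<open>x\<^sup>2 - \<omega>\<close>).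
\<close>

fun valid_mode :: "('n::finite, 'k::finite, 'm, 's, 'r) chp \<Rightarrow> 'n hp_mode \<Rightarrow> bool" where
  "valid_mode N (Mode1 a) \<longleftrightarrow>
     (\<forall>j\<in>pump_buses N. 0 < a j) \<and> (\<forall>j. 0 < damping N j) \<and> source_edges N \<noteq> {}"
| "valid_mode N (Mode2 j m) \<longleftrightarrow>
     pump_buses N = {j} \<and> 0 < m \<and> j \<notin> gen_buses N \<and> elec_load N j = 0 \<and> damping N j = 0 \<and>
     (\<forall>i. i \<noteq> j \<longrightarrow> 0 < damping N i)"

definition line_flow :: "('n::finite, 'k::finite, 'm, 's, 'r) chp \<Rightarrow> real^('n \<times> 'n) \<Rightarrow> 'n \<times> 'n \<Rightarrow> real" where
  "line_flow N \<eta> e = susc N e * sin (\<eta> $ e)"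

definition net_inflow ::
    "('n::finite, 'k::finite, 'm, 's, 'r) chp \<Rightarrow> real^('n \<times> 'n) \<Rightarrow> 'n \<Rightarrow> real" where
  "net_inflow N \<eta> j = (\<Sum>i | (i, j) \<in> lines N. line_flow N \<eta> (i, j))
                     - (\<Sum>k | (j, k) \<in> lines N. line_flow N \<eta> (j, k))"

definition elec_generation ::
    "('n::finite, 'k::finite, 'm, 's, 'r) chp \<Rightarrow> real^'n \<Rightarrow> 's^'n \<Rightarrow> 'n \<Rightarrow> real" where
  "elec_generation N \<omega> xe j = (if j \<in> gen_buses N then - g_e N j (xe $ j) (\<omega> $ j) else 0)"

definition heat_generation ::
    "('n::finite, 'k::finite, 'm::finite, 's, 'r) chp \<Rightarrow> real^('k + 'm) \<Rightarrow> 'r^'k \<Rightarrow> 'k \<Rightarrow> real" where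
  "heat_generation N T xh k =
     (if k \<in> source_edges N then - g_h N k (xh $ k) (average_temperature N T) else 0)"

text \<open>In the following, \<open>\<omega>d\<close> and \<open>Td\<close> stand for time derivatives, and \<open>pP\<close>, \<open>hP\<close> for heat pump consumption
  and heat pump output.\<close>

definition swing_equation ::
    "('n::finite, 'k::finite, 'm, 's, 'r) chp \<Rightarrow> real^('n \<times> 'n) \<Rightarrow> real^'n \<Rightarrow> 's^'n \<Rightarrow> ('n \<Rightarrow> real) \<Rightarrow>
     real^'n \<Rightarrow> 'n \<Rightarrow> bool" where
  "swing_equation N \<eta> \<omega> xe pP \<omega>d j \<longleftrightarrow>
     inertia N j * \<omega>d $ j =
       - elec_load N j - pP j + elec_generation N \<omega> xe j - damping N j * \<omega> $ j + net_inflow N \<eta> j"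

fun bus_equations ::
    "('n::finite, 'k::finite, 'm::finite, 's, 'r) chp \<Rightarrow> 'n hp_mode \<Rightarrow> real^('n \<times> 'n) \<Rightarrow> real^'n \<Rightarrow>
     's^'n \<Rightarrow> real^('k + 'm) \<Rightarrow> ('n \<Rightarrow> real) \<Rightarrow> real^'n \<Rightarrow> bool" where
  "bus_equations N (Mode1 a) \<eta> \<omega> xe T pP \<omega>d \<longleftrightarrow>
     (\<forall>j\<in>pump_buses N. pP j = a j * \<omega> $ j) \<and> (\<forall>j. swing_equation N \<eta> \<omega> xe pP \<omega>d j)"
| "bus_equations N (Mode2 j m) \<eta> \<omega> xe T pP \<omega>d \<longleftrightarrow>
     0 = - pP j + net_inflow N \<eta> j \<and> \<omega> $ j = m * average_temperature N T \<and>
     (\<forall>i. i \<noteq> j \<longrightarrow> swing_equation N \<eta> \<omega> xe pP \<omega>d i)"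

definition heat_equation ::
    "('n::finite, 'k::finite, 'm::finite, 's, 'r) chp \<Rightarrow> real^('k + 'm) \<Rightarrow> 'r^'k \<Rightarrow> ('k \<Rightarrow> real) \<Rightarrow>
     real^('k + 'm) \<Rightarrow> bool" where
  "heat_equation N T xh hP Td \<longleftrightarrow>
     (\<forall>i. volume N i * Td $ i = - (A_h N *v T) $ i +
        (case i of Inl k \<Rightarrow> heat_generation N T xh k + hP k - heat_load N k | Inr _ \<Rightarrow> 0))"

text \<open>
  States are tuples \<open>(\<eta>, \<omega>, xe, T, xh)\<close>. Coordinates of \<open>\<eta>\<close>, \<open>xe\<close>, \<open>xh\<close> that do not belong to a line,
  a generator bus, or a heat source are kept at 0.
\<close>

type_synonym ('n, 'k, 'm, 's, 'r) chp_state =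
  "(real^('n \<times> 'n)) \<times> (real^'n) \<times> ('s^'n) \<times> (real^('k + 'm)) \<times> ('r^'k)"

fun chp_dynamics ::
    "('n::finite, 'k::finite, 'm::finite, 's::euclidean_space, 'r::euclidean_space) chp \<Rightarrow>
     'n hp_mode \<Rightarrow> ('n, 'k, 'm, 's, 'r) chp_state \<Rightarrow> ('n, 'k, 'm, 's, 'r) chp_state \<Rightarrow> bool" where
  "chp_dynamics N md (\<eta>, \<omega>, xe, T, xh) (\<eta>d, \<omega>d, xed, Td, xhd) \<longleftrightarrow>
     (\<forall>e. e \<notin> lines N \<longrightarrow> \<eta> $ e = 0) \<and>
     (\<forall>j. j \<notin> gen_buses N \<longrightarrow> xe $ j = 0) \<and>
     (\<forall>k. k \<notin> source_edges N \<longrightarrow> xh $ k = 0) \<and>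
     (\<forall>(i, j)\<in>lines N. \<eta>d $ (i, j) = \<omega> $ i - \<omega> $ j) \<and>
     (\<forall>j\<in>gen_buses N. generation_dynamics (S_e N j) (f_e N j) (\<omega> $ j) (xe $ j) (xed $ j)) \<and>
     (\<forall>k\<in>source_edges N.
        generation_dynamics (S_h N k) (f_h N k) (average_temperature N T) (xh $ k) (xhd $ k)) \<and>
     (\<exists>pP hP. (\<forall>j. j \<notin> pump_buses N \<longrightarrow> pP j = 0) \<and> (\<forall>k. k \<notin> pump_edges N \<longrightarrow> hP k = 0) \<and>
        (\<forall>j\<in>pump_buses N. hP (pump_edge N j) = cop N j * pP j) \<and>
        bus_equations N md \<eta> \<omega> xe T pP \<omega>d \<and> heat_equation N T xh hP Td)"

end

theory Submission
  imports Defs "HOL-Complex_Analysis.Great_Picard"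
begin

text \<open>
  Buses without inertia make the system differential-algebraic. Solving for their frequencies turns
  it into an ordinary differential equation on the constraint set. Relative to every equilibrium \<open>c\<close>
  near the given one there is an energy \<open>V c\<close> that decreases along solutions: in Mode 1 that of the
  electric network, which does not depend on the heating network, in Mode 2 a weighted sum of the
  energies of both networks, in which the power exchanged through the heat pump cancels.

  The energies do not see everything: temperature differences within the heating network and, in
  Mode 1, the whole heating network only converge because they are driven by a converging input.
  Stability is therefore shown by compactness. Were the equilibrium unstable, solutions leaving a
  ball around it, run backwards from their exit points, would accumulate at a complete backward
  trajectory on which \<open>V c\<close> vanishes, and this forces the trajectory to be constant. The same argument
  shows that a bounded solution with an equilibrium \<open>c\<close> in its omega limit set converges to \<open>c\<close>.
  Such a \<open>c\<close> is found by passing repeatedly to limit sets of trajectories in limit sets, each step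
  letting one more group of variables settle.
\<close>

section \<open>Trajectories of vector fields and their limits\<close>

text \<open>Equilibria need not be isolated: the signed sum of the angle differences around a cycle
  of lines is preserved, so a meshed network has a continuum of them. The limit has to be located
  before an energy can be centred at it, hence a whole family \<open>V c\<close>.

  Stability of the generation systems is assumed for frozen inputs only, while along a solution
  frequency and average temperature at best converge. On an omega limit set they are exactly
  constant, so the assumption applies there without any perturbation estimate. This is why limit
  sets are iterated.

  \<open>V c\<close> is only semidefinite, so its sublevel sets do not confine solutions. Its place
  is taken by the rigidity of bounded backward histories: once its input has settled, a dissipative
  subsystem has, backwards in time, a nondecreasing energy. The limit value of this energy is
  attained along a forward trajectory of constant energy, which has to be at the zero level; so the
  energy was zero throughout.\<close>

definition trajectory ::
    "('a::euclidean_space \<Rightarrow> 'a) \<Rightarrow> 'a set \<Rightarrow> real set \<Rightarrow> (real \<Rightarrow> 'a) \<Rightarrow> bool" where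
  "trajectory F K I x \<longleftrightarrow>
     (\<forall>t\<in>I. x t \<in> K \<and> (x has_vector_derivative F (x t)) (at t within I))"

lemma trajectory_in: "trajectory F K I x \<Longrightarrow> t \<in> I \<Longrightarrow> x t \<in> K"
  by (simp add: trajectory_def)

lemma trajectory_deriv:
  "trajectory F K I x \<Longrightarrow> t \<in> I \<Longrightarrow> (x has_vector_derivative F (x t)) (at t within I)"
  by (simp add: trajectory_def)

lemma trajectory_subset:
  assumes "trajectory F K I x" "J \<subseteq> I"
  shows "trajectory F K J x"
  using assms by (auto simp: trajectory_def intro: has_vector_derivative_within_subset)

lemma trajectory_codomain:
  assumes "trajectory F K I x" "\<And>t. t \<in> I \<Longrightarrow> x t \<in> K'"
  shows "trajectory F K' I x"
  using assms by (auto simp: trajectory_def)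

lemma trajectory_mono: "trajectory F K I x \<Longrightarrow> K \<subseteq> K' \<Longrightarrow> trajectory F K' I x"
  by (auto simp: trajectory_def)

lemma trajectory_continuous: "trajectory F K I x \<Longrightarrow> continuous_on I x"
  unfolding trajectory_def continuous_on_eq_continuous_within
  using has_vector_derivative_continuous by blast

lemma trajectory_shift:
  assumes "trajectory F K I x" "(\<lambda>t. a + t) ` J \<subseteq> I"
  shows "trajectory F K J (\<lambda>t. x (a + t))"
  unfolding trajectory_def
proof (intro ballI conjI)
  fix t assume t: "t \<in> J"
  with assms have *: "a + t \<in> I" by auto
  then show "x (a + t) \<in> K" using assms(1) by (simp add: trajectory_def)
  have "(x has_vector_derivative F (x (a + t))) (at (a + t) within (\<lambda>t. a + t) ` J)"
    using trajectory_deriv[OF assms(1) *] assms(2) has_vector_derivative_within_subset by blast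
  then have "((x \<circ> (\<lambda>t. a + t)) has_vector_derivative 1 *\<^sub>R F (x (a + t))) (at t within J)"
    by (intro vector_diff_chain_within) (auto intro!: derivative_eq_intros)
  then show "((\<lambda>t. x (a + t)) has_vector_derivative F (x (a + t))) (at t within J)"
    by (simp add: o_def)
qed

lemma trajectory_reverse:
  assumes "trajectory F K I x" "(\<lambda>t. a - t) ` J \<subseteq> I"
  shows "trajectory (\<lambda>p. - F p) K J (\<lambda>t. x (a - t))"
  unfolding trajectory_def
proof (intro ballI conjI)
  fix t assume t: "t \<in> J"
  with assms have *: "a - t \<in> I" by auto
  then show "x (a - t) \<in> K" using assms(1) by (simp add: trajectory_def)
  have "(x has_vector_derivative F (x (a - t))) (at (a - t) within (\<lambda>t. a - t) ` J)"
    using trajectory_deriv[OF assms(1) *] assms(2) has_vector_derivative_within_subset by blast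
  then have "((x \<circ> (\<lambda>t. a - t)) has_vector_derivative (-1) *\<^sub>R F (x (a - t))) (at t within J)"
    by (intro vector_diff_chain_within) (auto intro!: derivative_eq_intros)
  then show "((\<lambda>t. x (a - t)) has_vector_derivative - F (x (a - t))) (at t within J)"
    by (simp add: o_def)
qed

lemma trajectory_lipschitz:
  assumes "trajectory F K I x" "convex I" "\<And>p. p \<in> K \<Longrightarrow> norm (F p) \<le> L" "0 \<le> L"
  shows "L-lipschitz_on I x"
proof (rule lipschitz_onI)
  fix s t assume st: "s \<in> I" "t \<in> I"
  have "norm (x s - x t) \<le> L * norm (s - t)"
  proof (rule differentiable_bound[OF assms(2) _ _ st])
    fix u assume u: "u \<in> I"
    show "(x has_derivative (\<lambda>h. h *\<^sub>R F (x u))) (at u within I)"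
      using trajectory_deriv[OF assms(1) u] by (simp add: has_vector_derivative_def)
    have "norm (F (x u)) \<le> L" using trajectory_in[OF assms(1) u] assms(3) by auto
    then show "onorm (\<lambda>h. h *\<^sub>R F (x u)) \<le> L"
      by (intro onorm_le) (metis abs_ge_zero mult.commute mult_right_mono norm_scaleR real_norm_def)
  qed
  then show "dist (x s) (x t) \<le> L * dist s t" by (simp add: dist_norm)
qed (rule assms)

lemma trajectory_has_integral:
  assumes "trajectory F K {a..b} x" "a \<le> t" "t \<le> b"
  shows "((\<lambda>s. F (x s)) has_integral x t - x a) {a..t}"
proof (rule fundamental_theorem_of_calculus[OF assms(2)])
  fix s assume s: "s \<in> {a..t}"
  have "(x has_vector_derivative F (x s)) (at s within {a..b})"
    using assms s by (auto simp: trajectory_def)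
  then show "(x has_vector_derivative F (x s)) (at s within {a..t})"
    by (rule has_vector_derivative_within_subset) (use assms in auto)
qed

text \<open>The integral equation, unlike the differential equation, survives pointwise limits.
  Limits of trajectories are recognised as trajectories through this converse of
  \<open>trajectory_has_integral\<close>.\<close>

lemma trajectory_of_integral:
  assumes "continuous_on {0..b} (\<lambda>s. F (x s))"
    and "\<And>t. 0 \<le> t \<Longrightarrow> t \<le> b \<Longrightarrow> x t \<in> K"
    and "\<And>t. 0 \<le> t \<Longrightarrow> t \<le> b \<Longrightarrow> x t = x 0 + integral {0..t} (\<lambda>s. F (x s))"
  shows "trajectory F K {0..b} x"
  unfolding trajectory_def
proof (intro ballI conjI)
  fix t assume t: "t \<in> {0..b}"
  then show "x t \<in> K" using assms(2) by simp
  have "((\<lambda>u. x 0 + integral {0..u} (\<lambda>s. F (x s))) has_vector_derivative F (x t)) (at t within {0..b})"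
    using integral_has_vector_derivative[OF assms(1) t]
    by (intro derivative_eq_intros) auto
  then show "(x has_vector_derivative F (x t)) (at t within {0..b})"
    by (rule has_vector_derivative_transform[OF t, rotated]) (rule assms(3); simp)
qed

lemma trajectory_atLeastI:
  assumes "\<And>b. 0 \<le> b \<Longrightarrow> trajectory F K {0..b} x"
  shows "trajectory F K {0..} x"
  unfolding trajectory_def
proof (intro ballI conjI)
  fix t :: real assume t: "t \<in> {0..}"
  then show "x t \<in> K" using assms[of t] by (auto simp: trajectory_def)
  have "(x has_vector_derivative F (x t)) (at t within {0..t+1})"
    using assms[of "t+1"] t by (auto simp: trajectory_def)
  moreover have "at t within {0..t+1} = at t within {0..}"
    by (rule at_within_nhd[of _ "{..<t+1}"]) auto
  ultimately show "(x has_vector_derivative F (x t)) (at t within {0..})" by simp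
qed

text \<open>Arzela-Ascoli in pointwise form: \<open>function_convergent_subsequence\<close> gives,
  by a diagonal argument, convergence at all nonnegative rationals, and the common Lipschitz
  constant carries it over to every time.\<close>

lemma lipschitz_seq_pointwise_convergent:
  fixes y :: "nat \<Rightarrow> real \<Rightarrow> 'a::euclidean_space"
  assumes K: "compact K"
    and lip: "\<And>n. L-lipschitz_on {0..} (y n)"
    and inK: "\<And>n t. 0 \<le> t \<Longrightarrow> y n t \<in> K"
  obtains r l where "strict_mono (r::nat \<Rightarrow> nat)"
    "\<forall>t\<ge>0. (\<lambda>n. y (r n) t) \<longlonglongrightarrow> l t"
    "\<forall>t\<ge>0. l t \<in> K" "L-lipschitz_on {0..} l"
proof -
  obtain B where B: "\<And>p. p \<in> K \<Longrightarrow> norm p \<le> B"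
    using compact_imp_bounded[OF K] bounded_iff by blast
  define Q where "Q = {t \<in> \<rat>. (0::real) \<le> t}"
  have "countable Q" unfolding Q_def by (rule countable_subset[OF _ countable_rat]) auto
  moreover have "\<And>n t. t \<in> Q \<Longrightarrow> norm (y n t) \<le> B" using inK B by (auto simp: Q_def)
  ultimately obtain r where r: "strict_mono (r::nat \<Rightarrow> nat)"
    and conv: "\<And>t. t \<in> Q \<Longrightarrow> \<exists>l. (\<lambda>n. y (r n) t) \<longlonglongrightarrow> l"
    using function_convergent_subsequence[of Q y B] by metis
  have L0: "0 \<le> L" using lip[of 0] by (rule lipschitz_on_nonneg)
  have "convergent (\<lambda>n. y (r n) t)" if t: "0 \<le> t" for t
  proof (rule Cauchy_convergent, rule metric_CauchyI)
    fix e :: real assume e: "0 < e"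
    \<comment> \<open>Moving from \<open>t\<close> to the rational \<open>q\<close> costs at most
      \<open>e / 4\<close> on either side, the Cauchy estimate at \<open>q\<close> another
      \<open>e / 4\<close>. \<open>L + 1\<close> avoids a division by zero.\<close>
    define d where "d = e / (4 * (L + 1))"
    have d: "0 < d" using e L0 by (auto simp: d_def)
    obtain q where q: "q \<in> \<rat>" "t < q" "q < t + d" using Rats_dense_in_real[of t "t+d"] d by auto
    then have qQ: "q \<in> Q" using t by (auto simp: Q_def)
    have Ld: "L * dist t q \<le> e / 4"
    proof -
      have "L * dist t q \<le> (L + 1) * d" using q L0 d by (intro mult_mono) (auto simp: dist_real_def)
      also have "\<dots> = e / 4" using L0 by (simp add: d_def field_simps)
      finally show ?thesis .
    qed
    have close: "dist (y n t) (y n q) \<le> e / 4" for n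
      using lipschitz_onD[OF lip[of n], of t q] t q Ld by (auto intro: order_trans)
    obtain a where "(\<lambda>n. y (r n) q) \<longlonglongrightarrow> a" using conv[OF qQ] by blast
    then have "Cauchy (\<lambda>n. y (r n) q)" by (rule LIMSEQ_imp_Cauchy)
    then have "\<exists>N. \<forall>m\<ge>N. \<forall>n\<ge>N. dist (y (r m) q) (y (r n) q) < e / 4"
      by (rule metric_CauchyD) (use e in simp)
    then obtain N where N: "\<forall>m\<ge>N. \<forall>n\<ge>N. dist (y (r m) q) (y (r n) q) < e / 4" ..
    show "\<exists>N. \<forall>m\<ge>N. \<forall>n\<ge>N. dist (y (r m) t) (y (r n) t) < e"
    proof (intro exI allI impI)
      fix m n assume mn: "N \<le> m" "N \<le> n"
      have "dist (y (r m) t) (y (r n) t)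
            \<le> dist (y (r m) t) (y (r m) q) + dist (y (r m) q) (y (r n) q) + dist (y (r n) q) (y (r n) t)"
        using dist_triangle[of "y (r m) t" "y (r n) t" "y (r m) q"]
              dist_triangle[of "y (r m) q" "y (r n) t" "y (r n) q"] by simp
      also have "\<dots> < e" using close[of "r m"] close[of "r n"] N[rule_format, OF mn] e by (simp add: dist_commute)
      finally show "dist (y (r m) t) (y (r n) t) < e" .
    qed
  qed
  then have lim: "(\<lambda>n. y (r n) t) \<longlonglongrightarrow> lim (\<lambda>n. y (r n) t)" if "0 \<le> t" for t
    using that convergent_LIMSEQ_iff by blast
  show thesis
  proof (rule that[OF r])
    show "\<forall>t\<ge>0. (\<lambda>n. y (r n) t) \<longlonglongrightarrow> lim (\<lambda>n. y (r n) t)" using lim by blast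
  next
    have "lim (\<lambda>n. y (r n) t) \<in> K" if t: "0 \<le> t" for t
      by (rule closed_sequentially[OF compact_imp_closed[OF K] _ lim[OF t]]) (use inK t in auto)
    then show "\<forall>t\<ge>0. lim (\<lambda>n. y (r n) t) \<in> K" by blast
  next
    show "L-lipschitz_on {0..} (\<lambda>t. lim (\<lambda>n. y (r n) t))"
    proof (rule lipschitz_onI[OF _ L0])
      fix s t :: real assume st: "s \<in> {0..}" "t \<in> {0..}"
      have "(\<lambda>n. dist (y (r n) s) (y (r n) t)) \<longlonglongrightarrow> dist (lim (\<lambda>n. y (r n) s)) (lim (\<lambda>n. y (r n) t))"
        by (intro tendsto_dist lim) (use st in auto)
      then show "dist (lim (\<lambda>n. y (r n) s)) (lim (\<lambda>n. y (r n) t)) \<le> L * dist s t"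
        by (rule LIMSEQ_le_const2) (use lipschitz_onD[OF lip st] in auto)
    qed
  qed
qed

text \<open>Dominated convergence passes the integral equation to the limit. The \<open>y n\<close>
  have to satisfy it only up to a vanishing error. This is asked separately for each
  \<open>t\<close>, because the Tonelli approximations below satisfy it only up to time 1.\<close>

lemma approximate_trajectories_limit:
  fixes y :: "nat \<Rightarrow> real \<Rightarrow> 'a::euclidean_space"
  assumes K: "compact K" and F: "continuous_on K F"
    and lip: "\<And>n. L-lipschitz_on {0..} (y n)"
    and inK: "\<And>n t. 0 \<le> t \<Longrightarrow> y n t \<in> K"
  obtains r l where "strict_mono (r::nat \<Rightarrow> nat)"
    "\<forall>t\<ge>0. (\<lambda>n. y (r n) t) \<longlonglongrightarrow> l t"
    "\<forall>t\<ge>0. l t \<in> K" "continuous_on {0..} l"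
    "\<forall>t\<ge>0. (\<lambda>n. y n t - y n 0 - integral {0..t} (\<lambda>s. F (y n s))) \<longlonglongrightarrow> 0
       \<longrightarrow> l t = l 0 + integral {0..t} (\<lambda>s. F (l s))"
proof -
  obtain r l where r: "strict_mono (r::nat \<Rightarrow> nat)"
    and l: "\<forall>t\<ge>0. (\<lambda>n. y (r n) t) \<longlonglongrightarrow> l t"
    and lK: "\<forall>t\<ge>0. l t \<in> K" and lipl: "L-lipschitz_on {0..} l"
    by (rule lipschitz_seq_pointwise_convergent[where y = y, OF K lip inK])
  obtain B where B: "\<And>p. p \<in> K \<Longrightarrow> norm (F p) \<le> B"
    using compact_imp_bounded[OF compact_continuous_image[OF F K]] by (auto simp: bounded_iff)
  show thesis
  proof (rule that[OF r l lK lipschitz_on_continuous_on[OF lipl]], intro allI impI)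
    fix t :: real
    assume t: "0 \<le> t" and err: "(\<lambda>n. y n t - y n 0 - integral {0..t} (\<lambda>s. F (y n s))) \<longlonglongrightarrow> 0"
    have int: "(\<lambda>n. integral {0..t} (\<lambda>s. F (y (r n) s))) \<longlonglongrightarrow> integral {0..t} (\<lambda>s. F (l s))"
    proof (rule dominated_convergence(2)[where h = "\<lambda>_. B"])
      show "(\<lambda>s. F (y (r n) s)) integrable_on {0..t}" for n
      proof (rule integrable_continuous_real)
        have "continuous_on {0..t} (y (r n))"
          using lipschitz_on_continuous_on[OF lip] by (rule continuous_on_subset) auto
        then show "continuous_on {0..t} (\<lambda>s. F (y (r n) s))"
          by (rule continuous_on_compose2[OF F]) (use inK in auto)
      qed
      show "norm (F (y (r n) s)) \<le> B" if "s \<in> {0..t}" for n s using B inK that by auto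
      show "(\<lambda>n. F (y (r n) s)) \<longlonglongrightarrow> F (l s)" if "s \<in> {0..t}" for s
        by (rule continuous_on_tendsto_compose[OF F l[rule_format]]) (use that inK lK in auto)
    qed auto
    have "(\<lambda>n. y (r n) t - y (r n) 0 - integral {0..t} (\<lambda>s. F (y (r n) s))) \<longlonglongrightarrow> 0"
      using LIMSEQ_subseq_LIMSEQ[OF err r] by (simp add: o_def)
    moreover have "(\<lambda>n. y (r n) t - y (r n) 0 - integral {0..t} (\<lambda>s. F (y (r n) s)))
        \<longlonglongrightarrow> l t - l 0 - integral {0..t} (\<lambda>s. F (l s))"
      by (intro tendsto_diff l[rule_format] int) (use t in auto)
    ultimately have "l t - l 0 - integral {0..t} (\<lambda>s. F (l s)) = 0" using LIMSEQ_unique by blast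
    then show "l t = l 0 + integral {0..t} (\<lambda>s. F (l s))" by (simp add: algebra_simps)
  qed
qed

text \<open>Pieces of different lengths are made comparable by freezing each at its end point. After
  time \<open>s n\<close> a frozen piece violates the integral equation by \<open>t - s n\<close>
  times the final velocity, so it is enough that the pieces shorter than \<open>t\<close> end with
  velocities tending to zero.\<close>

lemma trajectories_limit:
  fixes w :: "nat \<Rightarrow> real \<Rightarrow> 'a::euclidean_space"
  assumes K: "compact K" and F: "continuous_on K F"
    and w: "\<And>n. trajectory F K {0..s n} (w n)" and s: "\<And>n. 0 \<le> s n"
    and fin: "\<And>t. (\<lambda>n. if t \<le> s n then 0 else norm (F (w n (s n)))) \<longlonglongrightarrow> 0"
  obtains r l where "strict_mono (r::nat \<Rightarrow> nat)"
    "\<forall>t\<ge>0. (\<lambda>n. w (r n) (min t (s (r n)))) \<longlonglongrightarrow> l t"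
    "trajectory F K {0..} l"
proof -
  define y where "y n t = w n (min t (s n))" for n t
  obtain L where L: "\<And>p. p \<in> K \<Longrightarrow> norm (F p) \<le> L"
    using compact_imp_bounded[OF compact_continuous_image[OF F K]] by (auto simp: bounded_iff)
  have L0: "0 \<le> L"
  proof -
    have "w 0 0 \<in> K" using trajectory_in[OF w[of 0], of 0] s by auto
    then show ?thesis using L norm_ge_zero order_trans by blast
  qed
  have inK: "y n t \<in> K" if "0 \<le> t" for n t
    unfolding y_def by (rule trajectory_in[OF w]) (use that s in auto)
  have lip: "L-lipschitz_on {0..} (y n)" for n
  proof (rule lipschitz_onI[OF _ L0])
    fix a b :: real assume ab: "a \<in> {0..}" "b \<in> {0..}"
    have "dist (y n a) (y n b) \<le> L * dist (min a (s n)) (min b (s n))"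
      unfolding y_def
      by (rule lipschitz_onD[OF trajectory_lipschitz[OF w _ L L0]]) (use ab s in auto)
    also have "\<dots> \<le> L * dist a b" using L0 by (intro mult_left_mono) (auto simp: dist_real_def)
    finally show "dist (y n a) (y n b) \<le> L * dist a b" .
  qed
  have err: "(\<lambda>n. y n t - y n 0 - integral {0..t} (\<lambda>\<sigma>. F (y n \<sigma>))) \<longlonglongrightarrow> 0" if t: "0 \<le> t" for t
  proof -
    have int: "integral {0..t} (\<lambda>\<sigma>. F (y n \<sigma>)) =
        (y n t - y n 0) + (if t \<le> s n then 0 else (t - s n) *\<^sub>R F (w n (s n)))" for n
    proof (cases "t \<le> s n")
      case True
      have "((\<lambda>\<sigma>. F (w n \<sigma>)) has_integral w n t - w n 0) {0..t}"
        by (rule trajectory_has_integral[OF w t True])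
      then have "((\<lambda>\<sigma>. F (y n \<sigma>)) has_integral w n t - w n 0) {0..t}"
        by (rule has_integral_eq[rotated]) (use True in \<open>auto simp: y_def min_def\<close>)
      then show ?thesis using True s[of n] t by (auto simp: y_def dest: integral_unique)
    next
      case False
      have "((\<lambda>\<sigma>. F (w n \<sigma>)) has_integral w n (s n) - w n 0) {0..s n}"
        by (rule trajectory_has_integral[OF w s order_refl])
      then have 1: "((\<lambda>\<sigma>. F (y n \<sigma>)) has_integral w n (s n) - w n 0) {0..s n}"
        by (rule has_integral_eq[rotated]) (auto simp: y_def min_def)
      have "((\<lambda>\<sigma>. F (w n (s n))) has_integral (t - s n) *\<^sub>R F (w n (s n))) {s n..t}"
        using has_integral_const_real[of "F (w n (s n))" "s n" t] False by simp
      then have 2: "((\<lambda>\<sigma>. F (y n \<sigma>)) has_integral (t - s n) *\<^sub>R F (w n (s n))) {s n..t}"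
        by (rule has_integral_eq[rotated]) (auto simp: y_def min_def)
      have "((\<lambda>\<sigma>. F (y n \<sigma>)) has_integral (w n (s n) - w n 0) + (t - s n) *\<^sub>R F (w n (s n))) {0..t}"
        by (rule has_integral_combine[OF _ _ 1 2]) (use False s in auto)
      then show ?thesis using False s[of n] by (auto simp: y_def dest: integral_unique)
    qed
    have "norm (y n t - y n 0 - integral {0..t} (\<lambda>\<sigma>. F (y n \<sigma>)))
        \<le> t * (if t \<le> s n then 0 else norm (F (w n (s n))))" for n
      unfolding int using s[of n] t by (auto intro!: mult_right_mono)
    moreover have "(\<lambda>n. t * (if t \<le> s n then 0 else norm (F (w n (s n))))) \<longlonglongrightarrow> 0"
      using tendsto_mult_left[OF fin[of t], of t] by simp
    ultimately show ?thesis by (rule Lim_null_comparison[OF always_eventually[OF allI]])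
  qed
  obtain r l where r: "strict_mono (r::nat \<Rightarrow> nat)"
    and l: "\<forall>t\<ge>0. (\<lambda>n. y (r n) t) \<longlonglongrightarrow> l t"
    and lK: "\<forall>t\<ge>0. l t \<in> K" and lc: "continuous_on {0..} l"
    and leq: "\<forall>t\<ge>0. (\<lambda>n. y n t - y n 0 - integral {0..t} (\<lambda>s. F (y n s))) \<longlonglongrightarrow> 0
       \<longrightarrow> l t = l 0 + integral {0..t} (\<lambda>s. F (l s))"
    by (rule approximate_trajectories_limit[where y = y, OF K F lip inK])
  have "trajectory F K {0..} l"
  proof (rule trajectory_atLeastI, rule trajectory_of_integral)
    fix b :: real assume "0 \<le> b"
    show "continuous_on {0..b} (\<lambda>s. F (l s))"
      by (rule continuous_on_compose2[OF F continuous_on_subset[OF lc]]) (use lK in auto)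
    show "l t \<in> K" if "0 \<le> t" for t using lK that by blast
    show "l t = l 0 + integral {0..t} (\<lambda>s. F (l s))" if "0 \<le> t" for t
      using leq err that by blast
  qed
  moreover have "\<forall>t\<ge>0. (\<lambda>n. w (r n) (min t (s (r n)))) \<longlonglongrightarrow> l t"
    using l unfolding y_def .
  ultimately show thesis using that r by blast
qed

lemma long_trajectories_limit:
  fixes w :: "nat \<Rightarrow> real \<Rightarrow> 'a::euclidean_space"
  assumes K: "compact K" and F: "continuous_on K F"
    and w: "\<And>n. trajectory F K {0..s n} (w n)" and s: "\<And>n. 0 \<le> s n"
    and top: "filterlim s at_top sequentially"
  obtains r l where "strict_mono (r::nat \<Rightarrow> nat)"
    "\<forall>t\<ge>0. (\<lambda>n. w (r n) (min t (s (r n)))) \<longlonglongrightarrow> l t"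
    "trajectory F K {0..} l"
proof -
  have fin: "(\<lambda>n. if t \<le> s n then 0 else norm (F (w n (s n)))) \<longlonglongrightarrow> 0" for t
  proof (rule tendsto_eventually)
    have "eventually (\<lambda>n. t \<le> s n) sequentially" using top by (simp add: filterlim_at_top)
    then show "eventually (\<lambda>n. (if t \<le> s n then 0 else norm (F (w n (s n)))) = 0) sequentially"
      by eventually_elim simp
  qed
  obtain r l where "strict_mono (r::nat \<Rightarrow> nat)"
    "\<forall>t\<ge>0. (\<lambda>n. w (r n) (min t (s (r n)))) \<longlonglongrightarrow> l t" "trajectory F K {0..} l"
    by (rule trajectories_limit[where w = w and s = s, OF K F w s fin])
  then show thesis by (rule that)
qed

section \<open>Existence of trajectories\<close>

text \<open>A vector orthogonal to \<open>S\<close> is orthogonal to all values of \<open>f\<close>,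
  hence to the integral, and a subspace is its own double orthogonal complement.\<close>

lemma integral_in_subspace:
  fixes f :: "'b::euclidean_space \<Rightarrow> 'a::euclidean_space"
  assumes "subspace S" "f integrable_on A" "\<And>s. f s \<in> S"
  shows "integral A f \<in> S"
proof -
  have "integral A f \<in> S\<^sup>\<bottom>\<^sup>\<bottom>"
    unfolding orthogonal_comp_def[of "S\<^sup>\<bottom>"]
  proof (intro CollectI ballI)
    fix w assume "w \<in> S\<^sup>\<bottom>"
    then have "(\<lambda>v. w \<bullet> v) \<circ> f = (\<lambda>_. 0)"
      using assms(3) by (force simp: orthogonal_comp_def orthogonal_def inner_commute)
    then show "orthogonal w (integral A f)"
      using integral_linear[OF assms(2) bounded_linear_inner_right[of w]]
      by (simp add: orthogonal_def)
  qed
  then show ?thesis using orthogonal_comp_self[OF assms(1)] by simp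
qed

text \<open>Tonelli's approximations, in which the right-hand side is evaluated with delay
  \<open>h\<close>. The counter \<open>k\<close> unrolls the delay equation and makes the recursion
  structural. For \<open>t \<le> 0\<close> the integral over \<open>{0..t}\<close> is zero, which
  supplies the constant history \<open>p\<close>.\<close>

fun tonelli :: "('a::euclidean_space \<Rightarrow> 'a) \<Rightarrow> 'a \<Rightarrow> real \<Rightarrow> nat \<Rightarrow> real \<Rightarrow> 'a" where
  "tonelli G p h 0 t = p"
| "tonelli G p h (Suc k) t = p + integral {0..t} (\<lambda>s. G (tonelli G p h k (s - h)))"

lemma tonelli_lipschitz:
  fixes G :: "'a::euclidean_space \<Rightarrow> 'a"
  assumes G: "continuous_on UNIV G" and B: "\<And>q. norm (G q) \<le> B"
  shows "B-lipschitz_on UNIV (tonelli G p h k)"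
proof (induction k)
  have B0: "0 \<le> B" using B norm_ge_zero order_trans by blast
  case 0
  show ?case using B0 by (intro lipschitz_onI) auto
next
  have B0: "0 \<le> B" using B norm_ge_zero order_trans by blast
  case (Suc k)
  define g where "g = (\<lambda>s. G (tonelli G p h k (s - h)))"
  have g: "continuous_on A g" for A
    unfolding g_def
    by (intro continuous_on_compose2[OF G] continuous_on_compose2[OF lipschitz_on_continuous_on[OF Suc]]
        continuous_intros) auto
  have pos: "norm (integral {0..b} g - integral {0..a} g) \<le> B * (b - a)" if "0 \<le> a" "a \<le> b" for a b
  proof -
    have "integral {0..a} g + integral {a..b} g = integral {0..b} g"
      by (rule Henstock_Kurzweil_Integration.integral_combine[OF that])
        (intro integrable_continuous_real g)
    moreover have "norm (integral {a..b} g) \<le> B * (b - a)"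
      by (rule integral_bound[OF that(2) g]) (simp add: g_def B)
    ultimately show ?thesis by (metis add_diff_cancel_left')
  qed
  have eq: "tonelli G p h (Suc k) t = p + integral {0..max t 0} g" for t
    by (cases t "0::real" rule: linorder_cases) (auto simp: g_def)
  have le: "dist (tonelli G p h (Suc k) a) (tonelli G p h (Suc k) b) \<le> B * dist a b" if "a \<le> b" for a b
  proof -
    have "dist (tonelli G p h (Suc k) a) (tonelli G p h (Suc k) b)
        = norm (integral {0..max b 0} g - integral {0..max a 0} g)"
      unfolding eq by (simp add: dist_norm norm_minus_commute)
    also have "\<dots> \<le> B * (max b 0 - max a 0)" by (rule pos) (use that in auto)
    also have "\<dots> \<le> B * dist a b" using B0 that by (intro mult_left_mono) (auto simp: dist_real_def)
    finally show ?thesis .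
  qed
  show ?case
  proof (rule lipschitz_onI[OF _ B0])
    fix a b :: real
    show "dist (tonelli G p h (Suc k) a) (tonelli G p h (Suc k) b) \<le> B * dist a b"
      using le[of a b] le[of b a] by (cases "a \<le> b") (auto simp: dist_commute)
  qed
qed

text \<open>An iterate uses its predecessor only at times at least \<open>h\<close> earlier, so
  every iteration makes the function final on one more interval of length \<open>h\<close>.\<close>

lemma tonelli_stable:
  assumes "0 \<le> h"
  shows "t \<le> real k * h \<Longrightarrow> tonelli G p h (Suc k) t = tonelli G p h k t"
proof (induction k arbitrary: t)
  case 0
  then show ?case by (cases "t = 0") auto
next
  case (Suc k)
  have "tonelli G p h (Suc k) (s - h) = tonelli G p h k (s - h)" if "s \<in> {0..t}" for s
    by (rule Suc.IH) (use that Suc.prems in \<open>auto simp: algebra_simps\<close>)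
  then have "integral {0..t} (\<lambda>s. G (tonelli G p h (Suc k) (s - h)))
      = integral {0..t} (\<lambda>s. G (tonelli G p h k (s - h)))"
    by (intro Henstock_Kurzweil_Integration.integral_cong) (simp del: tonelli.simps)
  then show ?case using tonelli.simps(2) by metis
qed

text \<open>The approximations with delays \<open>h n\<close> share the Lipschitz constant
  \<open>B\<close>, and a limit of them solves the equation without delay. Composition with the
  projection onto \<open>C\<close> makes the field bounded and defined everywhere; its values still
  lie in \<open>S\<close>, which keeps the limit in \<open>S\<close>.\<close>

lemma peano_existence:
  fixes F :: "'a::euclidean_space \<Rightarrow> 'a"
  assumes S: "subspace S" and F: "continuous_on S F" and FS: "\<And>p. p \<in> S \<Longrightarrow> F p \<in> S" and p: "p \<in> S"
  obtains e x where "0 < e" "x 0 = p" "trajectory F S {0..e} x"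
proof -
  define C where "C = cball p 1 \<inter> S"
  have pC: "p \<in> C" using p by (simp add: C_def)
  have "closed C" using closed_subspace[OF S] by (auto simp: C_def)
  then have C: "compact C" "convex C" "C \<noteq> {}" "C \<subseteq> S" "closed C"
    using pC subspace_imp_convex[OF S] convex_Int[OF convex_cball]
      compact_Int_closed[OF compact_cball closed_subspace[OF S]] unfolding C_def by blast+
  define G where "G = F \<circ> closest_point C"
  have cpC: "closest_point C q \<in> C" for q using closest_point_in_set[OF C(5,3)] .
  have GS: "G q \<in> S" for q using cpC C(4) FS by (auto simp: G_def)
  have FC: "continuous_on C F" using F C(4) continuous_on_subset by blast
  have contG: "continuous_on A G" for A
    unfolding G_def o_def
    by (rule continuous_on_compose2[OF FC continuous_on_closest_point[OF C(2,5,3)]]) (use cpC in auto)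
  obtain B0 where B0: "\<And>q. q \<in> C \<Longrightarrow> norm (F q) \<le> B0"
    using compact_imp_bounded[OF compact_continuous_image[OF FC C(1)]] by (auto simp: bounded_iff)
  define B where "B = max B0 1"
  have B1: "1 \<le> B" by (simp add: B_def)
  have B: "norm (G q) \<le> B" for q using B0[OF cpC[of q]] by (auto simp: G_def B_def)
  define h where "h n = 1 / real (Suc n)" for n
  have h: "0 < h n" for n by (simp add: h_def)
  \<comment> \<open>By \<open>tonelli_stable\<close> the iterates \<open>Suc n\<close> and
    \<open>Suc (Suc n)\<close> agree up to time \<open>Suc n * h n = 1\<close>, so up to then
    \<open>y n\<close> satisfies the delay equation itself.\<close>
  define y where "y n = tonelli G p (h n) (Suc (Suc n))" for n
  have lip: "B-lipschitz_on UNIV (y n)" for n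
    unfolding y_def by (rule tonelli_lipschitz[OF contG B])
  have y0: "y n 0 = p" for n by (simp add: y_def)
  have yeq: "y n t = p + integral {0..t} (\<lambda>s. G (y n (s - h n)))" if "t \<le> 1" for n t
  proof -
    have "tonelli G p (h n) (Suc n) (s - h n) = y n (s - h n)" if "s \<in> {0..t}" for s
      unfolding y_def
    proof (rule tonelli_stable[symmetric])
      have "real (Suc n) * h n = 1" by (simp add: h_def)
      then show "s - h n \<le> real (Suc n) * h n" using h[of n] that \<open>t \<le> 1\<close> by simp
    qed (use h[of n] in simp)
    then have "integral {0..t} (\<lambda>s. G (tonelli G p (h n) (Suc n) (s - h n)))
      = integral {0..t} (\<lambda>s. G (y n (s - h n)))"
      by (intro Henstock_Kurzweil_Integration.integral_cong) (simp del: tonelli.simps)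
    then show ?thesis unfolding y_def using tonelli.simps(2) by metis
  qed
  \<comment> \<open>Freezing at time 1 gives functions on the whole half-line, as
    \<open>approximate_trajectories_limit\<close> expects; having speed at most \<open>B\<close>,
    they stay in \<open>cball p B\<close>.\<close>
  define w where "w n t = y n (min t 1)" for n t
  define K where "K = cball p B"
  have yK: "y n t \<in> K" if "\<bar>t\<bar> \<le> 1" for n t
  proof -
    have "dist (y n 0) (y n t) \<le> B * dist 0 t" using lipschitz_onD[OF lip] by blast
    also have "\<dots> \<le> B * 1" using that B1 by (intro mult_left_mono) (auto simp: dist_real_def)
    finally show ?thesis by (simp add: K_def y0)
  qed
  have wK: "w n t \<in> K" if "0 \<le> t" for n t unfolding w_def by (rule yK) (use that in auto)
  have wlip: "B-lipschitz_on {0..} (w n)" for n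
  proof (rule lipschitz_onI)
    fix a b :: real
    have "dist (w n a) (w n b) \<le> B * dist (min a 1) (min b 1)"
      unfolding w_def using lipschitz_onD[OF lip] by blast
    also have "\<dots> \<le> B * dist a b" using B1 by (intro mult_left_mono) (auto simp: dist_real_def)
    finally show "dist (w n a) (w n b) \<le> B * dist a b" .
  qed (use B1 in auto)
  have compK: "compact K" by (simp add: K_def)
  obtain r l where r: "strict_mono (r::nat \<Rightarrow> nat)"
    and l: "\<forall>t\<ge>0. (\<lambda>n. w (r n) t) \<longlonglongrightarrow> l t"
    and lK: "\<forall>t\<ge>0. l t \<in> K" and lc: "continuous_on {0..} l"
    and leq: "\<forall>t\<ge>0. (\<lambda>n. w n t - w n 0 - integral {0..t} (\<lambda>s. G (w n s))) \<longlonglongrightarrow> 0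
       \<longrightarrow> l t = l 0 + integral {0..t} (\<lambda>s. G (l s))"
    by (rule approximate_trajectories_limit[where y = w, OF compK contG wlip wK])
  have l0: "l 0 = p"
  proof -
    have "(\<lambda>n. w (r n) 0) \<longlonglongrightarrow> p" by (simp add: w_def y0)
    then show ?thesis using l LIMSEQ_unique by blast
  qed
  \<comment> \<open>The delay moves the argument of \<open>G\<close> by at most
    \<open>B * h n\<close>, and \<open>G\<close> is uniformly continuous on
    \<open>K\<close>.\<close>
  have err: "(\<lambda>n. w n t - w n 0 - integral {0..t} (\<lambda>s. G (w n s))) \<longlonglongrightarrow> 0"
    if t: "0 \<le> t" "t \<le> 1" for t
  proof (rule LIMSEQ_I)
    fix e :: real assume e: "0 < e"
    obtain d where d: "0 < d"
      and uc: "\<And>a b. a \<in> K \<Longrightarrow> b \<in> K \<Longrightarrow> dist b a < d \<Longrightarrow> dist (G b) (G a) < e / 2"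
      using compact_uniformly_continuous[OF contG compK] e
      unfolding uniformly_continuous_on_def by (metis half_gt_zero)
    obtain n0 where n0: "inverse (real (Suc n0)) < d / B" using reals_Archimedean[of "d / B"] d B1 by auto
    show "\<exists>n0. \<forall>n\<ge>n0. norm (w n t - w n 0 - integral {0..t} (\<lambda>s. G (w n s)) - 0) < e"
    proof (intro exI allI impI)
      fix n assume n: "n0 \<le> n"
      have "h n \<le> inverse (real (Suc n0))" using n by (simp add: h_def field_simps)
      then have "h n < d / B" using n0 by linarith
      then have hn: "B * h n < d" using B1 by (simp add: field_simps)
      have hn1: "h n \<le> 1" by (simp add: h_def)
      have cy: "continuous_on A (y n)" for A
        using lipschitz_on_continuous_on[OF lip] continuous_on_subset by blast
      have c1: "continuous_on {0..t} (\<lambda>s. G (y n (s - h n)))"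
        by (intro continuous_on_compose2[OF contG[of UNIV]] continuous_on_compose2[OF cy[of UNIV]]
            continuous_intros) auto
      have c2: "continuous_on {0..t} (\<lambda>s. G (y n s))"
        by (intro continuous_on_compose2[OF contG[of UNIV]] cy) auto
      have "integral {0..t} (\<lambda>s. G (w n s)) = integral {0..t} (\<lambda>s. G (y n s))"
        by (rule Henstock_Kurzweil_Integration.integral_cong) (use t in \<open>auto simp: w_def min_def\<close>)
      then have "w n t - w n 0 - integral {0..t} (\<lambda>s. G (w n s))
          = integral {0..t} (\<lambda>s. G (y n (s - h n))) - integral {0..t} (\<lambda>s. G (y n s))"
        using yeq[OF t(2), of n] t y0 by (simp add: w_def min_def)
      also have "\<dots> = integral {0..t} (\<lambda>s. G (y n (s - h n)) - G (y n s))"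
        by (rule integral_diff[symmetric]) (intro integrable_continuous_real c1 c2)+
      also have "norm \<dots> \<le> e / 2 * (t - 0)"
      proof (rule integral_bound[OF t(1)])
        show "continuous_on {0..t} (\<lambda>s. G (y n (s - h n)) - G (y n s))"
          by (intro continuous_intros c1 c2)
        fix s assume s: "s \<in> {0..t}"
        have "dist (y n (s - h n)) (y n s) \<le> B * dist (s - h n) s" using lipschitz_onD[OF lip] by blast
        also have "\<dots> < d" using hn h[of n] by (simp add: dist_real_def)
        finally have "dist (G (y n (s - h n))) (G (y n s)) < e / 2"
          by (intro uc yK) (use s t hn1 h[of n] in auto)
        then show "norm (G (y n (s - h n)) - G (y n s)) \<le> e / 2" by (simp add: dist_norm)
      qed
      also have "\<dots> < e"
      proof -
        have "e / 2 * t \<le> e / 2 * 1" using t e by (intro mult_left_mono) auto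
        then show ?thesis using e by simp
      qed
      finally show "norm (w n t - w n 0 - integral {0..t} (\<lambda>s. G (w n s)) - 0) < e" by simp
    qed
  qed
  have lt: "l t = p + integral {0..t} (\<lambda>s. G (l s))" if "0 \<le> t" "t \<le> 1" for t
    using leq[rule_format, OF that(1) err[OF that]] unfolding l0 .
  have cGl: "continuous_on {0..t} (\<lambda>s. G (l s))" for t
    by (rule continuous_on_compose2[OF contG[of UNIV] continuous_on_subset[OF lc]]) auto
  \<comment> \<open>With speed at most \<open>B\<close> the limit cannot leave the ball of radius 1
    before time \<open>1 / B\<close>; until then it lies in \<open>C\<close>, where the projection
    is the identity.\<close>
  define e where "e = 1 / B"
  have e: "0 < e" "e \<le> 1" using B1 by (auto simp: e_def)
  have lC: "l t \<in> C" if t: "0 \<le> t" "t \<le> e" for t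
  proof -
    have t1: "t \<le> 1" using t e by simp
    have iS: "integral {0..t} (\<lambda>s. G (l s)) \<in> S"
      by (intro integral_in_subspace[OF S] integrable_continuous_real cGl GS)
    have "norm (integral {0..t} (\<lambda>s. G (l s))) \<le> B * (t - 0)"
      by (rule integral_bound[OF t(1) cGl B])
    also have "\<dots> \<le> 1" using t B1 by (simp add: e_def field_simps)
    finally have "norm (l t - p) \<le> 1" unfolding lt[OF t(1) t1] by simp
    moreover have "l t \<in> S" unfolding lt[OF t(1) t1] using S p iS by (rule subspace_add)
    ultimately show ?thesis by (simp add: C_def dist_norm norm_minus_commute)
  qed
  have GF: "G (l t) = F (l t)" if "0 \<le> t" "t \<le> e" for t
    using closest_point_self[OF lC[OF that]] by (simp add: G_def)
  have "trajectory F S {0..e} l"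
  proof (rule trajectory_of_integral)
    show "continuous_on {0..e} (\<lambda>s. F (l s))"
      by (rule continuous_on_cong[THEN iffD1, OF refl _ cGl]) (use GF in auto)
    show "l t \<in> S" if "0 \<le> t" "t \<le> e" for t using lC[OF that] C(4) by auto
    show "l t = l 0 + integral {0..t} (\<lambda>s. F (l s))" if t: "0 \<le> t" "t \<le> e" for t
    proof -
      have "integral {0..t} (\<lambda>s. F (l s)) = integral {0..t} (\<lambda>s. G (l s))"
        by (rule Henstock_Kurzweil_Integration.integral_cong) (use GF t in auto)
      moreover have "t \<le> 1" using t e by simp
      ultimately show ?thesis using lt[OF t(1)] l0 by metis
    qed
  qed
  with e(1) l0 show thesis using that by blast
qed

section \<open>Limit sets\<close>

text \<open>Integer tails suffice because the tails are nested. The set belongs to a single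
  function, not to a flow, so that no uniqueness of trajectories enters.\<close>

definition omega_limit :: "(real \<Rightarrow> 'a::metric_space) \<Rightarrow> 'a set" where
  "omega_limit x = (\<Inter>n::nat. closure (x ` {real n..}))"

lemma closed_omega_limit: "closed (omega_limit x)"
  by (auto simp: omega_limit_def)

lemma omega_limit_sequenceE:
  assumes "q \<in> omega_limit x"
  obtains \<tau> :: "nat \<Rightarrow> real" where "\<And>n. real n \<le> \<tau> n" "(\<lambda>n. x (\<tau> n)) \<longlonglongrightarrow> q"
proof -
  have "\<exists>t\<ge>real n. dist (x t) q < inverse (real (Suc n))" for n
  proof -
    have "q \<in> closure (x ` {real n..})" using assms by (auto simp: omega_limit_def)
    then obtain p where "p \<in> x ` {real n..}" "dist p q < inverse (real (Suc n))"
      unfolding closure_approachable by (metis inverse_positive_iff_positive of_nat_0_less_iff zero_less_Suc)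
    then show ?thesis by auto
  qed
  then obtain \<tau> where \<tau>: "\<And>n. real n \<le> \<tau> n" "\<And>n. dist (x (\<tau> n)) q < inverse (real (Suc n))" by metis
  have "(\<lambda>n. x (\<tau> n)) \<longlonglongrightarrow> q"
    by (rule tendsto_dist_iff[THEN iffD2],
        rule tendsto_sandwich[OF _ _ tendsto_const LIMSEQ_inverse_real_of_nat])
      (intro always_eventually allI zero_le_dist less_imp_le \<tau>(2))+
  with \<tau>(1) show thesis by (rule that)
qed

lemma omega_limitI:
  assumes "filterlim \<tau> at_top sequentially" "(\<lambda>n. x (\<tau> n)) \<longlonglongrightarrow> q"
  shows "q \<in> omega_limit x"
  unfolding omega_limit_def
proof (intro INT_I)
  fix m :: nat
  have ev: "eventually (\<lambda>n. real m \<le> \<tau> n) sequentially"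
    using assms(1) by (simp add: filterlim_at_top)
  show "q \<in> closure (x ` {real m..})"
    by (rule Lim_in_closed_set[OF closed_closure _ _ assms(2)])
      (use ev in \<open>auto elim!: eventually_mono intro!: closure_subset[THEN subsetD]\<close>)
qed

lemma omega_limit_subset:
  assumes "closed K" "\<And>t. 0 \<le> t \<Longrightarrow> x t \<in> K"
  shows "omega_limit x \<subseteq> K"
proof -
  have "x ` {real 0..} \<subseteq> K" using assms(2) by auto
  then have "closure (x ` {real 0..}) \<subseteq> K" using assms(1) by (rule closure_minimal)
  then show ?thesis unfolding omega_limit_def by blast
qed

lemma omega_limit_nonempty:
  assumes "compact K" "\<And>t. 0 \<le> t \<Longrightarrow> x t \<in> K"
  shows "omega_limit x \<noteq> {}"
proof -
  have "\<forall>n. x (real n) \<in> K" using assms(2) by simp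
  then obtain q r where "strict_mono (r::nat \<Rightarrow> nat)" and q: "((\<lambda>n. x (real n)) \<circ> r) \<longlonglongrightarrow> q"
    using assms(1)[unfolded compact_def, rule_format, of "\<lambda>n. x (real n)"] by blast
  then have "filterlim (\<lambda>n. real (r n)) at_top sequentially"
    using filterlim_subseq filterlim_compose[OF filterlim_real_sequentially] by blast
  then have "q \<in> omega_limit x" by (rule omega_limitI) (use q in \<open>simp add: o_def\<close>)
  then show ?thesis by auto
qed

lemma omega_limit_eq_limit:
  fixes \<Phi> :: "'a::metric_space \<Rightarrow> 'b::t2_space"
  assumes "closed K" "\<And>t. 0 \<le> t \<Longrightarrow> x t \<in> K" "continuous_on K \<Phi>"
    and "((\<lambda>t. \<Phi> (x t)) \<longlongrightarrow> c) at_top" "q \<in> omega_limit x"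
  shows "\<Phi> q = c"
proof -
  obtain \<tau> where \<tau>: "\<And>n. real n \<le> \<tau> n" "(\<lambda>n. x (\<tau> n)) \<longlonglongrightarrow> q"
    using omega_limit_sequenceE[OF assms(5)] by blast
  have top: "filterlim \<tau> at_top sequentially"
    by (rule filterlim_at_top_mono[OF filterlim_real_sequentially]) (use \<tau>(1) in auto)
  have pos: "0 \<le> \<tau> n" for n by (rule order_trans[OF of_nat_0_le_iff \<tau>(1)])
  have qK: "q \<in> K" using omega_limit_subset[where x = x, OF assms(1,2)] assms(5) by blast
  have "(\<lambda>n. \<Phi> (x (\<tau> n))) \<longlonglongrightarrow> \<Phi> q"
    by (rule continuous_on_tendsto_compose[OF assms(3) \<tau>(2) qK]) (intro always_eventually allI assms(2) pos)
  moreover have "(\<lambda>n. \<Phi> (x (\<tau> n))) \<longlonglongrightarrow> c" by (rule filterlim_compose[OF assms(4) top])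
  ultimately show ?thesis using LIMSEQ_unique by blast
qed

text \<open>A nonincreasing function that converges along one sequence of times going to infinity
  converges altogether. Consequently \<open>\<Phi>\<close> is constant on the limit set.\<close>

lemma omega_limit_decreasing:
  fixes \<Phi> :: "'a::metric_space \<Rightarrow> real"
  assumes "closed K" "\<And>t. 0 \<le> t \<Longrightarrow> x t \<in> K" "continuous_on K \<Phi>"
    and dec: "\<And>s t. 0 \<le> s \<Longrightarrow> s \<le> t \<Longrightarrow> \<Phi> (x t) \<le> \<Phi> (x s)"
    and q: "q \<in> omega_limit x"
  shows "((\<lambda>t. \<Phi> (x t)) \<longlongrightarrow> \<Phi> q) at_top" "0 \<le> s \<Longrightarrow> \<Phi> q \<le> \<Phi> (x s)"
proof -
  obtain \<tau> where \<tau>: "\<And>n. real n \<le> \<tau> n" "(\<lambda>n. x (\<tau> n)) \<longlonglongrightarrow> q"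
    using omega_limit_sequenceE[OF q] by blast
  have pos: "0 \<le> \<tau> n" for n by (rule order_trans[OF of_nat_0_le_iff \<tau>(1)])
  have qK: "q \<in> K" using omega_limit_subset[where x = x, OF assms(1,2)] q by blast
  have lim: "(\<lambda>n. \<Phi> (x (\<tau> n))) \<longlonglongrightarrow> \<Phi> q"
    by (rule continuous_on_tendsto_compose[OF assms(3) \<tau>(2) qK]) (intro always_eventually allI assms(2) pos)
  have le: "\<Phi> q \<le> \<Phi> (x s)" if "0 \<le> s" for s
  proof (rule LIMSEQ_le_const2[OF lim])
    obtain m :: nat where "s \<le> real m" using real_arch_simple by blast
    then have "s \<le> \<tau> n" if "m \<le> n" for n using that \<tau>(1)[of n] by (meson of_nat_le_iff order_trans)
    then show "\<exists>m. \<forall>n\<ge>m. \<Phi> (x (\<tau> n)) \<le> \<Phi> (x s)" using dec[OF that] by blast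
  qed
  show "((\<lambda>t. \<Phi> (x t)) \<longlongrightarrow> \<Phi> q) at_top"
  proof (rule tendstoI)
    fix e :: real assume "0 < e"
    then have "eventually (\<lambda>n. dist (\<Phi> (x (\<tau> n))) (\<Phi> q) < e) sequentially" by (rule tendstoD[OF lim])
    then obtain n where n: "dist (\<Phi> (x (\<tau> n))) (\<Phi> q) < e" by (auto simp: eventually_sequentially)
    have "dist (\<Phi> (x t)) (\<Phi> q) < e" if "\<tau> n \<le> t" for t
      using dec[OF pos that] le[of t] le[OF pos, of n] that pos[of n] n by (simp add: dist_real_def)
    then show "eventually (\<lambda>t. dist (\<Phi> (x t)) (\<Phi> q) < e) at_top"
      by (auto simp: eventually_at_top_linorder)
  qed
  show "\<Phi> q \<le> \<Phi> (x s)" if "0 \<le> s" using le[OF that] .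
qed

text \<open>The trajectory is a limit of the pieces of \<open>x\<close> that follow the times at
  which \<open>x\<close> comes close to \<open>q\<close>. Some trajectory from \<open>q\<close>
  stays in the limit set; nothing is claimed about others.\<close>

lemma omega_limit_invariant:
  fixes x :: "real \<Rightarrow> 'a::euclidean_space"
  assumes K: "compact K" and F: "continuous_on K F"
    and x: "trajectory F K {0..} x" and q: "q \<in> omega_limit x"
  obtains y where "y 0 = q" "trajectory F (omega_limit x) {0..} y"
proof -
  obtain \<tau> where \<tau>: "\<And>n. real n \<le> \<tau> n" "(\<lambda>n. x (\<tau> n)) \<longlonglongrightarrow> q"
    using omega_limit_sequenceE[OF q] by blast
  have pos: "0 \<le> \<tau> n" for n by (rule order_trans[OF of_nat_0_le_iff \<tau>(1)])
  define w where "w n t = x (\<tau> n + t)" for n t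
  have w: "trajectory F K {0..real n} (w n)" for n
    unfolding w_def by (rule trajectory_shift[OF x]) (use pos[of n] in auto)
  obtain r l where r: "strict_mono (r::nat \<Rightarrow> nat)"
    and l: "\<forall>t\<ge>0. (\<lambda>n. w (r n) (min t (real (r n)))) \<longlonglongrightarrow> l t"
    and tr: "trajectory F K {0..} l"
    by (rule long_trajectories_limit[where w = w and s = real, OF K F w of_nat_0_le_iff filterlim_real_sequentially])
  have rtop: "filterlim (\<lambda>n. real (r n)) at_top sequentially"
    by (rule filterlim_compose[OF filterlim_real_sequentially filterlim_subseq[OF r]])
  have "l t \<in> omega_limit x" if t: "0 \<le> t" for t
  proof (rule omega_limitI)
    show "filterlim (\<lambda>n. \<tau> (r n) + min t (real (r n))) at_top sequentially"
    proof (rule filterlim_at_top_mono[OF rtop], intro always_eventually allI)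
      fix n show "real (r n) \<le> \<tau> (r n) + min t (real (r n))" using \<tau>(1)[of "r n"] t by simp
    qed
    show "(\<lambda>n. x (\<tau> (r n) + min t (real (r n)))) \<longlonglongrightarrow> l t" using l t by (simp add: w_def)
  qed
  then have "trajectory F (omega_limit x) {0..} l" by (intro trajectory_codomain[OF tr]) auto
  moreover have "l 0 = q"
  proof -
    have "(\<lambda>n. x (\<tau> (r n))) \<longlonglongrightarrow> l 0" using l[rule_format, of 0] by (simp add: w_def)
    moreover have "(\<lambda>n. x (\<tau> (r n))) \<longlonglongrightarrow> q" using LIMSEQ_subseq_LIMSEQ[OF \<tau>(2) r] by (simp add: o_def)
    ultimately show ?thesis using LIMSEQ_unique by blast
  qed
  ultimately show thesis by (rule that[rotated])
qed

text \<open>Looking backwards along \<open>u\<close>, \<open>\<Phi>\<close> increases to its constant value on an alpha limit set,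
  which contains a forward trajectory.\<close>

lemma backward_trajectory_le:
  fixes u :: "real \<Rightarrow> 'a::euclidean_space" and \<Phi> :: "'a \<Rightarrow> real"
  assumes K: "compact K" and F: "continuous_on K F"
    and u: "trajectory (\<lambda>p. - F p) K {0..} u" and \<Phi>: "continuous_on K \<Phi>"
    and dec: "\<And>y b. 0 \<le> b \<Longrightarrow> trajectory F K {0..b} y \<Longrightarrow> \<Phi> (y b) \<le> \<Phi> (y 0)"
    and const: "\<And>y. trajectory F K {0..} y \<Longrightarrow> (\<And>t. 0 \<le> t \<Longrightarrow> \<Phi> (y t) = \<Phi> (y 0)) \<Longrightarrow> \<Phi> (y 0) \<le> c"
  shows "\<Phi> (u 0) \<le> c"
proof -
  have uK: "u t \<in> K" if "0 \<le> t" for t using trajectory_in[OF u] that by simp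
  have rev: "trajectory F K {0..b} (\<lambda>t. u (a - t))" if "b \<le> a" for a b
  proof -
    have "trajectory (\<lambda>p. - (- F p)) K {0..b} (\<lambda>t. u (a - t))"
      by (rule trajectory_reverse[OF u]) (use that in auto)
    then show ?thesis by simp
  qed
  have inc: "\<Phi> (u s) \<le> \<Phi> (u t)" if "0 \<le> s" "s \<le> t" for s t
    using dec[OF _ rev[of "t - s" t]] that by simp
  \<comment> \<open>Reading \<open>u\<close> from time \<open>n\<close> back to 0 gives a forward
    piece of length \<open>n\<close>. At a fixed \<open>t\<close> the times \<open>n - t\<close>
    tend to infinity, so a limit of these pieces runs inside the limit set of
    \<open>u\<close>.\<close>
  define w where "w n t = u (real n - t)" for n t
  have w: "trajectory F K {0..real n} (w n)" for n unfolding w_def by (rule rev) simp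
  obtain r l where r: "strict_mono (r::nat \<Rightarrow> nat)"
    and l: "\<forall>t\<ge>0. (\<lambda>n. w (r n) (min t (real (r n)))) \<longlonglongrightarrow> l t"
    and tr: "trajectory F K {0..} l"
    by (rule long_trajectories_limit[where w = w and s = real, OF K F w of_nat_0_le_iff filterlim_real_sequentially])
  have rtop: "filterlim (\<lambda>n. real (r n)) at_top sequentially"
    by (rule filterlim_compose[OF filterlim_real_sequentially filterlim_subseq[OF r]])
  have lim: "l t \<in> omega_limit u" if t: "0 \<le> t" for t
  proof (rule omega_limitI)
    show "filterlim (\<lambda>n. real (r n) - min t (real (r n))) at_top sequentially"
    proof (rule filterlim_at_top_mono)
      show "filterlim (\<lambda>n. - t + real (r n)) at_top sequentially"
        by (rule filterlim_tendsto_add_at_top[OF tendsto_const rtop])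
      show "eventually (\<lambda>n. - t + real (r n) \<le> real (r n) - min t (real (r n))) sequentially" by simp
    qed
    show "(\<lambda>n. u (real (r n) - min t (real (r n)))) \<longlonglongrightarrow> l t" using l t by (simp add: w_def)
  qed
  \<comment> \<open>\<open>\<Phi>\<close> does not decrease along \<open>u\<close>, so
    \<open>omega_limit_decreasing\<close> is applied to \<open>- \<Phi>\<close>: on the limit set
    \<open>\<Phi>\<close> is constant and at least \<open>\<Phi> (u 0)\<close>.\<close>
  have cont: "continuous_on K (\<lambda>p. - \<Phi> p)" by (intro continuous_intros \<Phi>)
  have dec': "- \<Phi> (u t) \<le> - \<Phi> (u s)" if "0 \<le> s" "s \<le> t" for s t using inc[OF that] by simp
  note od' = omega_limit_decreasing[where x = u and \<Phi> = "\<lambda>p. - \<Phi> p", OF compact_imp_closed[OF K] uK cont]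
  have od: "((\<lambda>t. - \<Phi> (u t)) \<longlongrightarrow> - \<Phi> (l t)) at_top" if "0 \<le> t" for t
    by (rule od'(1)[OF _ _ lim[OF that]]) (assumption | rule dec')+
  have od0: "- \<Phi> (l 0) \<le> - \<Phi> (u 0)"
    by (rule od'(2)[OF _ _ lim[OF order_refl] order_refl]) (assumption | rule dec')+
  have eq: "\<Phi> (l t) = \<Phi> (l 0)" if "0 \<le> t" for t
    by (rule neg_equal_iff_equal[THEN iffD1], rule tendsto_unique[OF _ od[OF that] od[OF order_refl]]) simp
  have "\<Phi> (l 0) \<le> c" by (rule const[OF tr eq])
  moreover note od0
  ultimately show ?thesis by simp
qed

section \<open>Convergence from a family of Lyapunov functions\<close>

text \<open>A trajectory in a compact set has bounded speed, so it is uniformly continuous and has a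
  limit at \<open>\<tau>\<close>, which is the missing value.\<close>

lemma trajectory_extend_closed:
  fixes x :: "real \<Rightarrow> 'a::euclidean_space"
  assumes K: "compact K" and F: "continuous_on K F" and \<tau>: "0 < \<tau>"
    and x: "trajectory F K {0..<\<tau>} x"
  obtains z where "trajectory F K {0..\<tau>} z" "\<And>t. 0 \<le> t \<Longrightarrow> t < \<tau> \<Longrightarrow> z t = x t"
proof -
  obtain L where L: "\<And>p. p \<in> K \<Longrightarrow> norm (F p) \<le> L"
    using compact_imp_bounded[OF compact_continuous_image[OF F K]] by (auto simp: bounded_iff)
  have xK: "x t \<in> K" if "0 \<le> t" "t < \<tau>" for t using trajectory_in[OF x] that by simp
  have "0 \<le> L" using L[OF xK[of 0]] \<tau> norm_ge_zero[of "F (x 0)"] by linarith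
  then have "L-lipschitz_on {0..<\<tau>} x" by (intro trajectory_lipschitz[OF x _ L]) auto
  then have uc: "uniformly_continuous_on {0..<\<tau>} x" by (rule lipschitz_on_uniformly_continuous)
  have "\<tau> \<in> closure {0..<\<tau>}" using \<tau> by simp
  then obtain p where p: "(x \<longlongrightarrow> p) (at \<tau> within {0..<\<tau>})"
    by (rule uniformly_continuous_on_extension_at_closure[OF uc])
  have nt: "at \<tau> within {0..<\<tau>} \<noteq> bot"
    using \<tau> by (simp add: at_within_eq_bot_iff)
  have "eventually (\<lambda>t. x t \<in> K) (at \<tau> within {0..<\<tau>})"
    unfolding eventually_at_filter by (rule always_eventually) (use xK in auto)
  then have pK: "p \<in> K" by (rule Lim_in_closed_set[OF compact_imp_closed[OF K] _ nt p])
  define z where "z t = (if t < \<tau> then x t else p)" for t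
  have zx: "z t = x t" if "t < \<tau>" for t using that by (simp add: z_def)
  have zK: "z t \<in> K" if "0 \<le> t" for t using that pK xK by (auto simp: z_def)
  have zd: "(z has_vector_derivative F (z t)) (at t within {0..\<tau>})" if t: "0 \<le> t" "t < \<tau>" for t
  proof -
    have "(x has_vector_derivative F (x t)) (at t within {0..<\<tau>})"
      using trajectory_deriv[OF x, of t] t by simp
    then have "(z has_vector_derivative F (x t)) (at t within {0..<\<tau>})"
      by (rule has_vector_derivative_transform[rotated 2]) (use t in \<open>auto simp: z_def\<close>)
    moreover have "at t within {0..<\<tau>} = at t within {0..\<tau>}"
      by (rule at_within_nhd[of _ "{..<\<tau>}"]) (use t in auto)
    ultimately show ?thesis using zx[OF t(2)] by simp
  qed
  have cz: "continuous_on {0..\<tau>} z"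
    unfolding continuous_on_eq_continuous_within
  proof
    fix t assume t: "t \<in> {0..\<tau>}"
    show "continuous (at t within {0..\<tau>}) z"
    proof (cases "t < \<tau>")
      case True
      then show ?thesis using zd[of t] t by (auto intro: has_vector_derivative_continuous)
    next
      case False
      then have t\<tau>: "t = \<tau>" using t by simp
      have "(z \<longlongrightarrow> p) (at \<tau> within {0..<\<tau>})"
        by (rule Lim_transform_within[OF p, of 1]) (auto simp: z_def)
      moreover have "at \<tau> within {0..<\<tau>} = at \<tau> within {0..\<tau>}"
      proof -
        have "{0..<\<tau>} - {\<tau>} = {0..\<tau>} - {\<tau>}" by auto
        then show ?thesis unfolding at_within_def by metis
      qed
      ultimately show ?thesis by (simp add: t\<tau> continuous_within z_def)
    qed
  qed
  have "trajectory F K {0..\<tau>} z"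
  proof (rule trajectory_of_integral)
    show "continuous_on {0..\<tau>} (\<lambda>s. F (z s))"
      by (rule continuous_on_compose2[OF F cz]) (use zK in auto)
    show "z t \<in> K" if "0 \<le> t" for t using zK[OF that] .
    show "z t = z 0 + integral {0..t} (\<lambda>s. F (z s))" if t: "0 \<le> t" "t \<le> \<tau>" for t
    proof -
      \<comment> \<open>The derivative at \<open>\<tau>\<close> is not known yet, hence the version
        of the fundamental theorem that asks for derivatives in the interior only. The integral
        equation then yields the derivative at the end point.\<close>
      have "((\<lambda>s. F (z s)) has_integral z t - z 0) {0..t}"
      proof (rule fundamental_theorem_of_calculus_interior[OF t(1)])
        show "continuous_on {0..t} z" using cz by (rule continuous_on_subset) (use t in auto)
        fix s assume s: "s \<in> {0<..<t}"
        have "at s within {0..\<tau>} = at s" by (rule at_within_interior) (use s t in auto)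
        then show "(z has_vector_derivative F (z s)) (at s)" using zd[of s] s t by simp
      qed
      then have "integral {0..t} (\<lambda>s. F (z s)) = z t - z 0" by (rule integral_unique)
      then show ?thesis by simp
    qed
  qed
  then show thesis by (rule that) (simp add: zx)
qed

text \<open>Both pieces solve the same autonomous equation, so at the junction their one-sided
  derivatives are both the value of \<open>F\<close> at the common point.\<close>

lemma trajectory_append:
  fixes z w :: "real \<Rightarrow> 'a::euclidean_space"
  assumes z: "trajectory F M {0..\<tau>} z" and w: "trajectory F M {0..e} w"
    and "0 \<le> \<tau>" "0 < e" "w 0 = z \<tau>"
  shows "trajectory F M {0..<\<tau> + e} (\<lambda>t. if t \<in> {0..\<tau>} then z t else w (t - \<tau>))"
  unfolding trajectory_def
proof (intro ballI conjI)
  have w': "trajectory F M {\<tau>..\<tau> + e} (\<lambda>t. w (t - \<tau>))"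
    using trajectory_shift[OF w, of "- \<tau>" "{\<tau>..\<tau> + e}"] by (simp add: image_subset_iff)
  fix t assume t: "t \<in> {0..<\<tau> + e}"
  show "(if t \<in> {0..\<tau>} then z t else w (t - \<tau>)) \<in> M"
    using trajectory_in[OF z, of t] trajectory_in[OF w', of t] t by auto
  have cl: "closure {0..\<tau>} \<inter> closure {\<tau><..<\<tau> + e} = {\<tau>}" using assms by auto
  have S: "{0..\<tau>} \<union> (closure {0..\<tau>} \<inter> closure {\<tau><..<\<tau> + e}) = {0..\<tau>}"
    and T: "{\<tau><..<\<tau> + e} \<union> (closure {0..\<tau>} \<inter> closure {\<tau><..<\<tau> + e}) = {\<tau>..<\<tau> + e}"
    unfolding cl using assms by auto
  have "((\<lambda>t. if t \<in> {0..\<tau>} then z t else w (t - \<tau>)) has_vector_derivative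
      (if t \<in> {0..\<tau>} then F (z t) else F (w (t - \<tau>)))) (at t within {0..<\<tau> + e})"
  proof (rule has_vector_derivative_If_within_closures[where T = "{\<tau><..<\<tau> + e}"], unfold S T)
    show "t \<in> {0..\<tau>} \<union> {\<tau><..<\<tau> + e}" "{0..<\<tau> + e} = {0..\<tau>} \<union> {\<tau><..<\<tau> + e}"
      using t assms by auto
    show "t \<in> {0..\<tau>} \<Longrightarrow> (z has_vector_derivative F (z t)) (at t within {0..\<tau>})"
      by (rule trajectory_deriv[OF z])
    show "((\<lambda>t. w (t - \<tau>)) has_vector_derivative F (w (t - \<tau>))) (at t within {\<tau>..<\<tau> + e})"
      if "t \<in> {\<tau>..<\<tau> + e}"
      by (rule has_vector_derivative_within_subset[OF trajectory_deriv[OF w']]) (use that in auto)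
    show "z t = w (t - \<tau>)" if "t \<in> closure {0..\<tau>}" "t \<in> closure {\<tau><..<\<tau> + e}"
    proof -
      have "t = \<tau>" using that cl by blast
      then show ?thesis using assms by simp
    qed
    show "F (z t) = F (w (t - \<tau>))" if "t \<in> closure {0..\<tau>}" "t \<in> closure {\<tau><..<\<tau> + e}"
    proof -
      have "t = \<tau>" using that cl by blast
      then show ?thesis using assms by simp
    qed
  qed
  then show "((\<lambda>t. if t \<in> {0..\<tau>} then z t else w (t - \<tau>)) has_vector_derivative
      F (if t \<in> {0..\<tau>} then z t else w (t - \<tau>))) (at t within {0..<\<tau> + e})"
    by (simp only: if_distrib)
qed

lemma forward_interval_segment:
  assumes "forward_interval I" "t \<in> I"
  shows "0 \<le> t" "{0..t} \<subseteq> I"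
proof -
  have "I = {0..} \<or> (\<exists>\<tau>>0. I = {0..<\<tau>})" using assms(1) by (simp add: forward_interval_def)
  then show "0 \<le> t" "{0..t} \<subseteq> I" using assms(2) by auto
qed

text \<open>No \<open>V c\<close> has to be positive definite. Definiteness is replaced by
  \<open>bwd\<close>: within \<open>K\<close>, a backward half-trajectory in the zero set of
  \<open>V c\<close> can only start at \<open>c\<close>. The hypothesis \<open>lim\<close> provides
  the limit point at which the energy is to be centred, and \<open>ex\<close> continues a solution
  beyond the end of a bounded interval.\<close>

theorem lyapunov_family_convergence:
  fixes F :: "'a::euclidean_space \<Rightarrow> 'a" and V :: "'a \<Rightarrow> 'a \<Rightarrow> real"
  assumes M: "closed M" and r: "0 < r" and p: "p \<in> M" "F p = 0" "p \<in> E"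
    and K: "K = cball p r \<inter> M" and F: "continuous_on K F"
    and V: "\<And>c. c \<in> E \<Longrightarrow> continuous_on K (V c)" "\<And>c. c \<in> E \<Longrightarrow> V c c = 0"
      "\<And>c q. c \<in> E \<Longrightarrow> q \<in> K \<Longrightarrow> 0 \<le> V c q"
    and dec: "\<And>c x b. c \<in> E \<Longrightarrow> 0 \<le> b \<Longrightarrow> trajectory F K {0..b} x \<Longrightarrow> V c (x b) \<le> V c (x 0)"
    and bwd: "\<And>c u. c \<in> E \<Longrightarrow> trajectory (\<lambda>q. - F q) K {0..} u \<Longrightarrow> (\<And>t. 0 \<le> t \<Longrightarrow> V c (u t) = 0)
        \<Longrightarrow> u 0 = c"
    and lim: "\<And>x. trajectory F K {0..} x \<Longrightarrow> \<exists>c\<in>E. c \<in> omega_limit x"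
    and ex: "\<And>q. q \<in> M \<Longrightarrow> \<exists>e>0. \<exists>x. x 0 = q \<and> trajectory F M {0..e} x"
  shows "\<exists>\<delta>>0. \<forall>I x. forward_interval I \<and> trajectory F M I x \<and> dist (x 0) p < \<delta> \<and>
      (\<forall>J y. forward_interval J \<and> trajectory F M J y \<and> I \<subseteq> J \<and> (\<forall>t\<in>I. y t = x t) \<longrightarrow> J = I) \<longrightarrow>
      I = {0..} \<and> (\<exists>c\<in>E. (x \<longlongrightarrow> c) at_top)"
proof -
  have compK: "compact K" unfolding K using M by (simp add: compact_Int_closed)
  have pK: "p \<in> K" using p r by (simp add: K)
  have KM: "K \<subseteq> M" by (auto simp: K)
  have F': "continuous_on K (\<lambda>q. - F q)" by (intro continuous_intros F)
  have mono: "V c (x b) \<le> V c (x a)"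
    if "c \<in> E" "trajectory F K I x" "{a..b} \<subseteq> I" "a \<le> b" for c x a b I
  proof -
    have "trajectory F K {0..b - a} (\<lambda>t. x (a + t))"
      by (rule trajectory_shift[OF that(2)]) (use that(3) in auto)
    from dec[OF that(1) _ this] show ?thesis using that(4) by simp
  qed
  have "\<exists>\<delta>>0. \<forall>I x. forward_interval I \<and> trajectory F M I x \<and> dist (x 0) p < \<delta> \<longrightarrow> (\<forall>t\<in>I. dist (x t) p < r)"
  proof (rule ccontr)
    assume "\<not> ?thesis"
    then have unstable: "0 < \<delta> \<Longrightarrow> \<exists>I x t. forward_interval I \<and> trajectory F M I x \<and> dist (x 0) p < \<delta>
       \<and> t \<in> I \<and> r \<le> dist (x t) p" for \<delta>
      by (metis not_less)
    have "0 < min r (inverse (real (Suc n)))" for n using r by (simp del: of_nat_Suc)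
    from unstable[OF this] have "\<forall>n. \<exists>q. forward_interval (fst q) \<and> trajectory F M (fst q) (fst (snd q)) \<and>
        dist (fst (snd q) 0) p < min r (inverse (real (Suc n))) \<and>
        snd (snd q) \<in> fst q \<and> r \<le> dist (fst (snd q) (snd (snd q))) p"
      unfolding split_paired_Ex fst_conv snd_conv by blast
    from choice[OF this] obtain q where q: "\<forall>n. forward_interval (fst (q n)) \<and>
        trajectory F M (fst (q n)) (fst (snd (q n))) \<and>
        dist (fst (snd (q n)) 0) p < min r (inverse (real (Suc n))) \<and>
        snd (snd (q n)) \<in> fst (q n) \<and> r \<le> dist (fst (snd (q n)) (snd (snd (q n)))) p" ..
    define I x t1 where "I n = fst (q n)" and "x n = fst (snd (q n))" and "t1 n = snd (snd (q n))" for n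
    have I: "forward_interval (I n)" and x: "trajectory F M (I n) (x n)"
      and x0: "dist (x n 0) p < min r (inverse (real (Suc n)))"
      and t1: "t1 n \<in> I n" "r \<le> dist (x n (t1 n)) p" for n
      using spec[OF q, of n] unfolding I_def x_def t1_def by simp_all
    have t1': "0 \<le> t1 n" "{0..t1 n} \<subseteq> I n" for n
      using forward_interval_segment[OF I t1(1)] by blast+
    \<comment> \<open>The exit time is the least element of the compact set of times at distance at
      least \<open>r\<close>. By the intermediate value theorem the distance is then exactly
      \<open>r\<close>, so \<open>x n\<close> is in \<open>K\<close> up to and including this
      time.\<close>
    have "\<exists>s. 0 \<le> s \<and> s \<le> t1 n \<and> dist (x n s) p = r \<and> (\<forall>t. 0 \<le> t \<and> t < s \<longrightarrow> dist (x n t) p < r)" for n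
    proof -
      have cd: "continuous_on {0..t1 n} (\<lambda>t. dist (x n t) p)"
        by (intro continuous_intros continuous_on_subset[OF trajectory_continuous[OF x] t1'(2)])
      define A where "A = {0..t1 n} \<inter> (\<lambda>t. dist (x n t) p) -` {r..}"
      have "closed A" unfolding A_def by (rule continuous_closed_preimage[OF cd]) auto
      moreover have "bounded A" unfolding A_def by (rule bounded_subset[of "{0..t1 n}"]) auto
      ultimately have "compact A" by (simp add: compact_eq_bounded_closed)
      moreover have "t1 n \<in> A" using t1(2)[of n] t1'(1)[of n] unfolding A_def by simp
      ultimately obtain s where s: "s \<in> A" "\<forall>t\<in>A. s \<le> t" using compact_attains_inf[of A] by blast
      have sA: "0 \<le> s" "s \<le> t1 n" "r \<le> dist (x n s) p" using s(1) unfolding A_def by simp_all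
      have below: "dist (x n t) p < r" if "0 \<le> t" "t < s" for t
      proof (rule ccontr)
        assume "\<not> dist (x n t) p < r"
        then have "t \<in> A" using that sA unfolding A_def by simp
        then show False using bspec[OF s(2), of t] that by simp
      qed
      have "dist (x n s) p = r"
      proof (rule ccontr)
        assume "dist (x n s) p \<noteq> r"
        then have gt: "r < dist (x n s) p" using sA by simp
        have "dist (x n 0) p \<le> r" using x0[of n] by simp
        moreover have "continuous_on {0..s} (\<lambda>t. dist (x n t) p)"
          by (rule continuous_on_subset[OF cd]) (use sA in simp)
        ultimately have "\<exists>t. 0 \<le> t \<and> t \<le> s \<and> dist (x n t) p = r"
          by (intro IVT') (use gt sA in simp_all)
        then obtain t where "0 \<le> t" "t \<le> s" "dist (x n t) p = r" by blast
        with gt below[of t] show False by (cases "t = s") auto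
      qed
      with sA below show ?thesis by blast
    qed
    then obtain s where s: "\<And>n. 0 \<le> s n" "\<And>n. s n \<le> t1 n" "\<And>n. dist (x n (s n)) p = r"
      "\<And>n t. 0 \<le> t \<Longrightarrow> t < s n \<Longrightarrow> dist (x n t) p < r" by metis
    have xK: "trajectory F K {0..s n} (x n)" for n
    proof (rule trajectory_codomain)
      show tr: "trajectory F M {0..s n} (x n)"
        by (rule trajectory_subset[OF x]) (use t1'(2)[of n] s(2)[of n] in auto)
      fix t assume t: "t \<in> {0..s n}"
      then have "dist (x n t) p \<le> r" using s(3)[of n] s(4)[of t n] by (cases "t = s n") auto
      then show "x n t \<in> K" using trajectory_in[OF tr t] by (simp add: K dist_commute)
    qed
    \<comment> \<open>Starting from the exit points gives a limit with \<open>l 0\<close> at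
      distance \<open>r\<close> from \<open>p\<close>, while the other ends \<open>x n 0\<close>
      tend to \<open>p\<close>.\<close>
    define w where "w n t = x n (s n - t)" for n t
    have w: "trajectory (\<lambda>q. - F q) K {0..s n} (w n)" for n
      unfolding w_def by (rule trajectory_reverse[OF xK]) auto
    have x0K: "x n 0 \<in> K" for n by (rule trajectory_in[OF xK]) (use s in auto)
    have x0p: "(\<lambda>n. x n 0) \<longlonglongrightarrow> p"
    proof (rule tendsto_dist_iff[THEN iffD2], rule tendsto_sandwich[OF _ _ tendsto_const LIMSEQ_inverse_real_of_nat])
      show "\<forall>\<^sub>F n in sequentially. dist (x n 0) p \<le> inverse (real (Suc n))"
        by (intro always_eventually allI less_imp_le) (use x0 in \<open>simp del: of_nat_Suc\<close>)
    qed auto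
    \<comment> \<open>The exit times might stay bounded. In that case the reversed pieces end at
      \<open>x n 0\<close>, where the velocity tends to \<open>F p = 0\<close>, and freezing them
      there is harmless.\<close>
    have fin: "(\<lambda>n. if t \<le> s n then 0 else norm (- F (w n (s n)))) \<longlonglongrightarrow> 0" for t
    proof (rule tendsto_sandwich[OF _ _ tendsto_const])
      have "(\<lambda>n. F (x n 0)) \<longlonglongrightarrow> F p"
        by (rule continuous_on_tendsto_compose[OF F x0p pK]) (intro always_eventually allI x0K)
      then show "(\<lambda>n. norm (F (x n 0))) \<longlonglongrightarrow> 0" using p(2) tendsto_norm_zero by simp
      show "\<forall>\<^sub>F n in sequentially. (if t \<le> s n then 0 else norm (- F (w n (s n)))) \<le> norm (F (x n 0))"
        by (intro always_eventually allI) (simp add: w_def)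
    qed auto
    obtain \<rho> l where \<rho>: "strict_mono (\<rho>::nat \<Rightarrow> nat)"
      and l: "\<forall>t\<ge>0. (\<lambda>n. w (\<rho> n) (min t (s (\<rho> n)))) \<longlonglongrightarrow> l t"
      and tr: "trajectory (\<lambda>q. - F q) K {0..} l"
      by (rule trajectories_limit[where w = w and s = s, OF compK F' w s(1) fin])
    \<comment> \<open>Along \<open>x n\<close> the energy never exceeds its initial value, which
      tends to \<open>V p p = 0\<close>.\<close>
    have "V p (l t) = 0" if t: "0 \<le> t" for t
    proof -
      have lK: "l t \<in> K" using trajectory_in[OF tr] t by simp
      have wK: "w (\<rho> n) (min t (s (\<rho> n))) \<in> K" for n
        by (rule trajectory_in[OF w]) (use t s(1) in auto)
      have "(\<lambda>n. V p (w (\<rho> n) (min t (s (\<rho> n))))) \<longlonglongrightarrow> V p (l t)"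
        by (rule continuous_on_tendsto_compose[OF V(1)[OF p(3)] l[rule_format, OF t] lK])
          (intro always_eventually allI wK)
      moreover have "(\<lambda>n. V p (x (\<rho> n) 0)) \<longlonglongrightarrow> V p p"
        by (rule continuous_on_tendsto_compose[OF V(1)[OF p(3)] _ pK])
          (use LIMSEQ_subseq_LIMSEQ[OF x0p \<rho>] in \<open>simp_all add: o_def x0K\<close>)
      moreover have "V p (w (\<rho> n) (min t (s (\<rho> n)))) \<le> V p (x (\<rho> n) 0)" for n
        unfolding w_def by (rule mono[OF p(3) xK]) (use t s(1)[of "\<rho> n"] in auto)
      ultimately have "V p (l t) \<le> V p p" by (blast intro: LIMSEQ_le)
      then show ?thesis using V(2,3)[OF p(3)] lK by (simp add: order_antisym)
    qed
    then have "l 0 = p" by (rule bwd[OF p(3) tr])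
    moreover have "(\<lambda>n. dist (x (\<rho> n) (s (\<rho> n))) p) \<longlonglongrightarrow> dist (l 0) p"
      using tendsto_dist[OF l[rule_format, OF order_refl] tendsto_const[of p]] s(1) by (simp add: w_def min_def)
    ultimately have "(\<lambda>n. r) \<longlonglongrightarrow> 0" using s(3) by simp
    then show False using r by (simp add: LIMSEQ_const_iff)
  qed
  then obtain \<delta> where \<delta>: "0 < \<delta>" and stable: "\<And>I x t. forward_interval I \<Longrightarrow> trajectory F M I x \<Longrightarrow>
      dist (x 0) p < \<delta> \<Longrightarrow> t \<in> I \<Longrightarrow> dist (x t) p < r" by blast
  show ?thesis
  proof (intro exI[of _ \<delta>] conjI[OF \<delta>] allI impI, elim conjE)
    fix I x
    assume I: "forward_interval I" and x: "trajectory F M I x" and x0: "dist (x 0) p < \<delta>"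
      and "\<forall>J y. forward_interval J \<and> trajectory F M J y \<and> I \<subseteq> J \<and> (\<forall>t\<in>I. y t = x t) \<longrightarrow> J = I"
    then have max: "J = I"
      if "forward_interval J" "trajectory F M J y" "I \<subseteq> J" "\<forall>t\<in>I. y t = x t" for J y
      using that by blast
    have xK: "trajectory F K I x"
    proof (rule trajectory_codomain[OF x])
      fix t assume t: "t \<in> I"
      show "x t \<in> K" using stable[OF I x x0 t] trajectory_in[OF x t] by (simp add: K dist_commute)
    qed
    \<comment> \<open>On a bounded interval the solution would reach an end point in the compact set
      \<open>K\<close>, from which \<open>ex\<close> continues it, against maximality.\<close>
    have Iall: "I = {0..}"
    proof (rule ccontr)
      assume "I \<noteq> {0..}"
      then obtain \<tau> where \<tau>: "0 < \<tau>" "I = {0..<\<tau>}" using I by (auto simp: forward_interval_def)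
      obtain z where z: "trajectory F K {0..\<tau>} z" "\<And>t. 0 \<le> t \<Longrightarrow> t < \<tau> \<Longrightarrow> z t = x t"
        using trajectory_extend_closed[OF compK F \<tau>(1)] xK \<tau>(2) by blast
      have zM: "trajectory F M {0..\<tau>} z" by (rule trajectory_mono[OF z(1) KM])
      have "z \<tau> \<in> M" by (rule trajectory_in[OF zM]) (use \<tau> in auto)
      then obtain e w where e: "0 < e" and w: "w 0 = z \<tau>" "trajectory F M {0..e} w" using ex by blast
      have "{0..<\<tau> + e} = I"
      proof (rule max[OF _ trajectory_append[OF zM w(2) _ e w(1)]])
        show "forward_interval {0..<\<tau> + e}" unfolding forward_interval_def using \<tau>(1) e
          by (metis add_pos_pos)
        show "I \<subseteq> {0..<\<tau> + e}" using \<tau> e by auto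
      qed (use \<tau> z(2) in auto)
      moreover have "\<tau> \<in> {0..<\<tau> + e}" using \<tau> e by auto
      ultimately show False using \<tau>(2) by auto
    qed
    have x': "trajectory F K {0..} x" using xK Iall by simp
    obtain c where c: "c \<in> E" "c \<in> omega_limit x" using lim[OF x'] by blast
    have xtK: "x t \<in> K" if "0 \<le> t" for t using trajectory_in[OF x'] that by simp
    have cK: "c \<in> K" using omega_limit_subset[where x = x, OF compact_imp_closed[OF compK] xtK] c(2) by blast
    have dec': "V c (x t) \<le> V c (x s)" if "0 \<le> s" "s \<le> t" for s t
      by (rule mono[OF c(1) x']) (use that in auto)
    \<comment> \<open>The energy converges along \<open>x\<close>, and its limit is its value at the
      limit point \<open>c\<close>.\<close>
    have V0: "((\<lambda>t. V c (x t)) \<longlongrightarrow> 0) at_top"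
      using omega_limit_decreasing(1)[where x = x, OF compact_imp_closed[OF compK] xtK V(1)[OF c(1)] dec' c(2)]
        V(2)[OF c(1)] by simp
    have "(x \<longlongrightarrow> c) at_top"
    proof (rule tendstoI, rule ccontr)
      fix e :: real assume e: "0 < e" and "\<not> eventually (\<lambda>t. dist (x t) c < e) at_top"
      then have "\<exists>t\<ge>real n. e \<le> dist (x t) c" for n
        by (auto simp: eventually_at_top_linorder not_less)
      then obtain s where s: "\<And>n. real n \<le> s n" "\<And>n. e \<le> dist (x (s n)) c" by metis
      have s0: "0 \<le> s n" for n by (rule order_trans[OF of_nat_0_le_iff s(1)])
      have stop: "filterlim s at_top sequentially"
        by (rule filterlim_at_top_mono[OF filterlim_real_sequentially]) (use s(1) in auto)
      \<comment> \<open>The stability argument again, with starting points at distance at least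
        \<open>e\<close> from \<open>c\<close>. Their times tend to infinity, so the energy vanishes
        on the limit by \<open>V0\<close>.\<close>
      define w where "w n t = x (s n - t)" for n t
      have w: "trajectory (\<lambda>q. - F q) K {0..s n} (w n)" for n
        unfolding w_def by (rule trajectory_reverse[OF x']) auto
      obtain \<rho> l where \<rho>: "strict_mono (\<rho>::nat \<Rightarrow> nat)"
        and l: "\<forall>t\<ge>0. (\<lambda>n. w (\<rho> n) (min t (s (\<rho> n)))) \<longlonglongrightarrow> l t"
        and tr: "trajectory (\<lambda>q. - F q) K {0..} l"
        by (rule long_trajectories_limit[where w = w and s = s, OF compK F' w s0 stop])
      have "V c (l t) = 0" if t: "0 \<le> t" for t
      proof -
        have "filterlim (\<lambda>n. - t + s (\<rho> n)) at_top sequentially"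
          by (rule filterlim_tendsto_add_at_top[OF tendsto_const
                filterlim_compose[OF stop filterlim_subseq[OF \<rho>]]])
        then have "filterlim (\<lambda>n. s (\<rho> n) - min t (s (\<rho> n))) at_top sequentially"
          by (rule filterlim_at_top_mono) simp
        then have "(\<lambda>n. V c (x (s (\<rho> n) - min t (s (\<rho> n))))) \<longlonglongrightarrow> 0"
          by (rule filterlim_compose[OF V0])
        moreover have "(\<lambda>n. V c (w (\<rho> n) (min t (s (\<rho> n))))) \<longlonglongrightarrow> V c (l t)"
        proof (rule continuous_on_tendsto_compose[OF V(1)[OF c(1)] l[rule_format, OF t]])
          show "l t \<in> K" using trajectory_in[OF tr] t by simp
          have "w (\<rho> n) (min t (s (\<rho> n))) \<in> K" for n
            by (rule trajectory_in[OF w]) (use t s0 in auto)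
          then show "\<forall>\<^sub>F n in sequentially. w (\<rho> n) (min t (s (\<rho> n))) \<in> K" by simp
        qed
        ultimately show ?thesis unfolding w_def using LIMSEQ_unique by blast
      qed
      then have "l 0 = c" by (rule bwd[OF c(1) tr])
      moreover have "(\<lambda>n. dist (x (s (\<rho> n))) c) \<longlonglongrightarrow> dist (l 0) c"
        using tendsto_dist[OF l[rule_format, OF order_refl] tendsto_const[of c]] s0 by (simp add: w_def min_def)
      then have "e \<le> dist (l 0) c" by (rule LIMSEQ_le_const) (use s(2) in auto)
      ultimately show False using e by simp
    qed
    with Iall c(1) show "I = {0..} \<and> (\<exists>c\<in>E. (x \<longlongrightarrow> c) at_top)" by blast
  qed
qed

section \<open>Kernel of a matrix with a simple eigenvalue zero\<close>

lemma poly_det: "poly (det A) x = det (\<chi> i j. poly (A $ i $ j) x)"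
  for A :: "real poly^'a::finite^'a"
  by (simp add: det_def poly_sum poly_prod)

text \<open>A number beyond a bound of the operator norm is not an eigenvalue, so the polynomial
  does not vanish there.\<close>

lemma char_polynomial_nonzero: "char_polynomial (A :: real^'a::finite^'a) \<noteq> 0"
proof
  assume 0: "char_polynomial A = 0"
  obtain B where B: "B > 0" "\<And>v. norm (A *v v) \<le> B * norm v"
    using linear_bounded_pos[OF matrix_vector_mul_linear, of A] by blast
  define t where "t = B + 1"
  define C where "C = (\<chi> i j. (if i = j then t else 0) - A $ i $ j)"
  have "det C = poly (char_polynomial A) t"
    unfolding char_polynomial_def poly_det C_def
    by (intro arg_cong[where f = det]) (auto simp: vec_eq_iff)
  then have "det C = 0" using 0 by simp
  then have "\<not> invertible C" by (simp add: invertible_det_nz)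
  then obtain v where v: "C *v v = 0" "v \<noteq> 0"
    using matrix_left_invertible_ker[of C] invertible_left_inverse[of C] by blast
  have "C *v v = t *\<^sub>R v - A *v v"
    by (simp add: C_def vec_eq_iff matrix_vector_mult_def left_diff_distrib sum_subtractf if_distrib[of "\<lambda>x. x * _"] cong: if_cong)
  then have "A *v v = t *\<^sub>R v" using v by simp
  then have "t * norm v \<le> B * norm v" using B(2)[of v] B(1) by (simp add: t_def)
  then show False using v(2) by (simp add: t_def)
qed

text \<open>\<open>simple_eigenvalue\<close> is about algebraic multiplicity. With two independent
  kernel vectors as columns of an invertible matrix \<open>P\<close>, two columns of the product of
  \<open>X - A\<close> and \<open>P\<close> are divisible by \<open>X\<close>, so the square of
  \<open>X\<close> would divide the characteristic polynomial.\<close>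

lemma kernel_of_simple_zero_eigenvalue:
  fixes A :: "real^'a::finite^'a"
  assumes simple: "simple_eigenvalue A 0" and u: "A *v u = 0" "u \<noteq> 0" and x: "A *v x = 0"
  obtains c where "x = c *\<^sub>R u"
proof -
  obtain b where b: "u $ b \<noteq> 0" using u(2) by (auto simp: vec_eq_iff)
  \<comment> \<open>The multiple of \<open>u\<close> is chosen to cancel coordinate
    \<open>b\<close>. If \<open>y\<close> is nonzero at some \<open>a\<close>, then
    \<open>a \<noteq> b\<close>, and replacing the unit vectors at \<open>a\<close> and
    \<open>b\<close> by \<open>y\<close> and \<open>u\<close> keeps the columns of \<open>P\<close>
    independent.\<close>
  define y where "y = x - (x $ b / u $ b) *\<^sub>R u"
  have yb: "y $ b = 0" using b by (simp add: y_def)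
  have Ay: "A *v y = 0" using u(1) x by (simp add: y_def matrix_vector_mult_diff_distrib matrix_vector_mult_scaleR)
  have "y = 0"
  proof (rule ccontr)
    assume "y \<noteq> 0"
    then obtain a where a: "y $ a \<noteq> 0" by (auto simp: vec_eq_iff)
    have ab: "a \<noteq> b" using a yb by auto
    define P where "P = (\<chi> i j. if j = a then y $ i else if j = b then u $ i else if i = j then 1 else 0)"
    have "\<forall>w. P *v w = 0 \<longrightarrow> w = 0"
    proof (intro allI impI)
      fix w assume w: "P *v w = 0"
      have Pw: "(P *v w) $ i = y $ i * w $ a + u $ i * w $ b + (if i = a \<or> i = b then 0 else w $ i)" for i
      proof -
        have "(P *v w) $ i = (\<Sum>j\<in>UNIV. P $ i $ j * w $ j)" by (simp add: matrix_vector_mult_def)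
        also have "\<dots> = (\<Sum>j\<in>UNIV. (if j = a then y $ i * w $ j else 0) + (if j = b then u $ i * w $ j else 0)
            + (if j = i then (if i = a \<or> i = b then 0 else w $ j) else 0))"
          by (rule sum.cong[OF refl]) (use ab in \<open>auto simp: P_def\<close>)
        finally show ?thesis by (simp add: sum.distrib)
      qed
      have wb: "w $ b = 0" using Pw[of b] w yb b by simp
      have wa: "w $ a = 0" using Pw[of a] w wb a by simp
      show "w = 0" unfolding vec_eq_iff
      proof
        fix i show "w $ i = 0 $ i" using Pw[of i] w wa wb by (cases "i = a \<or> i = b") auto
      qed
    qed
    then have detP: "det P \<noteq> 0"
      using matrix_left_invertible_ker[of P] invertible_left_inverse[of P] invertible_det_nz[of P] by blast
    define C where "C = (\<chi> i j. if i = j then [:- A $ i $ j, 1:] else [:- A $ i $ j:])"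
    define Q where "Q = (\<chi> i j. [:P $ i $ j:])"
    \<comment> \<open>\<open>c j\<close> is the factor taken out of column \<open>j\<close> of the
      product. The columns are stored as the rows of \<open>D\<close>, since
      \<open>det_rows_mul\<close> is about rows.\<close>
    define c where "c j = (if j = a \<or> j = b then [:0, 1::real:] else 1)" for j
    define D where "D = (\<chi> j. if j = a \<or> j = b then (\<chi> i. [:P $ i $ j:]) else (\<chi> i. (C ** Q) $ i $ j))"
    have CQ: "(C ** Q) $ i $ j = [:- (A ** P) $ i $ j, P $ i $ j:]" for i j
    proof -
      have "(C ** Q) $ i $ j = (\<Sum>k\<in>UNIV. C $ i $ k * [:P $ k $ j:])"
        by (simp add: matrix_matrix_mult_def Q_def)
      also have "\<dots> = (\<Sum>k\<in>UNIV. [:- (A $ i $ k * P $ k $ j):] + (if k = i then [:0, P $ k $ j:] else 0))"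
        by (rule sum.cong[OF refl]) (auto simp: C_def)
      also have "\<dots> = [:\<Sum>k\<in>UNIV. - (A $ i $ k * P $ k $ j):] + [:0, P $ i $ j:]"
        by (simp add: sum.distrib sum_to_poly)
      finally show ?thesis by (simp add: matrix_matrix_mult_def sum_negf)
    qed
    have AP: "(A ** P) $ i $ j = 0" if "j = a \<or> j = b" for i j
    proof -
      have "(A ** P) $ i $ j = (A *v (\<chi> k. P $ k $ j)) $ i"
        by (simp add: matrix_matrix_mult_def matrix_vector_mult_def)
      moreover have "(\<chi> k. P $ k $ j) = (if j = a then y else u)"
        using that ab by (auto simp: P_def vec_eq_iff)
      ultimately show ?thesis using Ay u(1) by simp
    qed
    have "transpose (C ** Q) = (\<chi> j. c j *s D $ j)"
      unfolding vec_eq_iff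
    proof (intro allI)
      fix j i show "transpose (C ** Q) $ j $ i = (\<chi> j. c j *s D $ j) $ j $ i"
        by (cases "j = a \<or> j = b") (auto simp: transpose_def c_def D_def CQ AP)
    qed
    then have "det (C ** Q) = det (\<chi> j. c j *s D $ j)" by (metis det_transpose)
    also have "\<dots> = prod c UNIV * det D" by (simp add: det_rows_mul)
    also have "prod c UNIV = prod c {a, b}"
      by (rule prod.mono_neutral_right) (auto simp: c_def)
    also have "\<dots> = [:0, 1:] ^ 2" using ab by (simp add: c_def power2_eq_square)
    finally have "[:- 0, 1:] ^ 2 dvd det C * det Q" by (simp add: det_mul)
    moreover have C: "det C = char_polynomial A" by (simp add: C_def char_polynomial_def)
    \<comment> \<open>\<open>Q\<close> has constant entries, so its determinant is nonzero at 0 and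
      contributes nothing to the order there.\<close>
    moreover have "poly (det Q) 0 = det P"
      unfolding poly_det Q_def by (intro arg_cong[where f = det]) (auto simp: vec_eq_iff)
    then have Q0: "poly (det Q) 0 \<noteq> 0" using detP by simp
    then have nz: "det C * det Q \<noteq> 0" using char_polynomial_nonzero[of A] C by auto
    ultimately have "2 \<le> order 0 (det C * det Q)"
      using order_divides[of 0 2 "det C * det Q"] by simp
    also have "\<dots> = order 0 (det C) + order 0 (det Q)" by (rule order_mult[OF nz])
    also have "\<dots> = 1" using simple C Q0 by (simp add: simple_eigenvalue_def order_0I)
    finally show False by simp
  qed
  then have "x = (x $ b / u $ b) *\<^sub>R u" by (simp add: y_def)
  then show thesis by (rule that)
qed

section \<open>Reduction of the differential-algebraic system\<close>

abbreviation "eta z \<equiv> fst z"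
abbreviation "freq z \<equiv> fst (snd z)"
abbreviation "gen_state z \<equiv> fst (snd (snd z))"
abbreviation "temp z \<equiv> fst (snd (snd (snd z)))"
abbreviation "src_state z \<equiv> snd (snd (snd (snd z)))"

text \<open>In Mode 1 the consumption at a pump bus is proportional to its frequency and acts as
  additional damping.\<close>

fun eff_damping :: "('n::finite, 'k::finite, 'm, 's, 'r) chp \<Rightarrow> 'n hp_mode \<Rightarrow> 'n \<Rightarrow> real" where
  "eff_damping N (Mode1 a) j = damping N j + (if j \<in> pump_buses N then a j else 0)"
| "eff_damping N (Mode2 i m) j = damping N j"

text \<open>The buses whose frequency is dictated by the heating network instead of a swing
  equation.\<close>

fun slack :: "'n hp_mode \<Rightarrow> 'n set" where
  "slack (Mode1 a) = {}"
| "slack (Mode2 i m) = {i}"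

fun slack_gain :: "'n hp_mode \<Rightarrow> real" where
  "slack_gain (Mode1 a) = 0"
| "slack_gain (Mode2 i m) = m"

text \<open>In Mode 2 the consumption is obtained by solving the power balance at the pump bus for
  it.\<close>

fun pump_power :: "('n::finite, 'k::finite, 'm, 's, 'r) chp \<Rightarrow> 'n hp_mode \<Rightarrow> real^('n \<times> 'n) \<Rightarrow> real^'n \<Rightarrow>
    'n \<Rightarrow> real" where
  "pump_power N (Mode1 a) \<eta> \<omega> j = (if j \<in> pump_buses N then a j * \<omega> $ j else 0)"
| "pump_power N (Mode2 i m) \<eta> \<omega> j = (if j = i then net_inflow N \<eta> i else 0)"

text \<open>By the correspondence between pump buses and edges at most one term occurs. The sum also
  covers edges without a heat pump and avoids inverting \<open>pump_edge\<close>.\<close>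

definition pump_heat :: "('n::finite, 'k::finite, 'm, 's, 'r) chp \<Rightarrow> 'n hp_mode \<Rightarrow> real^('n \<times> 'n) \<Rightarrow> real^'n \<Rightarrow>
    'k \<Rightarrow> real" where
  "pump_heat N md \<eta> \<omega> k = (\<Sum>j | j \<in> pump_buses N \<and> pump_edge N j = k. cop N j * pump_power N md \<eta> \<omega> j)"

definition heat_input :: "('n::finite, 'k::finite, 'm::finite, 's, 'r) chp \<Rightarrow> 'n hp_mode \<Rightarrow>
    ('n, 'k, 'm, 's, 'r) chp_state \<Rightarrow> 'k \<Rightarrow> real" where
  "heat_input N md z k =
     heat_generation N (temp z) (src_state z) k + pump_heat N md (eta z) (freq z) k - heat_load N k"

definition temp_rate :: "('n::finite, 'k::finite, 'm::finite, 's, 'r) chp \<Rightarrow> 'n hp_mode \<Rightarrow>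
    ('n, 'k, 'm, 's, 'r) chp_state \<Rightarrow> real^('k + 'm)" where
  "temp_rate N md z = (\<chi> i. (- (A_h N *v temp z) $ i +
     (case i of Inl k \<Rightarrow> heat_input N md z k | Inr _ \<Rightarrow> 0)) / volume N i)"

text \<open>The time derivative of \<open>net_inflow\<close> when the angles move according to the
  frequencies, as \<open>net_inflow_deriv\<close> confirms.\<close>

definition inflow_rate :: "('n::finite, 'k::finite, 'm, 's, 'r) chp \<Rightarrow> real^('n \<times> 'n) \<Rightarrow> real^'n \<Rightarrow>
    'n \<Rightarrow> real" where
  "inflow_rate N \<eta> \<omega> j =
     (\<Sum>i | (i, j) \<in> lines N. susc N (i, j) * (cos (\<eta> $ (i, j)) * (\<omega> $ i - \<omega> $ j)))
   - (\<Sum>k | (j, k) \<in> lines N. susc N (j, k) * (cos (\<eta> $ (j, k)) * (\<omega> $ j - \<omega> $ k)))"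

definition freq_rate :: "('n::finite, 'k::finite, 'm::finite, 's, 'r) chp \<Rightarrow> 'n hp_mode \<Rightarrow>
    ('n, 'k, 'm, 's, 'r) chp_state \<Rightarrow> 'n \<Rightarrow> real" where
  "freq_rate N md z j =
     (if j \<in> gen_buses N then
        (- elec_load N j - eff_damping N md j * freq z $ j + elec_generation N (freq z) (gen_state z) j
          + net_inflow N (eta z) j) / inertia N j
      else if j \<in> slack md then slack_gain md * average_temperature N (temp_rate N md z)
      else inflow_rate N (eta z) (freq z) j / eff_damping N md j)"

text \<open>The frequencies of buses without inertia are functions of the other states; their time
  derivatives are obtained by differentiating the algebraic constraints.\<close>

definition vector_field :: "('n::finite, 'k::finite, 'm::finite, 's::euclidean_space, 'r::euclidean_space) chp \<Rightarrow>
    'n hp_mode \<Rightarrow> ('n, 'k, 'm, 's, 'r) chp_state \<Rightarrow> ('n, 'k, 'm, 's, 'r) chp_state" where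
  "vector_field N md z =
     (\<chi> e. if e \<in> lines N then freq z $ fst e - freq z $ snd e else 0,
      \<chi> j. freq_rate N md z j,
      \<chi> j. if j \<in> gen_buses N then - f_e N j (gen_state z $ j) (freq z $ j) else 0,
      temp_rate N md z,
      \<chi> k. if k \<in> source_edges N then - f_h N k (src_state z $ k) (average_temperature N (temp z)) else 0)"

text \<open>The algebraic constraints are left out here: what remains is a linear subspace, on which
  \<open>peano_existence\<close> applies.\<close>

definition state_space :: "('n::finite, 'k::finite, 'm::finite, 's::euclidean_space, 'r::euclidean_space) chp \<Rightarrow>
    ('n, 'k, 'm, 's, 'r) chp_state set" where
  "state_space N = {z. (\<forall>e. e \<notin> lines N \<longrightarrow> eta z $ e = 0) \<and>
     (\<forall>j. gen_state z $ j \<in> (if j \<in> gen_buses N then S_e N j else {0})) \<and>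
     (\<forall>k. src_state z $ k \<in> (if k \<in> source_edges N then S_h N k else {0}))}"

text \<open>Intended for buses without inertia, where its vanishing is the algebraic
  constraint.\<close>

definition residual :: "('n::finite, 'k::finite, 'm::finite, 's, 'r) chp \<Rightarrow> 'n hp_mode \<Rightarrow>
    ('n, 'k, 'm, 's, 'r) chp_state \<Rightarrow> 'n \<Rightarrow> real" where
  "residual N md z j = (if j \<in> slack md then freq z $ j - slack_gain md * average_temperature N (temp z)
     else eff_damping N md j * freq z $ j + elec_load N j - net_inflow N (eta z) j)"

definition constraint_set :: "('n::finite, 'k::finite, 'm::finite, 's::euclidean_space, 'r::euclidean_space) chp \<Rightarrow>
    'n hp_mode \<Rightarrow> ('n, 'k, 'm, 's, 'r) chp_state set" where
  "constraint_set N md = {z \<in> state_space N. \<forall>j. j \<notin> gen_buses N \<longrightarrow> residual N md z j = 0}"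

text \<open>Each mode determines the consumption uniquely. After its elimination both modes have one
  common form, the difference being carried by \<open>slack\<close>, \<open>slack_gain\<close> and
  \<open>eff_damping\<close>.\<close>

lemma bus_equations_iff:
  assumes "valid_mode N md"
  shows "(\<forall>j. j \<notin> pump_buses N \<longrightarrow> pP j = 0) \<and> bus_equations N md \<eta> \<omega> xe T pP \<omega>d \<longleftrightarrow>
    pP = pump_power N md \<eta> \<omega> \<and>
    (\<forall>j. if j \<in> slack md then \<omega> $ j = slack_gain md * average_temperature N T
      else inertia N j * \<omega>d $ j = - elec_load N j - eff_damping N md j * \<omega> $ j
        + elec_generation N \<omega> xe j + net_inflow N \<eta> j)"
proof (cases md)
  case (Mode1 a)
  have "swing_equation N \<eta> \<omega> xe (pump_power N md \<eta> \<omega>) \<omega>d j \<longleftrightarrow>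
      inertia N j * \<omega>d $ j = - elec_load N j - eff_damping N md j * \<omega> $ j
        + elec_generation N \<omega> xe j + net_inflow N \<eta> j" for j
    by (auto simp: Mode1 swing_equation_def algebra_simps)
  moreover have "(\<forall>j. j \<notin> pump_buses N \<longrightarrow> pP j = 0) \<and> (\<forall>j\<in>pump_buses N. pP j = a j * \<omega> $ j) \<longleftrightarrow>
      pP = pump_power N md \<eta> \<omega>"
    by (auto simp: Mode1 fun_eq_iff)
  ultimately show ?thesis by (auto simp: Mode1)
next
  case (Mode2 i m)
  have p: "pump_buses N = {i}" using assms by (simp add: Mode2)
  have "swing_equation N \<eta> \<omega> xe (pump_power N md \<eta> \<omega>) \<omega>d j \<longleftrightarrow>
      inertia N j * \<omega>d $ j = - elec_load N j - eff_damping N md j * \<omega> $ j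
        + elec_generation N \<omega> xe j + net_inflow N \<eta> j" if "j \<noteq> i" for j
    using that by (auto simp: Mode2 swing_equation_def algebra_simps)
  moreover have "(\<forall>j. j \<notin> pump_buses N \<longrightarrow> pP j = 0) \<and> 0 = - pP i + net_inflow N \<eta> i \<longleftrightarrow>
      pP = pump_power N md \<eta> \<omega>"
    by (auto simp: Mode2 fun_eq_iff p)
  ultimately show ?thesis by (auto simp: Mode2)
qed

text \<open>Every pump edge belongs to exactly one pump bus and all other edges carry zero, so the
  conditions fix \<open>hP\<close> everywhere.\<close>

lemma pump_heat_iff:
  assumes "chp_network N"
  shows "(\<forall>k. k \<notin> pump_edges N \<longrightarrow> hP k = 0) \<and>
      (\<forall>j\<in>pump_buses N. hP (pump_edge N j) = cop N j * pump_power N md \<eta> \<omega> j) \<longleftrightarrow>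
    hP = pump_heat N md \<eta> \<omega>"
proof -
  have bij: "bij_betw (pump_edge N) (pump_buses N) (pump_edges N)"
    using assms by (simp add: chp_network_def)
  have 1: "pump_heat N md \<eta> \<omega> (pump_edge N j) = cop N j * pump_power N md \<eta> \<omega> j"
    if "j \<in> pump_buses N" for j
  proof -
    have "{i. i \<in> pump_buses N \<and> pump_edge N i = pump_edge N j} = {j}"
      using that bij by (auto simp: bij_betw_def inj_on_def)
    then show ?thesis by (simp add: pump_heat_def)
  qed
  have 2: "pump_heat N md \<eta> \<omega> k = 0" if "k \<notin> pump_edges N" for k
  proof -
    have "{i. i \<in> pump_buses N \<and> pump_edge N i = k} = {}"
      using that bij by (auto simp: bij_betw_def)
    then show ?thesis by (simp only: pump_heat_def sum.empty)
  qed
  show ?thesis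
  proof (intro iffI)
    assume L: "(\<forall>k. k \<notin> pump_edges N \<longrightarrow> hP k = 0) \<and>
      (\<forall>j\<in>pump_buses N. hP (pump_edge N j) = cop N j * pump_power N md \<eta> \<omega> j)"
    show "hP = pump_heat N md \<eta> \<omega>"
    proof
      fix k show "hP k = pump_heat N md \<eta> \<omega> k"
      proof (cases "k \<in> pump_edges N")
        case True
        then obtain j where "j \<in> pump_buses N" "k = pump_edge N j" using bij by (auto simp: bij_betw_def)
        then show ?thesis using L 1 by simp
      next
        case False
        then show ?thesis using L 2 by simp
      qed
    qed
  qed (use 1 2 in auto)
qed

lemma slack_not_gen: "valid_mode N md \<Longrightarrow> j \<in> slack md \<Longrightarrow> j \<notin> gen_buses N"
  by (cases md) auto

lemma eff_damping_pos: "valid_mode N md \<Longrightarrow> j \<notin> slack md \<Longrightarrow> 0 < eff_damping N md j"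
  by (cases md) (auto simp: add_pos_pos)

text \<open>The derivatives of frequencies at buses without inertia and of the coordinates kept at
  zero remain open on the right: the constraints do not mention derivatives.
  \<open>solution_trajectory\<close> recovers them.\<close>

lemma chp_dynamics_iff:
  fixes N :: "('n::finite, 'k::finite, 'm::finite, 's::euclidean_space, 'r::euclidean_space) chp"
  assumes N: "chp_network N" and md: "valid_mode N md"
  shows "chp_dynamics N md z v \<longleftrightarrow> z \<in> constraint_set N md \<and>
    (\<forall>e\<in>lines N. eta v $ e = freq z $ fst e - freq z $ snd e) \<and>
    (\<forall>j\<in>gen_buses N. freq v $ j = freq_rate N md z j \<and>
       gen_state v $ j = - f_e N j (gen_state z $ j) (freq z $ j)) \<and>
    temp v = temp_rate N md z \<and>
    (\<forall>k\<in>source_edges N. src_state v $ k = - f_h N k (src_state z $ k) (average_temperature N (temp z)))"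
proof -
  obtain \<eta> \<omega> xe T xh where z: "z = (\<eta>, \<omega>, xe, T, xh)" by (metis prod.exhaust)
  obtain \<eta>d \<omega>d xed Td xhd where v: "v = (\<eta>d, \<omega>d, xed, Td, xhd)" by (metis prod.exhaust)
  have vol: "0 < volume N i" for i using N by (simp add: chp_network_def)
  have in0: "inertia N j = 0" if "j \<notin> gen_buses N" for j using N that by (simp add: chp_network_def)
  have in1: "0 < inertia N j" if "j \<in> gen_buses N" for j using N that by (simp add: chp_network_def)
  have heat: "heat_equation N T xh (pump_heat N md \<eta> \<omega>) Td \<longleftrightarrow> Td = temp_rate N md z"
  proof -
    have "(volume N i * Td $ i = - (A_h N *v T) $ i +
        (case i of Inl k \<Rightarrow> heat_generation N T xh k + pump_heat N md \<eta> \<omega> k - heat_load N k | Inr _ \<Rightarrow> 0))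
      \<longleftrightarrow> Td $ i = temp_rate N md z $ i" for i
      using vol[of i] by (cases i) (simp_all add: temp_rate_def heat_input_def z field_simps)
    then show ?thesis by (simp add: heat_equation_def vec_eq_iff)
  qed
  have bus: "(\<forall>j. if j \<in> slack md then \<omega> $ j = slack_gain md * average_temperature N T
      else inertia N j * \<omega>d $ j = - elec_load N j - eff_damping N md j * \<omega> $ j
        + elec_generation N \<omega> xe j + net_inflow N \<eta> j) \<longleftrightarrow>
      (\<forall>j\<in>gen_buses N. \<omega>d $ j = freq_rate N md z j) \<and> (\<forall>j. j \<notin> gen_buses N \<longrightarrow> residual N md z j = 0)"
    (is "(\<forall>j. ?P j) \<longleftrightarrow> _")
  proof -
    have "?P j \<longleftrightarrow> \<omega>d $ j = freq_rate N md z j" if "j \<in> gen_buses N" for j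
      using in1[OF that] slack_not_gen[OF md, of j] that
      by (auto simp: freq_rate_def z field_simps)
    moreover have "?P j \<longleftrightarrow> residual N md z j = 0" if "j \<notin> gen_buses N" for j
      using in0[OF that] that by (auto simp: residual_def elec_generation_def z)
    ultimately show ?thesis by metis
  qed
  have ex: "(\<exists>pP hP. (\<forall>j. j \<notin> pump_buses N \<longrightarrow> pP j = 0) \<and> (\<forall>k. k \<notin> pump_edges N \<longrightarrow> hP k = 0) \<and>
        (\<forall>j\<in>pump_buses N. hP (pump_edge N j) = cop N j * pP j) \<and>
        bus_equations N md \<eta> \<omega> xe T pP \<omega>d \<and> heat_equation N T xh hP Td) \<longleftrightarrow>
      (\<forall>j\<in>gen_buses N. \<omega>d $ j = freq_rate N md z j) \<and>
      (\<forall>j. j \<notin> gen_buses N \<longrightarrow> residual N md z j = 0) \<and> Td = temp_rate N md z" (is "?L \<longleftrightarrow> _")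
  proof -
    have "?L \<longleftrightarrow> (\<exists>pP hP. ((\<forall>j. j \<notin> pump_buses N \<longrightarrow> pP j = 0) \<and> bus_equations N md \<eta> \<omega> xe T pP \<omega>d) \<and>
        ((\<forall>k. k \<notin> pump_edges N \<longrightarrow> hP k = 0) \<and> (\<forall>j\<in>pump_buses N. hP (pump_edge N j) = cop N j * pP j))
        \<and> heat_equation N T xh hP Td)" by blast
    also have "\<dots> \<longleftrightarrow> (\<exists>pP hP. pP = pump_power N md \<eta> \<omega> \<and>
        ((\<forall>j\<in>gen_buses N. \<omega>d $ j = freq_rate N md z j) \<and> (\<forall>j. j \<notin> gen_buses N \<longrightarrow> residual N md z j = 0)) \<and>
        ((\<forall>k. k \<notin> pump_edges N \<longrightarrow> hP k = 0) \<and>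
         (\<forall>j\<in>pump_buses N. hP (pump_edge N j) = cop N j * pump_power N md \<eta> \<omega> j))
        \<and> heat_equation N T xh hP Td)"
      unfolding bus_equations_iff[OF md] bus by blast
    also have "\<dots> \<longleftrightarrow> (\<forall>j\<in>gen_buses N. \<omega>d $ j = freq_rate N md z j) \<and>
      (\<forall>j. j \<notin> gen_buses N \<longrightarrow> residual N md z j = 0) \<and> Td = temp_rate N md z"
      unfolding pump_heat_iff[OF N] heat[symmetric] by blast
    finally show ?thesis .
  qed
  show ?thesis
    unfolding z v chp_dynamics.simps ex[unfolded z] constraint_set_def state_space_def
    by (auto simp: generation_dynamics_def split: if_splits)
qed

section \<open>Derivatives and continuity of the network quantities\<close>

lemma has_vector_derivative_vecI:
  fixes f :: "real \<Rightarrow> 'a::real_normed_vector^'i"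
  assumes "\<And>i. ((\<lambda>t. f t $ i) has_vector_derivative d $ i) (at t within I)"
  shows "(f has_vector_derivative d) (at t within I)"
  unfolding has_vector_derivative_def has_derivative_within
proof
  show "bounded_linear (\<lambda>x. x *\<^sub>R d)" by (rule bounded_linear_scaleR_left)
  have "((\<lambda>y. (1 / norm (y - t)) *\<^sub>R (f y $ i - (f t $ i + (y - t) *\<^sub>R d $ i))) \<longlongrightarrow> 0) (at t within I)" for i
    using assms[of i] unfolding has_vector_derivative_def has_derivative_within by (rule conjunct2)
  then show "((\<lambda>y. (1 / norm (y - t)) *\<^sub>R (f y - (f t + (y - t) *\<^sub>R d))) \<longlongrightarrow> 0) (at t within I)"
    by (intro vec_tendstoI) simp
qed

lemma has_vector_derivative_nth:
  "(f has_vector_derivative d) F \<Longrightarrow> ((\<lambda>t. f t $ i) has_vector_derivative d $ i) F"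
  by (rule bounded_linear.has_vector_derivative[OF bounded_linear_vec_nth])

lemma has_vector_derivative_fst:
  "(f has_vector_derivative d) F \<Longrightarrow> ((\<lambda>t. fst (f t)) has_vector_derivative fst d) F"
  by (rule bounded_linear.has_vector_derivative[OF bounded_linear_fst])

lemma has_vector_derivative_snd:
  "(f has_vector_derivative d) F \<Longrightarrow> ((\<lambda>t. snd (f t)) has_vector_derivative snd d) F"
  by (rule bounded_linear.has_vector_derivative[OF bounded_linear_snd])

lemma has_vector_derivative_prodI:
  assumes "((\<lambda>t. fst (f t)) has_vector_derivative fst d) (at t within I)"
    and "((\<lambda>t. snd (f t)) has_vector_derivative snd d) (at t within I)"
  shows "(f has_vector_derivative d) (at t within I)"
  using has_vector_derivative_Pair[OF assms] by simp

lemma average_temperature_deriv: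
  assumes "(T has_vector_derivative d) (at t within I)"
  shows "((\<lambda>t. average_temperature N (T t)) has_real_derivative average_temperature N d) (at t within I)"
proof -
  have "((\<lambda>t. T t $ i) has_real_derivative d $ i) (at t within I)" for i
    using has_vector_derivative_nth[OF assms] by (simp add: has_real_derivative_iff_has_vector_derivative)
  then show ?thesis unfolding average_temperature_def
    by (intro DERIV_cdivide DERIV_sum DERIV_cmult)
qed

lemma net_inflow_deriv:
  assumes "\<And>e. e \<in> lines N \<Longrightarrow>
    ((\<lambda>t. \<eta> t $ e) has_real_derivative \<omega> $ fst e - \<omega> $ snd e) (at t within I)"
  shows "((\<lambda>t. net_inflow N (\<eta> t) j) has_real_derivative inflow_rate N (\<eta> t) \<omega> j) (at t within I)"
proof -
  have "((\<lambda>t. susc N e * sin (\<eta> t $ e)) has_real_derivative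
      susc N e * (cos (\<eta> t $ e) * (\<omega> $ fst e - \<omega> $ snd e))) (at t within I)" if "e \<in> lines N" for e
    by (intro DERIV_cmult DERIV_chain2[where f = sin] DERIV_sin assms that)
  from this[of "(_, _)"] show ?thesis unfolding net_inflow_def inflow_rate_def line_flow_def
    by (intro DERIV_diff DERIV_sum) auto
qed

lemma locally_lipschitz_on_continuous:
  assumes "locally_lipschitz_on S f"
  shows "continuous_on S f"
  unfolding continuous_on_eq_continuous_within
proof
  fix p assume p: "p \<in> S"
  then obtain e L where e: "0 < e" and L: "L-lipschitz_on (ball p e \<inter> S) f"
    using assms unfolding locally_lipschitz_on_def by blast
  have "continuous (at p within ball p e \<inter> S) f"
    using lipschitz_on_continuous_on[OF L] p e by (simp add: continuous_on_eq_continuous_within)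
  moreover have "at p within ball p e \<inter> S = at p within S"
    by (rule at_within_nhd[of _ "ball p e"]) (use e in auto)
  ultimately show "continuous (at p within S) f" by simp
qed

lemma locally_lipschitz_on_compose:
  assumes "locally_lipschitz_on (S \<times> UNIV) (\<lambda>(x, u). f x u)"
    and "continuous_on A x" "continuous_on A u" "\<And>z. z \<in> A \<Longrightarrow> x z \<in> S"
  shows "continuous_on A (\<lambda>z. f (x z) (u z))"
  using continuous_on_compose2[OF locally_lipschitz_on_continuous[OF assms(1)]
      continuous_on_Pair[OF assms(2,3)]] assms(4) by auto

lemma inflow_rate_continuous [continuous_intros]:
  fixes f :: "'z::t2_space \<Rightarrow> _"
  shows "continuous_on A f \<Longrightarrow> continuous_on A g \<Longrightarrow> continuous_on A (\<lambda>z. inflow_rate N (f z) (g z) j)"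
  unfolding inflow_rate_def by (intro continuous_intros)

lemma net_inflow_continuous [continuous_intros]:
  fixes f :: "'z::t2_space \<Rightarrow> _"
  shows "continuous_on A f \<Longrightarrow> continuous_on A (\<lambda>z. net_inflow N (f z) j)"
  unfolding net_inflow_def line_flow_def by (intro continuous_intros)

lemma average_temperature_continuous [continuous_intros]:
  "continuous_on A f \<Longrightarrow> continuous_on A (\<lambda>z. average_temperature N (f z))"
  unfolding average_temperature_def divide_inverse by (intro continuous_intros)

lemma pump_heat_continuous [continuous_intros]:
  fixes f :: "'z::t2_space \<Rightarrow> _"
  assumes "continuous_on A f" "continuous_on A g"
  shows "continuous_on A (\<lambda>z. pump_heat N md (f z) (g z) k)"
proof -
  have "continuous_on A (\<lambda>z. pump_power N md (f z) (g z) j)" for j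
  proof (cases md)
    case (Mode1 a)
    then show ?thesis using assms by (cases "j \<in> pump_buses N") (auto intro!: continuous_intros)
  next
    case (Mode2 i m)
    then show ?thesis using assms by (cases "j = i") (auto intro!: continuous_intros)
  qed
  then show ?thesis unfolding pump_heat_def by (intro continuous_intros)
qed

section \<open>The reduced vector field and its solutions\<close>

locale chp_model =
  fixes N :: "('n::finite, 'k::finite, 'm::finite, 's::euclidean_space, 'r::euclidean_space) chp"
    and md :: "'n hp_mode"
  assumes N: "chp_network N" and md: "valid_mode N md"
begin

lemma gen_system: "j \<in> gen_buses N \<Longrightarrow> generation_system (S_e N j) (f_e N j) (g_e N j)"
  using N by (simp add: chp_network_def)

lemma src_system: "k \<in> source_edges N \<Longrightarrow> generation_system (S_h N k) (f_h N k) (g_h N k)"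
  using N by (simp add: chp_network_def)

lemma subspace_state_space: "subspace (state_space N)"
proof -
  have e: "subspace (if j \<in> gen_buses N then S_e N j else {0})" for j
    using gen_system[of j] by (auto simp: generation_system_def)
  have h: "subspace (if k \<in> source_edges N then S_h N k else {0})" for k
    using src_system[of k] by (auto simp: generation_system_def)
  show ?thesis
    unfolding subspace_def state_space_def
    using subspace_0[OF e] subspace_0[OF h] subspace_add[OF e] subspace_add[OF h]
      subspace_scale[OF e] subspace_scale[OF h] by simp
qed

lemma state_in_subspace:
  assumes "z \<in> state_space N"
  shows "j \<in> gen_buses N \<Longrightarrow> gen_state z $ j \<in> S_e N j" "k \<in> source_edges N \<Longrightarrow> src_state z $ k \<in> S_h N k"
proof -
  have "gen_state z $ j \<in> (if j \<in> gen_buses N then S_e N j else {0})"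
    "src_state z $ k \<in> (if k \<in> source_edges N then S_h N k else {0})"
    using assms unfolding state_space_def by blast+
  then show "j \<in> gen_buses N \<Longrightarrow> gen_state z $ j \<in> S_e N j" "k \<in> source_edges N \<Longrightarrow> src_state z $ k \<in> S_h N k"
    by simp_all
qed

lemma gen_continuous:
  assumes "j \<in> gen_buses N"
  shows "continuous_on (state_space N) (\<lambda>z. f_e N j (gen_state z $ j) (freq z $ j))"
    and "continuous_on (state_space N) (\<lambda>z. g_e N j (gen_state z $ j) (freq z $ j))"
proof -
  have *: "locally_lipschitz_on (S_e N j \<times> UNIV) (\<lambda>(x, u). f_e N j x u)"
    "locally_lipschitz_on (S_e N j \<times> UNIV) (\<lambda>(x, u). g_e N j x u)"
    using gen_system[OF assms] unfolding generation_system_def by blast+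
  show "continuous_on (state_space N) (\<lambda>z. f_e N j (gen_state z $ j) (freq z $ j))"
    by (rule locally_lipschitz_on_compose[OF *(1) _ _ state_in_subspace(1)[OF _ assms]]) (intro continuous_intros | assumption)+
  show "continuous_on (state_space N) (\<lambda>z. g_e N j (gen_state z $ j) (freq z $ j))"
    by (rule locally_lipschitz_on_compose[OF *(2) _ _ state_in_subspace(1)[OF _ assms]]) (intro continuous_intros | assumption)+
qed

lemma src_continuous:
  assumes "k \<in> source_edges N"
  shows "continuous_on (state_space N) (\<lambda>z. f_h N k (src_state z $ k) (average_temperature N (temp z)))"
    and "continuous_on (state_space N) (\<lambda>z. g_h N k (src_state z $ k) (average_temperature N (temp z)))"
proof -
  have *: "locally_lipschitz_on (S_h N k \<times> UNIV) (\<lambda>(x, u). f_h N k x u)"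
    "locally_lipschitz_on (S_h N k \<times> UNIV) (\<lambda>(x, u). g_h N k x u)"
    using src_system[OF assms] unfolding generation_system_def by blast+
  show "continuous_on (state_space N) (\<lambda>z. f_h N k (src_state z $ k) (average_temperature N (temp z)))"
    by (rule locally_lipschitz_on_compose[OF *(1) _ _ state_in_subspace(2)[OF _ assms]]) (intro continuous_intros | assumption)+
  show "continuous_on (state_space N) (\<lambda>z. g_h N k (src_state z $ k) (average_temperature N (temp z)))"
    by (rule locally_lipschitz_on_compose[OF *(2) _ _ state_in_subspace(2)[OF _ assms]]) (intro continuous_intros | assumption)+
qed

lemma elec_generation_continuous:
  "continuous_on (state_space N) (\<lambda>z. elec_generation N (freq z) (gen_state z) j)"
  by (cases "j \<in> gen_buses N") (auto simp: elec_generation_def intro!: continuous_intros gen_continuous)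

lemma heat_generation_continuous:
  "continuous_on (state_space N) (\<lambda>z. heat_generation N (temp z) (src_state z) k)"
  by (cases "k \<in> source_edges N") (auto simp: heat_generation_def intro!: continuous_intros src_continuous)

lemma temp_rate_continuous: "continuous_on (state_space N) (temp_rate N md)"
proof -
  have "continuous_on (state_space N) (\<lambda>z. case i of Inl k \<Rightarrow> heat_input N md z k | Inr _ \<Rightarrow> 0)" for i :: "'k + 'm"
    by (cases i) (auto simp: heat_input_def intro!: continuous_intros heat_generation_continuous)
  then show ?thesis
    unfolding temp_rate_def divide_inverse matrix_vector_mult_def by (intro continuous_intros)
qed

lemma vector_field_continuous: "continuous_on (state_space N) (vector_field N md)"
proof -
  have 1: "continuous_on (state_space N) (\<lambda>z. freq_rate N md z j)" for j
    unfolding freq_rate_def divide_inverse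
    by (cases "j \<in> gen_buses N"; cases "j \<in> slack md")
      (auto intro!: continuous_intros elec_generation_continuous temp_rate_continuous)
  have 2: "continuous_on (state_space N) (\<lambda>z. if j \<in> gen_buses N then - f_e N j (gen_state z $ j) (freq z $ j) else 0)" for j
    by (cases "j \<in> gen_buses N") (auto intro!: continuous_intros gen_continuous)
  have 3: "continuous_on (state_space N) (\<lambda>z. if k \<in> source_edges N
      then - f_h N k (src_state z $ k) (average_temperature N (temp z)) else 0)" for k
    by (cases "k \<in> source_edges N") (auto intro!: continuous_intros src_continuous)
  have 4: "continuous_on (state_space N) (\<lambda>z. if e \<in> lines N then freq z $ fst e - freq z $ snd e else 0)" for e
    by (cases "e \<in> lines N") (auto intro!: continuous_intros)
  show ?thesis unfolding vector_field_def
    by (intro continuous_on_Pair continuous_on_vec_lambda 1 2 3 4 temp_rate_continuous)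
qed

lemma vector_field_in_state_space:
  assumes z: "z \<in> state_space N"
  shows "vector_field N md z \<in> state_space N"
proof -
  have "- f_e N j (gen_state z $ j) (freq z $ j) \<in> S_e N j" if j: "j \<in> gen_buses N" for j
    using gen_system[OF j] state_in_subspace(1)[OF z j] by (simp add: generation_system_def subspace_neg)
  moreover have "- f_h N k (src_state z $ k) u \<in> S_h N k" if k: "k \<in> source_edges N" for k u
    using src_system[OF k] state_in_subspace(2)[OF z k] by (simp add: generation_system_def subspace_neg)
  ultimately show ?thesis unfolding state_space_def vector_field_def by simp
qed

lemma constraint_subset: "constraint_set N md \<subseteq> state_space N"
  by (auto simp: constraint_set_def)

lemma residual_continuous: "continuous_on A (\<lambda>z. residual N md z j)"
  unfolding residual_def by (cases "j \<in> slack md") (auto intro!: continuous_intros)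

lemma closed_constraint_set: "closed (constraint_set N md)"
proof -
  have eq: "constraint_set N md = state_space N \<inter> (\<Inter>j\<in>- gen_buses N. {z. residual N md z j = 0})"
    by (auto simp: constraint_set_def)
  have "closed {z. residual N md z j = 0}" for j
    by (intro closed_Collect_eq residual_continuous continuous_intros)
  then show ?thesis
    unfolding eq by (intro closed_Int closed_INT ballI closed_subspace[OF subspace_state_space])
qed

lemma vector_field_derivs:
  assumes "(x has_vector_derivative vector_field N md (x t)) (at t within I)"
  shows "e \<in> lines N \<Longrightarrow>
      ((\<lambda>t. eta (x t) $ e) has_real_derivative freq (x t) $ fst e - freq (x t) $ snd e) (at t within I)"
    and "((\<lambda>t. freq (x t) $ j) has_real_derivative freq_rate N md (x t) j) (at t within I)"
    and "((\<lambda>t. temp (x t)) has_vector_derivative temp_rate N md (x t)) (at t within I)"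
    and "j \<in> gen_buses N \<Longrightarrow> ((\<lambda>t. gen_state (x t) $ j) has_vector_derivative
      - f_e N j (gen_state (x t) $ j) (freq (x t) $ j)) (at t within I)"
    and "k \<in> source_edges N \<Longrightarrow> ((\<lambda>t. src_state (x t) $ k) has_vector_derivative
      - f_h N k (src_state (x t) $ k) (average_temperature N (temp (x t)))) (at t within I)"
    and "((\<lambda>t. eta (x t) $ e) has_real_derivative
      (if e \<in> lines N then freq (x t) $ fst e - freq (x t) $ snd e else 0)) (at t within I)"
proof -
  note d1 = has_vector_derivative_snd[OF assms]
  note d2 = has_vector_derivative_snd[OF d1]
  note d3 = has_vector_derivative_snd[OF d2]
  show "((\<lambda>t. eta (x t) $ e) has_real_derivative
      (if e \<in> lines N then freq (x t) $ fst e - freq (x t) $ snd e else 0)) (at t within I)"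
    using has_vector_derivative_nth[OF has_vector_derivative_fst[OF assms], of e]
    by (simp add: has_real_derivative_iff_has_vector_derivative vector_field_def)
  then show "e \<in> lines N \<Longrightarrow>
      ((\<lambda>t. eta (x t) $ e) has_real_derivative freq (x t) $ fst e - freq (x t) $ snd e) (at t within I)"
    by simp
  show "((\<lambda>t. freq (x t) $ j) has_real_derivative freq_rate N md (x t) j) (at t within I)"
    using has_vector_derivative_nth[OF has_vector_derivative_fst[OF d1], of j]
    by (simp add: has_real_derivative_iff_has_vector_derivative vector_field_def)
  show "((\<lambda>t. temp (x t)) has_vector_derivative temp_rate N md (x t)) (at t within I)"
    using has_vector_derivative_fst[OF d3] by (simp add: vector_field_def)
  show "j \<in> gen_buses N \<Longrightarrow> ((\<lambda>t. gen_state (x t) $ j) has_vector_derivative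
      - f_e N j (gen_state (x t) $ j) (freq (x t) $ j)) (at t within I)"
    using has_vector_derivative_nth[OF has_vector_derivative_fst[OF d2], of j] by (simp add: vector_field_def)
  show "k \<in> source_edges N \<Longrightarrow> ((\<lambda>t. src_state (x t) $ k) has_vector_derivative
      - f_h N k (src_state (x t) $ k) (average_temperature N (temp (x t)))) (at t within I)"
    using has_vector_derivative_nth[OF has_vector_derivative_snd[OF d3], of k] by (simp add: vector_field_def)
qed

text \<open>At buses without inertia \<open>freq_rate\<close> is chosen precisely so that the terms
  of this derivative cancel.\<close>

lemma residual_deriv:
  assumes x: "(x has_vector_derivative vector_field N md (x t)) (at t within I)" and j: "j \<notin> gen_buses N"
  shows "((\<lambda>t. residual N md (x t) j) has_real_derivative 0) (at t within I)"
proof (cases "j \<in> slack md")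
  case True
  have "((\<lambda>t. freq (x t) $ j - slack_gain md * average_temperature N (temp (x t))) has_real_derivative
      freq_rate N md (x t) j - slack_gain md * average_temperature N (temp_rate N md (x t))) (at t within I)"
    by (intro DERIV_diff DERIV_cmult average_temperature_deriv vector_field_derivs[OF x])
  then show ?thesis using True j by (simp add: residual_def freq_rate_def)
next
  case False
  have "((\<lambda>t. eff_damping N md j * freq (x t) $ j + elec_load N j - net_inflow N (eta (x t)) j) has_real_derivative
      eff_damping N md j * freq_rate N md (x t) j + 0 - inflow_rate N (eta (x t)) (freq (x t)) j) (at t within I)"
    by (intro DERIV_diff DERIV_add DERIV_const DERIV_cmult net_inflow_deriv vector_field_derivs[OF x])
  then show ?thesis using False j eff_damping_pos[OF md False] by (simp add: residual_def freq_rate_def)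
qed

text \<open>Peano's theorem is applied on the linear space \<open>state_space N\<close>, ignoring
  the constraints. A solution that starts on them stays on them, because the residuals are constant
  along it.\<close>

lemma vector_field_viable:
  assumes "p \<in> constraint_set N md"
  shows "\<exists>e>0. \<exists>x. x 0 = p \<and> trajectory (vector_field N md) (constraint_set N md) {0..e} x"
proof -
  have "p \<in> state_space N" using assms constraint_subset by auto
  then obtain e x where e: "0 < e" "x 0 = p" and x: "trajectory (vector_field N md) (state_space N) {0..e} x"
    using peano_existence[OF subspace_state_space vector_field_continuous vector_field_in_state_space] by blast
  have "x t \<in> constraint_set N md" if t: "t \<in> {0..e}" for t
    unfolding constraint_set_def
  proof (intro CollectI conjI allI impI)
    show "x t \<in> state_space N" using trajectory_in[OF x t] .
    fix j assume j: "j \<notin> gen_buses N"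
    have "\<exists>c. \<forall>s\<in>{0..e}. residual N md (x s) j = c"
      by (rule has_field_derivative_zero_constant)
        (auto intro!: residual_deriv j trajectory_deriv[OF x])
    then have "residual N md (x t) j = residual N md (x 0) j" using t e by auto
    then show "residual N md (x t) j = 0" using assms e j by (simp add: constraint_set_def)
  qed
  then show ?thesis using trajectory_codomain[OF x] e by blast
qed

lemma dynamics_vector_field:
  "z \<in> constraint_set N md \<Longrightarrow> chp_dynamics N md z (vector_field N md z)"
  unfolding chp_dynamics_iff[OF N md] by (simp add: vector_field_def)

lemma trajectory_solution:
  assumes "forward_interval I" "trajectory (vector_field N md) (constraint_set N md) I z"
  shows "solution_of (chp_dynamics N md) I z"
  unfolding solution_of_def
proof (intro conjI ballI)
  fix t assume t: "t \<in> I"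
  show "\<exists>v. (z has_vector_derivative v) (at t within I) \<and> chp_dynamics N md (z t) v"
    using trajectory_deriv[OF assms(2) t] dynamics_vector_field[OF trajectory_in[OF assms(2) t]] by blast
qed (rule assms)

text \<open>\<open>chp_dynamics\<close> does not determine the witness \<open>v\<close> at the
  algebraic variables. But the constraints hold throughout \<open>I\<close>, so these variables are
  functions of the others, or constantly zero, and differentiating these identities gives the
  entries of the vector field.\<close>

lemma solution_trajectory:
  assumes "solution_of (chp_dynamics N md) I z"
  shows "trajectory (vector_field N md) (constraint_set N md) I z"
proof -
  have zM: "z t \<in> constraint_set N md" if "t \<in> I" for t
    using assms that unfolding solution_of_def chp_dynamics_iff[OF N md] by blast
  show ?thesis unfolding trajectory_def
  proof (intro ballI conjI)
    fix t assume t: "t \<in> I"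
    then show "z t \<in> constraint_set N md" by (rule zM)
    obtain v where v: "(z has_vector_derivative v) (at t within I)" and R: "chp_dynamics N md (z t) v"
      using assms t unfolding solution_of_def by blast
    note R = R[unfolded chp_dynamics_iff[OF N md]]
    note v1 = has_vector_derivative_snd[OF v]
    note v2 = has_vector_derivative_snd[OF v1]
    note v3 = has_vector_derivative_snd[OF v2]
    have const: "(f has_vector_derivative 0) (at t within I)" if "\<And>s. s \<in> I \<Longrightarrow> f s = c"
      for f :: "real \<Rightarrow> 'x::real_normed_vector" and c
      by (rule has_vector_derivative_transform[OF t _ has_vector_derivative_const[of c]]) (use that in auto)
    have eta: "((\<lambda>t. eta (z t) $ e) has_vector_derivative eta (vector_field N md (z t)) $ e) (at t within I)" for e
    proof (cases "e \<in> lines N")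
      case True
      then show ?thesis using has_vector_derivative_nth[OF has_vector_derivative_fst[OF v], of e] R
        by (simp add: vector_field_def)
    next
      case False
      then have "eta (z s) $ e = 0" if "s \<in> I" for s
        using zM[OF that] by (cases e) (auto simp: constraint_set_def state_space_def)
      from const[of "\<lambda>s. eta (z s) $ e", OF this] show ?thesis using False by (simp add: vector_field_def)
    qed
    have gen: "((\<lambda>t. gen_state (z t) $ j) has_vector_derivative gen_state (vector_field N md (z t)) $ j) (at t within I)" for j
    proof (cases "j \<in> gen_buses N")
      case True
      then show ?thesis using has_vector_derivative_nth[OF has_vector_derivative_fst[OF v2], of j] R
        by (simp add: vector_field_def)
    next
      case False
      then have "gen_state (z s) $ j = 0" if "s \<in> I" for s
        using zM[OF that] by (auto simp: constraint_set_def state_space_def split: if_splits)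
      from const[of "\<lambda>s. gen_state (z s) $ j", OF this] show ?thesis using False by (simp add: vector_field_def)
    qed
    have src: "((\<lambda>t. src_state (z t) $ k) has_vector_derivative src_state (vector_field N md (z t)) $ k) (at t within I)" for k
    proof (cases "k \<in> source_edges N")
      case True
      then show ?thesis using has_vector_derivative_nth[OF has_vector_derivative_snd[OF v3], of k] R
        by (simp add: vector_field_def)
    next
      case False
      then have "src_state (z s) $ k = 0" if "s \<in> I" for s
        using zM[OF that] by (auto simp: constraint_set_def state_space_def split: if_splits)
      from const[of "\<lambda>s. src_state (z s) $ k", OF this] show ?thesis using False by (simp add: vector_field_def)
    qed
    have temp: "((\<lambda>t. temp (z t)) has_vector_derivative temp_rate N md (z t)) (at t within I)"
      using has_vector_derivative_fst[OF v3] R by simp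
    have freq: "((\<lambda>t. freq (z t) $ j) has_vector_derivative freq_rate N md (z t) j) (at t within I)" for j
    proof (cases "j \<in> gen_buses N")
      case True
      then show ?thesis using has_vector_derivative_nth[OF has_vector_derivative_fst[OF v1], of j] R by simp
    next
      case False
      have res: "residual N md (z s) j = 0" if "s \<in> I" for s
        using zM[OF that] False by (simp add: constraint_set_def)
      show ?thesis
      proof (cases "j \<in> slack md")
        case True
        have "((\<lambda>t. slack_gain md * average_temperature N (temp (z t))) has_real_derivative freq_rate N md (z t) j)
            (at t within I)"
          using DERIV_cmult[OF average_temperature_deriv[OF temp]] True False by (simp add: freq_rate_def)
        then have "((\<lambda>t. slack_gain md * average_temperature N (temp (z t))) has_vector_derivative freq_rate N md (z t) j)
            (at t within I)" by (simp add: has_real_derivative_iff_has_vector_derivative)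
        then show ?thesis
          by (rule has_vector_derivative_transform[OF t, rotated]) (use res True in \<open>simp add: residual_def\<close>)
      next
        case ns: False
        \<comment> \<open>The constraint solved for the frequency: positive effective damping makes
          it an explicit function of the angles.\<close>
        have "((\<lambda>t. (net_inflow N (eta (z t)) j - elec_load N j) / eff_damping N md j) has_real_derivative
            (inflow_rate N (eta (z t)) (freq (z t)) j - 0) / eff_damping N md j) (at t within I)"
        proof (intro DERIV_cdivide DERIV_diff DERIV_const net_inflow_deriv)
          show "((\<lambda>t. eta (z t) $ e) has_real_derivative freq (z t) $ fst e - freq (z t) $ snd e) (at t within I)"
            if "e \<in> lines N" for e
            using eta[of e] that by (simp add: has_real_derivative_iff_has_vector_derivative vector_field_def)
        qed
        then have "((\<lambda>t. (net_inflow N (eta (z t)) j - elec_load N j) / eff_damping N md j) has_vector_derivative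
            freq_rate N md (z t) j) (at t within I)"
          using False ns by (simp add: has_real_derivative_iff_has_vector_derivative freq_rate_def)
        then show ?thesis
          by (rule has_vector_derivative_transform[OF t, rotated])
            (use res ns eff_damping_pos[OF md ns] in \<open>simp add: residual_def field_simps\<close>)
      qed
    qed
    have 1: "((\<lambda>t. freq (z t)) has_vector_derivative freq (vector_field N md (z t))) (at t within I)"
      by (rule has_vector_derivative_vecI) (simp add: vector_field_def freq)
    have 2: "((\<lambda>t. temp (z t)) has_vector_derivative temp (vector_field N md (z t))) (at t within I)"
      using temp by (simp add: vector_field_def)
    note e = has_vector_derivative_vecI[where f = "\<lambda>t. eta (z t)", OF eta]
    note g = has_vector_derivative_vecI[where f = "\<lambda>t. gen_state (z t)", OF gen]
    note s = has_vector_derivative_vecI[where f = "\<lambda>t. src_state (z t)", OF src]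
    show "(z has_vector_derivative vector_field N md (z t)) (at t within I)"
      by (rule has_vector_derivative_prodI[OF e has_vector_derivative_prodI[OF 1
            has_vector_derivative_prodI[OF g has_vector_derivative_prodI[OF 2 s]]]])
  qed
qed

end

section \<open>Energy of the network\<close>

text \<open>Passivity, strict minimality and asymptotic stability each come with a neighbourhood of
  their own; here they are stated on a common one. The last clause freezes the input at
  \<open>us\<close>, the only input for which stability is assumed.\<close>

definition passive_system ::
    "'s::euclidean_space set \<Rightarrow> ('s \<Rightarrow> real \<Rightarrow> 's) \<Rightarrow> ('s \<Rightarrow> real \<Rightarrow> real) \<Rightarrow> real \<Rightarrow> 's \<Rightarrow>
     ('s \<Rightarrow> real) \<Rightarrow> ('s \<Rightarrow> 's) \<Rightarrow> (real \<Rightarrow> real) \<Rightarrow> 's set \<Rightarrow> real set \<Rightarrow> bool" where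
  "passive_system S f g us xs V dV \<phi> X \<Omega> \<longleftrightarrow>
     X \<subseteq> S \<and> V xs = 0 \<and> \<phi> 0 = 0 \<and> (\<forall>s. s \<noteq> 0 \<longrightarrow> 0 < \<phi> s) \<and>
     (\<forall>x\<in>X. 0 \<le> V x \<and> (V x = 0 \<longrightarrow> x = xs) \<and> (V has_derivative (\<lambda>h. dV x \<bullet> h)) (at x within S) \<and>
        (\<forall>u\<in>\<Omega>. dV x \<bullet> (- f x u) \<le> (- u + us) * ((- g x u) - (- g xs us)) - \<phi> (- u + us))) \<and>
     (\<forall>x. solution_of (generation_dynamics S f us) {0..} x \<and> x 0 \<in> X \<longrightarrow> (x \<longlongrightarrow> xs) at_top)"

lemma passive_systemD:
  assumes "passive_system S f g us xs V dV \<phi> X \<Omega>"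
  shows "X \<subseteq> S" "V xs = 0" "0 \<le> \<phi> s" "\<phi> s = 0 \<Longrightarrow> s = 0"
    and "x \<in> X \<Longrightarrow> 0 \<le> V x" "x \<in> X \<Longrightarrow> V x = 0 \<Longrightarrow> x = xs"
    and "x \<in> X \<Longrightarrow> (V has_derivative (\<lambda>h. dV x \<bullet> h)) (at x within S)"
    and "x \<in> X \<Longrightarrow> u \<in> \<Omega> \<Longrightarrow>
      dV x \<bullet> (- f x u) \<le> (- u + us) * ((- g x u) - (- g xs us)) - \<phi> (- u + us)"
    and "solution_of (generation_dynamics S f us) {0..} y \<Longrightarrow> y 0 \<in> X \<Longrightarrow> (y \<longlongrightarrow> xs) at_top"
proof -
  have pos: "s \<noteq> 0 \<longrightarrow> 0 < \<phi> s" and zero: "\<phi> 0 = 0" using assms by (simp_all add: passive_system_def)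
  show "0 \<le> \<phi> s" using pos zero by (cases "s = 0") auto
  show "\<phi> s = 0 \<Longrightarrow> s = 0" using pos by auto
qed (use assms in \<open>simp_all add: passive_system_def\<close>)

lemma passive_system_converges:
  assumes p: "passive_system S f g us xs V dV \<phi> X \<Omega>"
    and y: "\<And>t. 0 \<le> t \<Longrightarrow> y t \<in> X" "\<And>t. 0 \<le> t \<Longrightarrow> (y has_vector_derivative - f (y t) us) (at t within {0..})"
  shows "(y \<longlongrightarrow> xs) at_top"
proof (rule passive_systemD(9)[OF p])
  show "solution_of (generation_dynamics S f us) {0..} y"
    unfolding solution_of_def generation_dynamics_def
  proof (intro conjI ballI)
    show "forward_interval {0..}" by (simp add: forward_interval_def)
    fix t :: real assume t: "t \<in> {0..}"
    then have "y t \<in> S" using y(1) passive_systemD(1)[OF p] by auto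
    then show "\<exists>v. (y has_vector_derivative v) (at t within {0..}) \<and> y t \<in> S \<and> v = - f (y t) us"
      using y(2) t by auto
  qed
qed (use y in simp)

text \<open>The storage function is differentiable relative to the subspace \<open>S\<close> only,
  so the chain rule asks for the whole path to lie in \<open>S\<close>.\<close>

lemma storage_deriv:
  assumes V: "(V has_derivative (\<lambda>h. dV \<bullet> h)) (at (x t) within S)"
    and x: "(x has_vector_derivative v) (at t within I)" and S: "\<And>s. s \<in> I \<Longrightarrow> x s \<in> S"
  shows "((\<lambda>t. V (x t)) has_real_derivative dV \<bullet> v) (at t within I)"
proof -
  have "(V has_derivative (\<lambda>h. dV \<bullet> h)) (at (x t) within x ` I)"
    by (rule has_derivative_subset[OF V]) (use S in auto)
  from has_derivative_in_compose[OF x[unfolded has_vector_derivative_def] this]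
  have "((\<lambda>t. V (x t)) has_derivative (\<lambda>h. dV \<bullet> (h *\<^sub>R v))) (at t within I)" .
  then show ?thesis
    unfolding has_field_derivative_def by (simp add: mult_commute_abs)
qed

lemma sum_over_lines:
  fixes h :: "'n::finite \<times> 'n \<Rightarrow> real"
  shows "(\<Sum>e\<in>L. h e) = (\<Sum>j\<in>UNIV. \<Sum>i | (i, j) \<in> L. h (i, j))"
    and "(\<Sum>e\<in>L. h e) = (\<Sum>j\<in>UNIV. \<Sum>k | (j, k) \<in> L. h (j, k))"
proof -
  have "(\<Sum>e\<in>L. h e) = (\<Sum>e\<in>UNIV. if e \<in> L then h e else 0)"
    by (simp add: sum.If_cases)
  also have "\<dots> = (\<Sum>(j, k)\<in>UNIV \<times> UNIV. if (j, k) \<in> L then h (j, k) else 0)"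
    by (rule sum.cong) auto
  also have "\<dots> = (\<Sum>j\<in>UNIV. \<Sum>k\<in>UNIV. if (j, k) \<in> L then h (j, k) else 0)"
    by (simp only: sum.cartesian_product)
  finally have eq: "(\<Sum>e\<in>L. h e) = (\<Sum>j\<in>UNIV. \<Sum>k\<in>UNIV. if (j, k) \<in> L then h (j, k) else 0)" .
  then show "(\<Sum>e\<in>L. h e) = (\<Sum>j\<in>UNIV. \<Sum>k | (j, k) \<in> L. h (j, k))"
    by (simp add: sum.If_cases)
  have "(\<Sum>e\<in>L. h e) = (\<Sum>k\<in>UNIV. \<Sum>j\<in>UNIV. if (j, k) \<in> L then h (j, k) else 0)"
    unfolding eq by (rule sum.swap)
  then show "(\<Sum>e\<in>L. h e) = (\<Sum>j\<in>UNIV. \<Sum>i | (i, j) \<in> L. h (i, j))"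
    by (simp add: sum.If_cases)
qed

text \<open>Summation by parts on the graph: the contributions of the lines are regrouped by their
  end points.\<close>

lemma sum_line_flow:
  "(\<Sum>e\<in>lines N. line_flow N \<eta> e * (\<omega> (fst e) - \<omega> (snd e))) = - (\<Sum>j\<in>UNIV. \<omega> j * net_inflow N \<eta> j)"
proof -
  have 1: "(\<Sum>e\<in>lines N. line_flow N \<eta> e * \<omega> (fst e)) = (\<Sum>j\<in>UNIV. \<omega> j * (\<Sum>k | (j, k) \<in> lines N. line_flow N \<eta> (j, k)))"
    unfolding sum_over_lines(2) by (simp add: sum_distrib_left mult.commute)
  have 2: "(\<Sum>e\<in>lines N. line_flow N \<eta> e * \<omega> (snd e)) = (\<Sum>j\<in>UNIV. \<omega> j * (\<Sum>i | (i, j) \<in> lines N. line_flow N \<eta> (i, j)))"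
    unfolding sum_over_lines(1) by (simp add: sum_distrib_left mult.commute)
  show ?thesis
    unfolding net_inflow_def right_diff_distrib sum_subtractf 1 2 by simp
qed

lemma sum_net_inflow: "(\<Sum>j\<in>UNIV. net_inflow N \<eta> j) = 0"
  using sum_line_flow[of N \<eta> "\<lambda>_. 1"] by simp

text \<open>This is the Bregman divergence of \<open>- cos\<close>, which is strictly convex on the
  interval because its derivative \<open>sin\<close> is strictly increasing there.\<close>

lemma angle_energy_pos:
  fixes a b :: real
  assumes "\<bar>a\<bar> < pi / 2" "\<bar>b\<bar> < pi / 2" "a \<noteq> b"
  shows "0 < cos a - cos b - sin a * (b - a)"
proof (cases "a < b")
  have der: "((\<lambda>x. - cos x) has_real_derivative sin x) (at x)" for x :: real
    by (auto intro!: derivative_eq_intros)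
  case True
  then obtain c where c: "a < c" "c < b" "- cos b - - cos a = (b - a) * sin c"
    using MVT2[OF True der] by blast
  have "sin a < sin c" by (rule sin_monotone_2pi) (use c assms in auto)
  then have "0 < (b - a) * (sin c - sin a)" using True by simp
  then show ?thesis using c(3) by (simp add: algebra_simps)
next
  have der: "((\<lambda>x. - cos x) has_real_derivative sin x) (at x)" for x :: real
    by (auto intro!: derivative_eq_intros)
  case False
  then have ba: "b < a" using assms by simp
  then obtain c where c: "b < c" "c < a" "- cos a - - cos b = (a - b) * sin c"
    using MVT2[OF ba der] by blast
  have "sin c < sin a" by (rule sin_monotone_2pi) (use c assms in auto)
  then have "0 < (a - b) * (sin a - sin c)" using ba by simp
  then show ?thesis using c(3) by (simp add: algebra_simps)
qed

text \<open>The radius \<open>r\<close> has to be so small that all local hypotheses hold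
  simultaneously on the part of the closed ball that satisfies the constraints; this is what the
  three \<open>near\<close> assumptions express.\<close>

locale passive_chp = chp_model N md
  for N :: "('n::finite, 'k::finite, 'm::finite, 's::euclidean_space, 'r::euclidean_space) chp"
    and md :: "'n hp_mode" +
  fixes zs :: "('n, 'k, 'm, 's, 'r) chp_state" and r :: real
    and Ve :: "'n \<Rightarrow> 's \<Rightarrow> real" and dVe \<phi>e Xe \<Omega>e
    and Vh :: "'k \<Rightarrow> 'r \<Rightarrow> real" and dVh \<phi>h Xh \<Omega>h
  assumes zs: "zs \<in> constraint_set N md" "vector_field N md zs = 0" and r: "0 < r"
    and pe: "j \<in> gen_buses N \<Longrightarrow> passive_system (S_e N j) (f_e N j) (g_e N j) (freq zs $ j) (gen_state zs $ j)
          (Ve j) (dVe j) (\<phi>e j) (Xe j) (\<Omega>e j)"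
    and ph: "k \<in> source_edges N \<Longrightarrow> passive_system (S_h N k) (f_h N k) (g_h N k)
          (average_temperature N (temp zs)) (src_state zs $ k) (Vh k) (dVh k) (\<phi>h k) (Xh k) (\<Omega>h k)"
    and near_eta: "z \<in> cball zs r \<inter> constraint_set N md \<Longrightarrow> e \<in> lines N \<Longrightarrow> \<bar>eta z $ e\<bar> < pi / 2"
    and near_gen: "z \<in> cball zs r \<inter> constraint_set N md \<Longrightarrow> j \<in> gen_buses N \<Longrightarrow>
          gen_state z $ j \<in> Xe j \<and> freq z $ j \<in> \<Omega>e j"
    and near_src: "z \<in> cball zs r \<inter> constraint_set N md \<Longrightarrow> k \<in> source_edges N \<Longrightarrow>
          src_state z $ k \<in> Xh k \<and> average_temperature N (temp z) \<in> \<Omega>h k"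
begin

abbreviation "F \<equiv> vector_field N md"
abbreviation "M \<equiv> constraint_set N md"
abbreviation "avg z \<equiv> average_temperature N (temp z)"
abbreviation "K \<equiv> cball zs r \<inter> M"

text \<open>Equilibria relative to which the total energy decreases along trajectories in \<open>K\<close>.\<close>

definition equilibria :: "('n, 'k, 'm, 's, 'r) chp_state set" where
  "equilibria = {c \<in> M. F c = 0 \<and> (\<forall>e\<in>lines N. \<bar>eta c $ e\<bar> < pi / 2) \<and>
     gen_state c = gen_state zs \<and> src_state c = src_state zs \<and>
     (\<forall>j. j \<notin> slack md \<longrightarrow> freq c $ j = freq zs $ j) \<and>
     (source_edges N \<noteq> {} \<longrightarrow> avg c = avg zs)}"

text \<open>Kinetic energy, the divergence of \<open>angle_energy_pos\<close> on every line, and the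
  storage functions. The latter are centred at \<open>zs\<close> for every \<open>c\<close>, which
  is consistent because members of \<open>equilibria\<close> share the generation states of
  \<open>zs\<close>.\<close>

definition V_elec :: "('n, 'k, 'm, 's, 'r) chp_state \<Rightarrow> ('n, 'k, 'm, 's, 'r) chp_state \<Rightarrow> real" where
  "V_elec c z = (\<Sum>j\<in>UNIV. inertia N j * (freq z $ j - freq c $ j)\<^sup>2 / 2)
     + (\<Sum>e\<in>lines N. susc N e * (cos (eta c $ e) - cos (eta z $ e) - sin (eta c $ e) * (eta z $ e - eta c $ e)))
     + (\<Sum>j\<in>gen_buses N. Ve j (gen_state z $ j))"

definition V_heat :: "('n, 'k, 'm, 's, 'r) chp_state \<Rightarrow> ('n, 'k, 'm, 's, 'r) chp_state \<Rightarrow> real" where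
  "V_heat c z = (\<Sum>i\<in>UNIV. volume N i) * (avg z - avg c)\<^sup>2 / 2 + (\<Sum>k\<in>source_edges N. Vh k (src_state z $ k))"

text \<open>Deviations are measured from \<open>zs\<close> whatever the centre of the energy, since
  all members of \<open>equilibria\<close> have the frequencies of \<open>zs\<close> off the slack
  bus.\<close>

definition damp_elec :: "('n, 'k, 'm, 's, 'r) chp_state \<Rightarrow> real" where
  "damp_elec z = (\<Sum>j\<in>- slack md. eff_damping N md j * (freq z $ j - freq zs $ j)\<^sup>2)
     + (\<Sum>j\<in>gen_buses N. \<phi>e j (- freq z $ j + freq zs $ j))"

definition damp_heat :: "('n, 'k, 'm, 's, 'r) chp_state \<Rightarrow> real" where
  "damp_heat z = (\<Sum>k\<in>source_edges N. \<phi>h k (- avg z + avg zs))"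

lemma K_M: "z \<in> K \<Longrightarrow> z \<in> M" by simp

lemma M_state_space: "z \<in> M \<Longrightarrow> z \<in> state_space N" using constraint_subset by auto

lemma volume_pos: "0 < volume N i" using N by (simp add: chp_network_def)

lemma total_volume_pos: "0 < (\<Sum>i\<in>UNIV. volume N i)"
  by (rule sum_pos) (auto simp: volume_pos)

lemma inertia_nonneg: "0 \<le> inertia N j"
  using N by (cases "j \<in> gen_buses N") (auto simp: chp_network_def less_imp_le)

lemma inertia_slack: "j \<in> slack md \<Longrightarrow> inertia N j = 0"
  using N slack_not_gen[OF md] by (auto simp: chp_network_def)

lemma zs_equilibrium: "zs \<in> equilibria"
proof -
  have "zs \<in> K" using zs r by simp
  from near_eta[OF this] show ?thesis using zs by (simp add: equilibria_def)
qed

lemma equilibriaD: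
  assumes "c \<in> equilibria"
  shows "c \<in> M" "F c = 0" "e \<in> lines N \<Longrightarrow> \<bar>eta c $ e\<bar> < pi / 2"
    "gen_state c = gen_state zs" "src_state c = src_state zs"
    "j \<notin> slack md \<Longrightarrow> freq c $ j = freq zs $ j" "source_edges N \<noteq> {} \<Longrightarrow> avg c = avg zs"
  using assms by (simp_all add: equilibria_def)

lemma field_zeroD:
  assumes "F c = 0"
  shows "e \<in> lines N \<Longrightarrow> freq c $ fst e = freq c $ snd e" "freq_rate N md c j = 0" "temp_rate N md c = 0"
proof -
  have *: "eta (F c) $ e = 0" "freq (F c) $ j = 0" "temp (F c) = 0" for e j using assms by simp_all
  show "e \<in> lines N \<Longrightarrow> freq c $ fst e = freq c $ snd e" using *(1)[of e] by (simp add: vector_field_def)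
  show "freq_rate N md c j = 0" using *(2)[of j] by (simp add: vector_field_def)
  show "temp_rate N md c = 0" using *(3) by (simp add: vector_field_def)
qed

text \<open>At a bus without inertia both sides vanish by the algebraic constraint. The energy
  balance can therefore treat all buses alike.\<close>

lemma swing_identity:
  assumes z: "z \<in> M" and j: "j \<notin> slack md"
  shows "inertia N j * freq_rate N md z j = - elec_load N j - eff_damping N md j * freq z $ j
    + elec_generation N (freq z) (gen_state z) j + net_inflow N (eta z) j"
proof (cases "j \<in> gen_buses N")
  case True
  then have "0 < inertia N j" using N by (simp add: chp_network_def)
  then show ?thesis using True by (simp add: freq_rate_def)
next
  case False
  then have "inertia N j = 0" using N by (simp add: chp_network_def)
  moreover have "residual N md z j = 0" using z False by (simp add: constraint_set_def)
  ultimately show ?thesis using False j by (simp add: residual_def elec_generation_def)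
qed

text \<open>The power of the line flows cancels between kinetic and potential energy, except at a
  slack bus, which has no kinetic energy. The generation terms are absorbed by the storage
  functions, whose passivity is an inequality; hence a bound on \<open>d\<close> and no
  formula.\<close>

lemma V_elec_deriv:
  assumes z: "trajectory F K I z" and t: "t \<in> I" and c: "c \<in> equilibria"
  obtains d where "((\<lambda>t. V_elec c (z t)) has_real_derivative d) (at t within I)"
    "d \<le> - damp_elec (z t) - (\<Sum>j\<in>slack md. (freq (z t) $ j - freq c $ j) *
      (net_inflow N (eta (z t)) j - net_inflow N (eta c) j))"
proof -
  have zK: "z s \<in> K" if "s \<in> I" for s using trajectory_in[OF z that] .
  note cD = equilibriaD[OF c]
  note zd = vector_field_derivs[OF trajectory_deriv[OF z t]]
  define x where "x = z t"
  have xK: "x \<in> K" "x \<in> M" using zK[OF t] by (auto simp: x_def)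
  define w where "w j = freq x $ j - freq c $ j" for j
  define n where "n j = net_inflow N (eta x) j - net_inflow N (eta c) j" for j
  define G where "G j = elec_generation N (freq x) (gen_state x) j - elec_generation N (freq c) (gen_state c) j" for j
  define d where "d = (\<Sum>j\<in>UNIV. inertia N j * (w j * freq_rate N md x j))
     + (\<Sum>e\<in>lines N. susc N e * ((sin (eta x $ e) - sin (eta c $ e)) * (freq x $ fst e - freq x $ snd e)))
     + (\<Sum>j\<in>gen_buses N. dVe j (gen_state x $ j) \<bullet> (- f_e N j (gen_state x $ j) (freq x $ j)))"
  have "((\<lambda>t. V_elec c (z t)) has_real_derivative d) (at t within I)"
    unfolding V_elec_def d_def
  proof (intro DERIV_add DERIV_sum)
    fix j
    show "((\<lambda>t. inertia N j * (freq (z t) $ j - freq c $ j)\<^sup>2 / 2) has_real_derivative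
        inertia N j * (w j * freq_rate N md x j)) (at t within I)"
      using zd(2)[of j] by (auto intro!: derivative_eq_intros simp: w_def x_def)
  next
    fix e assume "e \<in> lines N"
    from zd(1)[OF this]
    show "((\<lambda>t. susc N e * (cos (eta c $ e) - cos (eta (z t) $ e) - sin (eta c $ e) * (eta (z t) $ e - eta c $ e)))
        has_real_derivative susc N e * ((sin (eta x $ e) - sin (eta c $ e)) * (freq x $ fst e - freq x $ snd e)))
        (at t within I)"
      by (auto intro!: derivative_eq_intros simp: x_def algebra_simps)
  next
    fix j assume j: "j \<in> gen_buses N"
    show "((\<lambda>t. Ve j (gen_state (z t) $ j)) has_real_derivative
        dVe j (gen_state x $ j) \<bullet> (- f_e N j (gen_state x $ j) (freq x $ j))) (at t within I)"
      unfolding x_def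
    proof (rule storage_deriv[OF _ zd(4)[OF j]])
      show "(Ve j has_derivative (\<lambda>h. dVe j (gen_state (z t) $ j) \<bullet> h)) (at (gen_state (z t) $ j) within S_e N j)"
        using passive_systemD(7)[OF pe[OF j]] near_gen[OF zK[OF t] j] by blast
      show "gen_state (z s) $ j \<in> S_e N j" if "s \<in> I" for s
        using near_gen[OF zK[OF that] j] passive_systemD(1)[OF pe[OF j]] by blast
    qed
  qed
  moreover have "d \<le> - damp_elec x - (\<Sum>j\<in>slack md. w j * n j)"
  proof -
    \<comment> \<open>At the equilibrium \<open>c\<close> both ends of a line have the same
      frequency, so frequencies may be replaced by their deviations \<open>w\<close> before
      \<open>sum_line_flow\<close> is used.\<close>
    have lines: "(\<Sum>e\<in>lines N. susc N e * ((sin (eta x $ e) - sin (eta c $ e)) * (freq x $ fst e - freq x $ snd e)))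
        = - (\<Sum>j\<in>UNIV. w j * n j)"
    proof -
      have "(\<Sum>e\<in>lines N. susc N e * ((sin (eta x $ e) - sin (eta c $ e)) * (freq x $ fst e - freq x $ snd e)))
        = (\<Sum>e\<in>lines N. line_flow N (eta x) e * (w (fst e) - w (snd e)) - line_flow N (eta c) e * (w (fst e) - w (snd e)))"
        using field_zeroD(1)[OF cD(2)]
        by (intro sum.cong) (auto simp: w_def line_flow_def algebra_simps)
      also have "\<dots> = - (\<Sum>j\<in>UNIV. w j * n j)"
        unfolding sum_subtractf sum_line_flow by (simp add: n_def right_diff_distrib sum_subtractf)
      finally show ?thesis .
    qed
    have swing: "inertia N j * (w j * freq_rate N md x j) =
        (if j \<in> slack md then 0 else w j * (- eff_damping N md j * w j + G j + n j))" for j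
    proof (cases "j \<in> slack md")
      case False
      have "0 = - elec_load N j - eff_damping N md j * freq c $ j
        + elec_generation N (freq c) (gen_state c) j + net_inflow N (eta c) j"
        using swing_identity[OF cD(1) False] field_zeroD(2)[OF cD(2), of j] by simp
      then have "inertia N j * freq_rate N md x j = - eff_damping N md j * w j + G j + n j"
        using swing_identity[OF xK(2) False] by (simp add: w_def G_def n_def algebra_simps)
      then show ?thesis using False by (metis mult.left_commute)
    qed (simp add: inertia_slack)
    have G: "(\<Sum>j\<in>- slack md. w j * G j) = (\<Sum>j\<in>gen_buses N. w j * G j)"
      by (rule sum.mono_neutral_right) (auto simp: G_def elec_generation_def dest: slack_not_gen[OF md])
    have pass: "dVe j (gen_state x $ j) \<bullet> (- f_e N j (gen_state x $ j) (freq x $ j))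
        \<le> - (w j * G j) - \<phi>e j (- freq x $ j + freq zs $ j)" if j: "j \<in> gen_buses N" for j
    proof -
      have fc: "freq c $ j = freq zs $ j" using cD(6) slack_not_gen[OF md] j by blast
      have "dVe j (gen_state x $ j) \<bullet> (- f_e N j (gen_state x $ j) (freq x $ j)) \<le>
        (- freq x $ j + freq zs $ j) * (- g_e N j (gen_state x $ j) (freq x $ j)
          - - g_e N j (gen_state zs $ j) (freq zs $ j)) - \<phi>e j (- freq x $ j + freq zs $ j)"
        using passive_systemD(8)[OF pe[OF j]] near_gen[OF xK(1) j] by blast
      also have "(- freq x $ j + freq zs $ j) * (- g_e N j (gen_state x $ j) (freq x $ j)
          - - g_e N j (gen_state zs $ j) (freq zs $ j)) = - (w j * G j)"
        using j fc cD(4) by (simp add: w_def G_def elec_generation_def algebra_simps)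
      finally show ?thesis .
    qed
    have D: "(\<Sum>j\<in>- slack md. eff_damping N md j * (w j)\<^sup>2) = (\<Sum>j\<in>- slack md. eff_damping N md j * (freq x $ j - freq zs $ j)\<^sup>2)"
      using cD(6) by (intro sum.cong) (auto simp: w_def)
    have split: "(\<Sum>j\<in>UNIV. w j * n j) = (\<Sum>j\<in>- slack md. w j * n j) + (\<Sum>j\<in>slack md. w j * n j)"
      using sum.union_disjoint[of "- slack md" "slack md" "\<lambda>j. w j * n j"] by (simp add: Compl_partition2)
    have "(\<Sum>j\<in>UNIV. inertia N j * (w j * freq_rate N md x j))
        = (\<Sum>j\<in>- slack md. w j * (- eff_damping N md j * w j + G j + n j))"
      unfolding swing by (simp add: sum.If_cases Compl_eq)
    also have "\<dots> = (\<Sum>j\<in>- slack md. - (eff_damping N md j * (w j)\<^sup>2) + w j * G j + w j * n j)"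
      by (intro sum.cong) (auto simp: algebra_simps power2_eq_square)
    also have "\<dots> = - (\<Sum>j\<in>- slack md. eff_damping N md j * (w j)\<^sup>2) + (\<Sum>j\<in>gen_buses N. w j * G j)
        + (\<Sum>j\<in>- slack md. w j * n j)"
      by (simp add: sum.distrib sum_negf sum_subtractf G)
    finally have 1: "(\<Sum>j\<in>UNIV. inertia N j * (w j * freq_rate N md x j)) = \<dots>" .
    have 2: "(\<Sum>j\<in>gen_buses N. dVe j (gen_state x $ j) \<bullet> (- f_e N j (gen_state x $ j) (freq x $ j)))
        \<le> (\<Sum>j\<in>gen_buses N. - (w j * G j) - \<phi>e j (- freq x $ j + freq zs $ j))"
      by (rule sum_mono) (rule pass)
    show ?thesis
      using 2 unfolding d_def 1 lines damp_elec_def D split by (simp add: sum_subtractf sum_negf)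
  qed
  ultimately show thesis by (intro that) (simp_all add: w_def n_def x_def)
qed

end

lemma sum_UNIV_sum:
  fixes h :: "'a::finite + 'b::finite \<Rightarrow> real"
  shows "(\<Sum>i\<in>UNIV. h i) = (\<Sum>k\<in>UNIV. h (Inl k)) + (\<Sum>i\<in>UNIV. h (Inr i))"
  using sum.Plus[of "UNIV :: 'a set" "UNIV :: 'b set" h] by (simp add: o_def)

lemma trajectory_nonincreasing:
  fixes \<Phi> :: "'a::euclidean_space \<Rightarrow> real"
  assumes x: "trajectory F K {0..b} x" and b: "0 \<le> b"
    and d: "\<And>t. t \<in> {0..b} \<Longrightarrow> \<exists>d\<le>0. ((\<lambda>t. \<Phi> (x t)) has_real_derivative d) (at t within {0..b})"
  shows "\<Phi> (x b) \<le> \<Phi> (x 0)"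
proof (rule DERIV_nonpos_imp_decreasing_open[OF b])
  fix t assume t: "0 < t" "t < b"
  then have "at t within {0..b} = at t" by (intro at_within_interior) auto
  then show "\<exists>d. ((\<lambda>t. \<Phi> (x t)) has_real_derivative d) (at t) \<and> d \<le> 0" using d[of t] t by auto
next
  show "continuous_on {0..b} (\<lambda>t. \<Phi> (x t))"
    unfolding continuous_on_eq_continuous_within using d DERIV_continuous by blast
qed

text \<open>The derivative within \<open>{0..}\<close> is one-sided at 0. Uniqueness of derivatives
  is applied on the interval from \<open>t\<close> to \<open>t + 1\<close>, which covers this case
  as well.\<close>

lemma constant_deriv_zero:
  fixes f :: "real \<Rightarrow> real"
  assumes "\<And>t. 0 \<le> t \<Longrightarrow> f t = c" "0 \<le> t" "(f has_real_derivative d) (at t within {0..})"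
  shows "d = 0"
proof (rule vector_derivative_unique_within_closed_interval)
  show "t < t + 1" "t \<in> cbox t (t + 1)" by simp_all
  show "(f has_vector_derivative d) (at t within cbox t (t + 1))"
    by (rule has_vector_derivative_within_subset[OF assms(3)[unfolded has_real_derivative_iff_has_vector_derivative]])
      (use assms(2) in auto)
  show "(f has_vector_derivative 0) (at t within cbox t (t + 1))"
    by (rule has_vector_derivative_transform[OF _ _ has_vector_derivative_const[of c]]) (use assms(1,2) in auto)
qed

context passive_chp
begin

section \<open>Heat balance and total energy\<close>

lemma sum_pump_heat:
  "(\<Sum>k\<in>UNIV. pump_heat N md \<eta> \<omega> k) = (\<Sum>j\<in>pump_buses N. cop N j * pump_power N md \<eta> \<omega> j)"
  unfolding pump_heat_def by (rule sum.group) auto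

text \<open>The column sums of \<open>A_h N\<close> vanish: transport inside the heating network
  conserves heat, and only the external input changes the average.\<close>

lemma avg_temp_rate: "(\<Sum>i\<in>UNIV. volume N i) * average_temperature N (temp_rate N md z) = (\<Sum>k\<in>UNIV. heat_input N md z k)"
proof -
  have A: "(\<Sum>i\<in>UNIV. (A_h N *v T) $ i) = 0" for T
  proof -
    have "1 v* A_h N = 0" using N by (simp add: chp_network_def)
    then have "(1 :: real^('k + 'm)) \<bullet> (A_h N *v T) = 0"
      using dot_lmul_matrix[of 1 "A_h N" T] by simp
    then show ?thesis by (simp add: inner_vec_def)
  qed
  have e: "volume N i * temp_rate N md z $ i = - (A_h N *v temp z) $ i +
     (case i of Inl k \<Rightarrow> heat_input N md z k | Inr _ \<Rightarrow> 0)" for i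
    using volume_pos[of i] by (simp add: temp_rate_def)
  have "(\<Sum>i\<in>UNIV. volume N i * temp_rate N md z $ i) = (\<Sum>i\<in>UNIV. - (A_h N *v temp z) $ i)
      + (\<Sum>i\<in>UNIV. case i of Inl k \<Rightarrow> heat_input N md z k | Inr (_ :: 'm) \<Rightarrow> 0)"
    by (simp only: e sum.distrib)
  also have "(\<Sum>i\<in>UNIV. - (A_h N *v temp z) $ i) = 0" unfolding sum_negf A by simp
  also have "(\<Sum>i\<in>UNIV. case i of Inl k \<Rightarrow> heat_input N md z k | Inr (_ :: 'm) \<Rightarrow> 0) = (\<Sum>k\<in>UNIV. heat_input N md z k)"
    by (simp add: sum_UNIV_sum)
  finally have "(\<Sum>i\<in>UNIV. volume N i * temp_rate N md z $ i) = (\<Sum>k\<in>UNIV. heat_input N md z k)" by simp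
  then show ?thesis using total_volume_pos by (simp add: average_temperature_def)
qed

text \<open>Seen through its average temperature the heating network is a single reservoir. The
  sources are absorbed by passivity, and the exchange with the heat pumps is what remains.\<close>

lemma V_heat_deriv:
  assumes z: "trajectory F K I z" and t: "t \<in> I" and c: "c \<in> equilibria"
  obtains d where "((\<lambda>t. V_heat c (z t)) has_real_derivative d) (at t within I)"
    "d \<le> - damp_heat (z t) + (avg (z t) - avg c) * (\<Sum>j\<in>pump_buses N. cop N j *
      (pump_power N md (eta (z t)) (freq (z t)) j - pump_power N md (eta c) (freq c) j))"
proof -
  have zK: "z s \<in> K" if "s \<in> I" for s using trajectory_in[OF z that] .
  note cD = equilibriaD[OF c]
  note zd = vector_field_derivs[OF trajectory_deriv[OF z t]]
  define x where "x = z t"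
  have xK: "x \<in> K" using zK[OF t] by (simp add: x_def)
  define \<theta> where "\<theta> = avg x - avg c"
  define \<nu> where "\<nu> = (\<Sum>i\<in>UNIV. volume N i)"
  define d where "d = \<nu> * (\<theta> * average_temperature N (temp_rate N md x))
    + (\<Sum>k\<in>source_edges N. dVh k (src_state x $ k) \<bullet> (- f_h N k (src_state x $ k) (avg x)))"
  have "((\<lambda>t. V_heat c (z t)) has_real_derivative d) (at t within I)"
    unfolding V_heat_def d_def
  proof (intro DERIV_add DERIV_sum)
    show "((\<lambda>t. (\<Sum>i\<in>UNIV. volume N i) * (avg (z t) - avg c)\<^sup>2 / 2) has_real_derivative
        \<nu> * (\<theta> * average_temperature N (temp_rate N md x))) (at t within I)"
      using average_temperature_deriv[OF zd(3), of N]
      by (auto intro!: derivative_eq_intros simp: \<nu>_def \<theta>_def x_def)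
  next
    fix k assume k: "k \<in> source_edges N"
    show "((\<lambda>t. Vh k (src_state (z t) $ k)) has_real_derivative
        dVh k (src_state x $ k) \<bullet> (- f_h N k (src_state x $ k) (avg x))) (at t within I)"
      unfolding x_def
    proof (rule storage_deriv[OF _ zd(5)[OF k]])
      show "(Vh k has_derivative (\<lambda>h. dVh k (src_state (z t) $ k) \<bullet> h)) (at (src_state (z t) $ k) within S_h N k)"
        using passive_systemD(7)[OF ph[OF k]] near_src[OF zK[OF t] k] by blast
      show "src_state (z s) $ k \<in> S_h N k" if "s \<in> I" for s
        using near_src[OF zK[OF that] k] passive_systemD(1)[OF ph[OF k]] by blast
    qed
  qed
  moreover have "d \<le> - damp_heat x + \<theta> * (\<Sum>j\<in>pump_buses N. cop N j *
      (pump_power N md (eta x) (freq x) j - pump_power N md (eta c) (freq c) j))"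
  proof -
    define H where "H k = heat_generation N (temp x) (src_state x) k - heat_generation N (temp c) (src_state c) k" for k
    have "\<nu> * average_temperature N (temp_rate N md c) = 0"
      using field_zeroD(3)[OF cD(2)] by (simp add: average_temperature_def)
    then have "\<nu> * average_temperature N (temp_rate N md x)
        = (\<Sum>k\<in>UNIV. heat_input N md x k) - (\<Sum>k\<in>UNIV. heat_input N md c k)"
      unfolding \<nu>_def avg_temp_rate by simp
    also have "\<dots> = (\<Sum>k\<in>UNIV. H k) + (\<Sum>k\<in>UNIV. pump_heat N md (eta x) (freq x) k)
        - (\<Sum>k\<in>UNIV. pump_heat N md (eta c) (freq c) k)"
      by (simp add: heat_input_def H_def sum.distrib sum_subtractf)
    also have "(\<Sum>k\<in>UNIV. H k) = (\<Sum>k\<in>source_edges N. H k)"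
      by (rule sum.mono_neutral_right) (auto simp: H_def heat_generation_def)
    finally have 1: "\<nu> * average_temperature N (temp_rate N md x) = (\<Sum>k\<in>source_edges N. H k)
        + (\<Sum>j\<in>pump_buses N. cop N j * (pump_power N md (eta x) (freq x) j - pump_power N md (eta c) (freq c) j))"
      unfolding sum_pump_heat by (simp add: right_diff_distrib sum_subtractf)
    have pass: "dVh k (src_state x $ k) \<bullet> (- f_h N k (src_state x $ k) (avg x))
        \<le> - (\<theta> * H k) - \<phi>h k (- avg x + avg zs)" if k: "k \<in> source_edges N" for k
    proof -
      have ac: "avg c = avg zs" using cD(7) k by blast
      have "dVh k (src_state x $ k) \<bullet> (- f_h N k (src_state x $ k) (avg x)) \<le>
        (- avg x + avg zs) * (- g_h N k (src_state x $ k) (avg x)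
          - - g_h N k (src_state zs $ k) (avg zs)) - \<phi>h k (- avg x + avg zs)"
        using passive_systemD(8)[OF ph[OF k]] near_src[OF xK k] by blast
      also have "(- avg x + avg zs) * (- g_h N k (src_state x $ k) (avg x)
          - - g_h N k (src_state zs $ k) (avg zs)) = - (\<theta> * H k)"
        using k ac cD(5) by (simp add: \<theta>_def H_def heat_generation_def algebra_simps)
      finally show ?thesis .
    qed
    have 2: "(\<Sum>k\<in>source_edges N. dVh k (src_state x $ k) \<bullet> (- f_h N k (src_state x $ k) (avg x)))
        \<le> (\<Sum>k\<in>source_edges N. - (\<theta> * H k) - \<phi>h k (- avg x + avg zs))"
      by (rule sum_mono) (rule pass)
    have "\<nu> * (\<theta> * average_temperature N (temp_rate N md x)) = \<theta> * (\<Sum>k\<in>source_edges N. H k)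
        + \<theta> * (\<Sum>j\<in>pump_buses N. cop N j * (pump_power N md (eta x) (freq x) j - pump_power N md (eta c) (freq c) j))"
      unfolding mult.left_commute[of \<nu>] 1 by (simp add: distrib_left)
    then show ?thesis
      using 2 unfolding d_def damp_heat_def by (simp add: sum_subtractf sum_negf sum_distrib_left)
  qed
  ultimately show thesis by (intro that) (simp_all add: \<theta>_def x_def)
qed

text \<open>The weight converts electric power into heat: a temperature deviation
  \<open>\<theta>\<close> moves the pump bus frequency by \<open>m * \<theta>\<close>, and
  \<open>cop N j / m\<close> times \<open>m * \<theta> * p\<close> is \<open>\<theta>\<close> times
  the pump heat \<open>cop N j * p\<close>.\<close>

definition V :: "('n, 'k, 'm, 's, 'r) chp_state \<Rightarrow> ('n, 'k, 'm, 's, 'r) chp_state \<Rightarrow> real" where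
  "V c z = (case md of Mode1 a \<Rightarrow> V_elec c z | Mode2 j m \<Rightarrow> cop N j / m * V_elec c z + V_heat c z)"

definition damp :: "('n, 'k, 'm, 's, 'r) chp_state \<Rightarrow> real" where
  "damp z = (case md of Mode1 a \<Rightarrow> damp_elec z | Mode2 j m \<Rightarrow> cop N j / m * damp_elec z + damp_heat z)"

lemma V_mode: "md = Mode1 a \<Longrightarrow> V c z = V_elec c z"
  "md = Mode2 j m \<Longrightarrow> V c z = cop N j / m * V_elec c z + V_heat c z"
  unfolding V_def by simp_all

lemma damp_mode: "md = Mode1 a \<Longrightarrow> damp z = damp_elec z"
  "md = Mode2 j m \<Longrightarrow> damp z = cop N j / m * damp_elec z + damp_heat z"
  unfolding damp_def by simp_all

lemma mode2D:
  assumes "md = Mode2 j m"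
  shows "pump_buses N = {j}" "0 < m" "0 < cop N j" "j \<notin> gen_buses N"
  using assms md N by (auto simp: chp_network_def)

lemma slack_freq: "z \<in> M \<Longrightarrow> md = Mode2 j m \<Longrightarrow> freq z $ j = m * avg z"
  using mode2D[of j m] by (auto simp: constraint_set_def residual_def)

text \<open>In Mode 2 the power exchanged with the heat pump cancels because \<open>\<omega>\<^sub>j = m T\<close>.\<close>

lemma V_deriv:
  assumes z: "trajectory F K I z" and t: "t \<in> I" and c: "c \<in> equilibria"
  obtains d where "((\<lambda>t. V c (z t)) has_real_derivative d) (at t within I)" "d \<le> - damp (z t)"
proof -
  obtain d1 where d1: "((\<lambda>t. V_elec c (z t)) has_real_derivative d1) (at t within I)"
    "d1 \<le> - damp_elec (z t) - (\<Sum>j\<in>slack md. (freq (z t) $ j - freq c $ j) *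
      (net_inflow N (eta (z t)) j - net_inflow N (eta c) j))"
    using V_elec_deriv[OF z t c] by blast
  show thesis
  proof (cases md)
    case (Mode1 a)
    then have "slack md = {}" by simp
    then show ?thesis using that[of d1] d1 by (simp only: V_mode(1)[OF Mode1] damp_mode(1)[OF Mode1]) simp
  next
    case (Mode2 j m)
    note m2 = mode2D[OF Mode2]
    obtain d2 where d2: "((\<lambda>t. V_heat c (z t)) has_real_derivative d2) (at t within I)"
      "d2 \<le> - damp_heat (z t) + (avg (z t) - avg c) * (\<Sum>j\<in>pump_buses N. cop N j *
      (pump_power N md (eta (z t)) (freq (z t)) j - pump_power N md (eta c) (freq c) j))"
      using V_heat_deriv[OF z t c] by blast
    have pp: "pump_power N md \<eta> \<omega> j = net_inflow N \<eta> j" for \<eta> \<omega> by (simp add: Mode2)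
    define p where "p = net_inflow N (eta (z t)) j - net_inflow N (eta c) j"
    have "freq (z t) $ j = m * avg (z t)" "freq c $ j = m * avg c"
      using slack_freq[OF _ Mode2] trajectory_in[OF z t] equilibriaD(1)[OF c] by auto
    then have "d1 \<le> - damp_elec (z t) - m * (avg (z t) - avg c) * p"
      using d1(2) unfolding p_def by (simp only: slack.simps(2)[of j m, folded Mode2]) (simp add: algebra_simps)
    then have "cop N j / m * d1 \<le> cop N j / m * (- damp_elec (z t) - m * (avg (z t) - avg c) * p)"
      using m2 by (intro mult_left_mono) auto
    also have "\<dots> = - (cop N j / m * damp_elec (z t)) - (avg (z t) - avg c) * (cop N j * p)"
      using m2 by (simp add: field_simps)
    finally have "cop N j / m * d1 \<le> - (cop N j / m * damp_elec (z t)) - (avg (z t) - avg c) * (cop N j * p)" .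
    moreover have "d2 \<le> - damp_heat (z t) + (avg (z t) - avg c) * (cop N j * p)"
      using d2(2) by (simp add: m2(1) pp p_def)
    ultimately have "cop N j / m * d1 + d2 \<le> - damp (z t)"
      unfolding damp_mode(2)[OF Mode2] by linarith
    moreover have "((\<lambda>t. V c (z t)) has_real_derivative cop N j / m * d1 + d2) (at t within I)"
      unfolding V_mode(2)[OF Mode2] by (intro DERIV_add DERIV_cmult d1 d2)
    ultimately show ?thesis by (rule that[rotated])
  qed
qed

section \<open>Signs and zero sets of damping and energy\<close>

lemma phi_nonneg:
  "j \<in> gen_buses N \<Longrightarrow> 0 \<le> \<phi>e j s" "k \<in> source_edges N \<Longrightarrow> 0 \<le> \<phi>h k s"
  by (rule passive_systemD(3)[OF pe], assumption) (rule passive_systemD(3)[OF ph])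

lemma damping_term_nonneg: "j \<in> - slack md \<Longrightarrow> 0 \<le> eff_damping N md j * (freq z $ j - freq zs $ j)\<^sup>2"
  using eff_damping_pos[OF md, of j] by simp

lemma damp_elec_nonneg: "0 \<le> damp_elec z"
  unfolding damp_elec_def by (intro add_nonneg_nonneg sum_nonneg damping_term_nonneg phi_nonneg)

lemma damp_heat_nonneg: "0 \<le> damp_heat z"
  unfolding damp_heat_def by (intro sum_nonneg phi_nonneg)

lemma damp_nonneg: "0 \<le> damp z"
proof (cases md)
  case (Mode1 a)
  show ?thesis unfolding damp_mode(1)[OF Mode1] by (rule damp_elec_nonneg)
next
  case (Mode2 j m)
  show ?thesis unfolding damp_mode(2)[OF Mode2]
    using mode2D[OF Mode2] by (intro add_nonneg_nonneg mult_nonneg_nonneg damp_elec_nonneg damp_heat_nonneg) simp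
qed

lemma damp_elec_zeroD:
  assumes "damp_elec z = 0" "j \<notin> slack md"
  shows "freq z $ j = freq zs $ j"
proof -
  define S1 where "S1 = (\<Sum>j\<in>- slack md. eff_damping N md j * (freq z $ j - freq zs $ j)\<^sup>2)"
  have "0 \<le> (\<Sum>j\<in>gen_buses N. \<phi>e j (- freq z $ j + freq zs $ j))"
    by (intro sum_nonneg phi_nonneg)
  moreover have "0 \<le> S1" unfolding S1_def by (intro sum_nonneg damping_term_nonneg)
  ultimately have S1: "S1 = 0" using assms(1) unfolding damp_elec_def S1_def by linarith
  have "eff_damping N md j * (freq z $ j - freq zs $ j)\<^sup>2 = 0"
    by (rule sum_nonneg_0[OF _ damping_term_nonneg S1[unfolded S1_def]]) (use assms(2) in auto)
  then show ?thesis using eff_damping_pos[OF md assms(2)] by simp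
qed

lemma damp_heat_zeroD:
  assumes "damp_heat z = 0" "source_edges N \<noteq> {}"
  shows "avg z = avg zs"
proof -
  obtain k where k: "k \<in> source_edges N" using assms(2) by blast
  then have "\<phi>h k (- avg z + avg zs) = 0"
    using assms(1) sum_nonneg_eq_0_iff[of "source_edges N", OF _ phi_nonneg(2)] unfolding damp_heat_def
    by simp
  then have "- avg z + avg zs = 0" by (rule passive_systemD(4)[OF ph[OF k]])
  then show ?thesis by simp
qed

lemma damp_zeroD:
  assumes "damp z = 0"
  shows "j \<notin> slack md \<Longrightarrow> freq z $ j = freq zs $ j"
    and "md = Mode2 i m \<Longrightarrow> source_edges N \<noteq> {} \<Longrightarrow> avg z = avg zs"
proof -
  have "damp_elec z = 0 \<and> (md = Mode2 i m \<longrightarrow> damp_heat z = 0)" for i m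
  proof (cases md)
    case (Mode2 j m')
    have "cop N j / m' * damp_elec z + damp_heat z = 0" using assms damp_mode(2)[OF Mode2] by metis
    moreover have "0 < cop N j / m'" using mode2D[OF Mode2] by simp
    moreover have "0 \<le> cop N j / m' * damp_elec z" by (rule mult_nonneg_nonneg[OF less_imp_le[OF calculation(2)] damp_elec_nonneg])
    ultimately have "cop N j / m' * damp_elec z = 0" "damp_heat z = 0" using damp_heat_nonneg[of z] by linarith+
    then show ?thesis using \<open>0 < cop N j / m'\<close> by (metis less_irrefl mult_eq_0_iff)
  next
    case (Mode1 a)
    then show ?thesis using assms damp_mode(1)[OF Mode1] by (metis hp_mode.distinct(1))
  qed
  then show "j \<notin> slack md \<Longrightarrow> freq z $ j = freq zs $ j"
    and "md = Mode2 i m \<Longrightarrow> source_edges N \<noteq> {} \<Longrightarrow> avg z = avg zs"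
    using damp_elec_zeroD damp_heat_zeroD by blast+
qed

lemma V_elec_terms:
  assumes z: "z \<in> K" and c: "c \<in> equilibria"
  shows "0 \<le> inertia N j * (freq z $ j - freq c $ j)\<^sup>2 / 2"
    and "e \<in> lines N \<Longrightarrow> 0 \<le> susc N e * (cos (eta c $ e) - cos (eta z $ e) - sin (eta c $ e) * (eta z $ e - eta c $ e))"
    and "j \<in> gen_buses N \<Longrightarrow> 0 \<le> Ve j (gen_state z $ j)"
proof -
  show "0 \<le> inertia N j * (freq z $ j - freq c $ j)\<^sup>2 / 2" using inertia_nonneg by simp
  show "0 \<le> susc N e * (cos (eta c $ e) - cos (eta z $ e) - sin (eta c $ e) * (eta z $ e - eta c $ e))"
    if e: "e \<in> lines N"
  proof -
    have "0 < susc N e" using N e by (simp add: chp_network_def)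
    moreover have "0 \<le> cos (eta c $ e) - cos (eta z $ e) - sin (eta c $ e) * (eta z $ e - eta c $ e)"
      using angle_energy_pos[OF equilibriaD(3)[OF c e] near_eta[OF z e]]
      by (cases "eta c $ e = eta z $ e") auto
    ultimately show ?thesis by simp
  qed
  show "0 \<le> Ve j (gen_state z $ j)" if "j \<in> gen_buses N"
    using passive_systemD(5)[OF pe[OF that]] near_gen[OF z that] by blast
qed

lemma V_elec_nonneg: "z \<in> K \<Longrightarrow> c \<in> equilibria \<Longrightarrow> 0 \<le> V_elec c z"
  unfolding V_elec_def by (intro add_nonneg_nonneg sum_nonneg V_elec_terms)

lemma M_offD:
  assumes "z \<in> M"
  shows "e \<notin> lines N \<Longrightarrow> eta z $ e = 0" "j \<notin> gen_buses N \<Longrightarrow> gen_state z $ j = 0"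
    "k \<notin> source_edges N \<Longrightarrow> src_state z $ k = 0"
proof -
  have "(\<forall>e. e \<notin> lines N \<longrightarrow> eta z $ e = 0)" "gen_state z $ j \<in> (if j \<in> gen_buses N then S_e N j else {0})"
    "src_state z $ k \<in> (if k \<in> source_edges N then S_h N k else {0})" for j k
    using M_state_space[OF assms] unfolding state_space_def by blast+
  note * = this
  show "e \<notin> lines N \<Longrightarrow> eta z $ e = 0" using *(1) by blast
  show "j \<notin> gen_buses N \<Longrightarrow> gen_state z $ j = 0" using *(2)[of j] by simp
  show "k \<notin> source_edges N \<Longrightarrow> src_state z $ k = 0" using *(3)[of k] by simp
qed

lemma load_freq_eqI:
  assumes "z \<in> M" "c \<in> M" "eta z = eta c" "j \<notin> slack md" "j \<notin> gen_buses N"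
  shows "freq z $ j = freq c $ j"
proof -
  have "residual N md z j = 0" "residual N md c j = 0" using assms by (simp_all add: constraint_set_def)
  then have "eff_damping N md j * freq z $ j + elec_load N j - net_inflow N (eta c) j = 0"
    "eff_damping N md j * freq c $ j + elec_load N j - net_inflow N (eta c) j = 0"
    unfolding residual_def assms(3) using assms(4) by simp_all
  then have "eff_damping N md j * freq z $ j = eff_damping N md j * freq c $ j" by linarith
  then show ?thesis using eff_damping_pos[OF md assms(4)] by simp
qed

text \<open>Buses without inertia do not occur in the kinetic energy, but off the slack bus their
  frequencies are functions of the angles by the constraint.\<close>

lemma V_elec_zeroD:
  assumes z: "z \<in> K" and c: "c \<in> equilibria" and V0: "V_elec c z = 0"
  shows "eta z = eta c" "gen_state z = gen_state c" "j \<notin> slack md \<Longrightarrow> freq z $ j = freq c $ j"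
proof -
  note terms = V_elec_terms[OF z c]
  have s: "0 \<le> (\<Sum>j\<in>UNIV. inertia N j * (freq z $ j - freq c $ j)\<^sup>2 / 2)"
    "0 \<le> (\<Sum>e\<in>lines N. susc N e * (cos (eta c $ e) - cos (eta z $ e) - sin (eta c $ e) * (eta z $ e - eta c $ e)))"
    "0 \<le> (\<Sum>j\<in>gen_buses N. Ve j (gen_state z $ j))"
    by (intro sum_nonneg terms; assumption)+
  have s1: "(\<Sum>j\<in>UNIV. inertia N j * (freq z $ j - freq c $ j)\<^sup>2 / 2) = 0"
    and s2: "(\<Sum>e\<in>lines N. susc N e * (cos (eta c $ e) - cos (eta z $ e) - sin (eta c $ e) * (eta z $ e - eta c $ e))) = 0"
    and s3: "(\<Sum>j\<in>gen_buses N. Ve j (gen_state z $ j)) = 0"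
    using s V0 unfolding V_elec_def by linarith+
  have t1: "inertia N j * (freq z $ j - freq c $ j)\<^sup>2 / 2 = 0" for j
    using sum_nonneg_eq_0_iff[THEN iffD1, OF _ _ s1] terms(1) by simp
  have t2: "susc N e * (cos (eta c $ e) - cos (eta z $ e) - sin (eta c $ e) * (eta z $ e - eta c $ e)) = 0"
    if "e \<in> lines N" for e
    using sum_nonneg_eq_0_iff[THEN iffD1, OF _ _ s2] terms(2) that by simp
  have t3: "Ve j (gen_state z $ j) = 0" if "j \<in> gen_buses N" for j
    using sum_nonneg_eq_0_iff[THEN iffD1, OF _ _ s3] terms(3) that by simp
  have "eta z $ e = eta c $ e" for e
  proof (cases "e \<in> lines N")
    case True
    have "0 < susc N e" using N True by (simp add: chp_network_def)
    then show ?thesis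
      using t2[OF True] angle_energy_pos[OF equilibriaD(3)[OF c True] near_eta[OF z True]] by fastforce
  next
    case False
    then show ?thesis using M_offD(1)[OF K_M[OF z]] M_offD(1)[OF equilibriaD(1)[OF c]] by simp
  qed
  then show eta: "eta z = eta c" by (simp add: vec_eq_iff)
  have "gen_state z $ j = gen_state c $ j" for j
  proof (cases "j \<in> gen_buses N")
    case True
    then show ?thesis using passive_systemD(6)[OF pe[OF True] _ t3[OF True]] near_gen[OF z True] equilibriaD(4)[OF c]
      by simp
  next
    case False
    then show ?thesis using M_offD(2)[OF K_M[OF z]] M_offD(2)[OF equilibriaD(1)[OF c]] by simp
  qed
  then show "gen_state z = gen_state c" by (simp add: vec_eq_iff)
  show "freq z $ j = freq c $ j" if j: "j \<notin> slack md"
  proof (cases "j \<in> gen_buses N")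
    case True
    then have "0 < inertia N j" using N by (simp add: chp_network_def)
    then show ?thesis using t1[of j] by simp
  next
    case False
    then show ?thesis by (rule load_freq_eqI[OF K_M[OF z] equilibriaD(1)[OF c] eta j])
  qed
qed

lemma V_heat_nonneg: "z \<in> K \<Longrightarrow> 0 \<le> V_heat c z"
proof -
  assume z: "z \<in> K"
  have "0 \<le> Vh k (src_state z $ k)" if "k \<in> source_edges N" for k
    using passive_systemD(5)[OF ph[OF that]] near_src[OF z that] by blast
  then show ?thesis unfolding V_heat_def using total_volume_pos
    by (intro add_nonneg_nonneg sum_nonneg) (auto simp: less_imp_le)
qed

lemma V_heat_zeroD:
  assumes z: "z \<in> K" and c: "c \<in> equilibria" and V0: "V_heat c z = 0"
  shows "avg z = avg c" "src_state z = src_state c"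
proof -
  have nn: "0 \<le> Vh k (src_state z $ k)" if "k \<in> source_edges N" for k
    using passive_systemD(5)[OF ph[OF that]] near_src[OF z that] by blast
  have a: "0 \<le> (\<Sum>i\<in>UNIV. volume N i) * (avg z - avg c)\<^sup>2 / 2" using total_volume_pos by simp
  have b: "0 \<le> (\<Sum>k\<in>source_edges N. Vh k (src_state z $ k))" by (intro sum_nonneg nn)
  have "(\<Sum>i\<in>UNIV. volume N i) * (avg z - avg c)\<^sup>2 / 2 = 0"
    and s: "(\<Sum>k\<in>source_edges N. Vh k (src_state z $ k)) = 0"
    using a b V0 unfolding V_heat_def by linarith+
  then show "avg z = avg c" using total_volume_pos by simp
  have "src_state z $ k = src_state c $ k" for k
  proof (cases "k \<in> source_edges N")
    case True
    have "Vh k (src_state z $ k) = 0"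
      using sum_nonneg_eq_0_iff[THEN iffD1, OF _ _ s] nn True by simp
    then show ?thesis using passive_systemD(6)[OF ph[OF True]] near_src[OF z True] equilibriaD(5)[OF c]
      by simp
  next
    case False
    then show ?thesis using M_offD(3)[OF K_M[OF z]] M_offD(3)[OF equilibriaD(1)[OF c]] by simp
  qed
  then show "src_state z = src_state c" by (simp add: vec_eq_iff)
qed

lemma V_nonneg: "z \<in> K \<Longrightarrow> c \<in> equilibria \<Longrightarrow> 0 \<le> V c z"
proof (cases md)
  case (Mode1 a)
  show "z \<in> K \<Longrightarrow> c \<in> equilibria \<Longrightarrow> 0 \<le> V c z" unfolding V_mode(1)[OF Mode1] by (rule V_elec_nonneg)
next
  case (Mode2 j m)
  show "z \<in> K \<Longrightarrow> c \<in> equilibria \<Longrightarrow> 0 \<le> V c z" unfolding V_mode(2)[OF Mode2]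
    using mode2D[OF Mode2] by (intro add_nonneg_nonneg mult_nonneg_nonneg V_elec_nonneg V_heat_nonneg) simp_all
qed

lemma V_center:
  assumes "c \<in> equilibria"
  shows "V c c = 0"
proof -
  have "Ve j (gen_state c $ j) = 0" if "j \<in> gen_buses N" for j
    using passive_systemD(2)[OF pe[OF that]] equilibriaD(4)[OF assms] by simp
  then have "V_elec c c = 0" by (simp add: V_elec_def)
  moreover have "Vh k (src_state c $ k) = 0" if "k \<in> source_edges N" for k
    using passive_systemD(2)[OF ph[OF that]] equilibriaD(5)[OF assms] by simp
  then have "V_heat c c = 0" by (simp add: V_heat_def)
  ultimately show ?thesis unfolding V_def by (simp split: hp_mode.split)
qed

text \<open>The slack frequency is recovered from the average temperature in \<open>V_heat\<close>.
  Temperature differences and, in Mode 1, the average temperature and source states are invisible to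
  \<open>V\<close>; the dynamics have to settle them.\<close>

lemma V_zeroD:
  assumes z: "z \<in> K" and c: "c \<in> equilibria" and V0: "V c z = 0"
  shows "eta z = eta c" "gen_state z = gen_state c" "freq z = freq c" "md = Mode2 i m \<Longrightarrow> V_heat c z = 0"
proof -
  have *: "V_elec c z = 0 \<and> (\<forall>i m. md = Mode2 i m \<longrightarrow> V_heat c z = 0)"
  proof (cases md)
    case (Mode2 j m')
    have "cop N j / m' * V_elec c z + V_heat c z = 0" using V0 V_mode(2)[OF Mode2] by metis
    moreover have pos: "0 < cop N j / m'" using mode2D[OF Mode2] by simp
    moreover have "0 \<le> cop N j / m' * V_elec c z" by (rule mult_nonneg_nonneg[OF less_imp_le[OF pos] V_elec_nonneg[OF z c]])
    ultimately have "cop N j / m' * V_elec c z = 0" "V_heat c z = 0" using V_heat_nonneg[OF z, of c] by linarith+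
    then show ?thesis using pos by (metis less_irrefl mult_eq_0_iff)
  next
    case (Mode1 a)
    then show ?thesis using V0 V_mode(1)[OF Mode1] by (metis hp_mode.distinct(1))
  qed
  then have e0: "V_elec c z = 0" by blast
  show "md = Mode2 i m \<Longrightarrow> V_heat c z = 0" using * by blast
  show "eta z = eta c" "gen_state z = gen_state c" by (rule V_elec_zeroD[OF z c e0])+
  have "freq z $ j = freq c $ j" for j
  proof (cases "j \<in> slack md")
    case True
    then obtain m where m: "md = Mode2 j m" by (cases md) auto
    then have "avg z = avg c" using V_heat_zeroD(1)[OF z c] * by blast
    then show ?thesis using slack_freq[OF K_M[OF z] m] slack_freq[OF equilibriaD(1)[OF c] m] by simp
  next
    case False
    then show ?thesis by (rule V_elec_zeroD(3)[OF z c e0])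
  qed
  then show "freq z = freq c" by (simp add: vec_eq_iff)
qed

lemma V_continuous:
  shows "continuous_on K (V_heat c)" "continuous_on K (V c)"
proof -
  have e: "continuous_on K (\<lambda>z. Ve j (gen_state z $ j))" if j: "j \<in> gen_buses N" for j
  proof (rule continuous_on_compose2[where f = "\<lambda>z. gen_state z $ j"])
    show "continuous_on (Xe j) (Ve j)"
      unfolding continuous_on_eq_continuous_within
    proof
      fix x assume x: "x \<in> Xe j"
      show "continuous (at x within Xe j) (Ve j)"
        using has_derivative_continuous[OF passive_systemD(7)[OF pe[OF j] x]] passive_systemD(1)[OF pe[OF j]]
        by (rule continuous_within_subset)
    qed
    show "(\<lambda>z. gen_state z $ j) ` K \<subseteq> Xe j" using near_gen[OF _ j] by blast
  qed (intro continuous_intros)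
  have h: "continuous_on K (\<lambda>z. Vh k (src_state z $ k))" if k: "k \<in> source_edges N" for k
  proof (rule continuous_on_compose2[where f = "\<lambda>z. src_state z $ k"])
    show "continuous_on (Xh k) (Vh k)"
      unfolding continuous_on_eq_continuous_within
    proof
      fix x assume x: "x \<in> Xh k"
      show "continuous (at x within Xh k) (Vh k)"
        using has_derivative_continuous[OF passive_systemD(7)[OF ph[OF k] x]] passive_systemD(1)[OF ph[OF k]]
        by (rule continuous_within_subset)
    qed
    show "(\<lambda>z. src_state z $ k) ` K \<subseteq> Xh k" using near_src[OF _ k] by blast
  qed (intro continuous_intros)
  have E: "continuous_on K (V_elec c)"
    unfolding V_elec_def divide_inverse by (intro continuous_intros e) auto
  show H: "continuous_on K (V_heat c)"
    unfolding V_heat_def divide_inverse by (intro continuous_intros h) auto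
  show "continuous_on K (V c)"
  proof (cases md)
    case (Mode1 a)
    have "V c = V_elec c" using V_mode(1)[OF Mode1] by (intro ext)
    then show ?thesis using E by simp
  next
    case (Mode2 j m)
    have "V c = (\<lambda>z. cop N j / m * V_elec c z + V_heat c z)" using V_mode(2)[OF Mode2] by (intro ext)
    then show ?thesis using E H by (simp only:) (intro continuous_intros)
  qed
qed

end

section \<open>Limit sets of network trajectories\<close>

text \<open>If \<open>A *v x\<close> were nonzero, a small step from \<open>x\<close> against it
  would make the quadratic form negative, because the linear term dominates.\<close>

lemma psd_kernel:
  fixes A :: "real^'a::finite^'a"
  assumes A: "positive_semidefinite A" and x: "x \<bullet> (A *v x) = 0"
  shows "A *v x = 0"
proof (rule ccontr)
  assume nz: "A *v x \<noteq> 0"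
  define y where "y = A *v x"
  define b where "b = y \<bullet> (A *v y)"
  define a where "a = y \<bullet> y"
  have a: "0 < a" using nz by (simp add: a_def y_def)
  have b: "0 \<le> b" using A by (simp add: positive_semidefinite_def b_def)
  have sym: "x \<bullet> (A *v y) = y \<bullet> (A *v x)"
  proof -
    have "x \<bullet> (A *v y) = (x v* A) \<bullet> y" by (simp add: dot_lmul_matrix)
    also have "x v* A = transpose A *v x" by (simp add: transpose_matrix_vector)
    also have "transpose A = A" using A by (simp add: positive_semidefinite_def)
    finally show ?thesis by (simp add: inner_commute)
  qed
  \<comment> \<open>Any negative \<open>t\<close> with \<open>2 * a + t * b > 0\<close> would do;
    \<open>b + 1\<close> covers the case \<open>b = 0\<close>.\<close>
  define t where "t = - a / (b + 1)"
  have "0 \<le> (x + t *\<^sub>R y) \<bullet> (A *v (x + t *\<^sub>R y))" using A by (simp add: positive_semidefinite_def)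
  also have "\<dots> = x \<bullet> (A *v x) + t * (x \<bullet> (A *v y)) + t * (y \<bullet> (A *v x)) + t\<^sup>2 * b"
    by (simp add: matrix_vector_right_distrib matrix_vector_mult_scaleR inner_add_left inner_add_right
        b_def power2_eq_square algebra_simps)
  also have "\<dots> = 2 * t * a + t\<^sup>2 * b" using x sym by (simp add: a_def y_def)
  also have "\<dots> = t * (2 * a + t * b)" by (simp add: power2_eq_square algebra_simps)
  finally have 1: "0 \<le> t * (2 * a + t * b)" .
  have "t < 0" using a b by (simp add: t_def)
  moreover have "- a \<le> t * b" using a b by (simp add: t_def field_simps)
  then have "0 < 2 * a + t * b" using a by linarith
  ultimately have "t * (2 * a + t * b) < 0" by (simp add: mult_neg_pos)
  with 1 show False by simp
qed

lemma compact_slice: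
  fixes g :: "'z::t2_space \<Rightarrow> 'x::t2_space"
  assumes "compact C" "continuous_on C g"
  shows "compact {z \<in> C. g z = a}"
proof -
  have "closed {z \<in> C. g z = a}"
    using continuous_closed_preimage[OF assms(2) compact_imp_closed[OF assms(1)], of "{a}"]
    by (simp add: vimage_def Int_def)
  then have "compact (C \<inter> {z \<in> C. g z = a})" by (rule compact_Int_closed[OF assms(1)])
  then show ?thesis by (simp add: Int_absorb1 subset_eq)
qed

lemma tendsto_at_top_constant:
  fixes f :: "real \<Rightarrow> 'b::topological_space"
  assumes "\<And>t. 0 \<le> t \<Longrightarrow> f t = c"
  shows "(f \<longlongrightarrow> c) at_top"
proof (rule tendsto_eventually)
  show "eventually (\<lambda>t. f t = c) at_top"
    by (rule eventually_at_top_linorderI[of 0]) (rule assms)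
qed

context passive_chp
begin

section \<open>Temperature differences within the heating network\<close>

lemma A_h_quadratic:
  shows "0 \<le> x \<bullet> (A_h N *v x)" and "x \<bullet> (A_h N *v x) = 0 \<Longrightarrow> \<exists>s. x = s *\<^sub>R 1"
proof -
  define S where "S = A_h N + transpose (A_h N)"
  have psd: "positive_semidefinite S" and simple: "simple_eigenvalue S 0"
    and A1: "A_h N *v 1 = 0" "1 v* A_h N = 0"
    using N by (simp_all add: chp_network_def S_def)
  have "x \<bullet> (transpose (A_h N) *v x) = x \<bullet> (A_h N *v x)"
    by (metis dot_lmul_matrix inner_commute transpose_matrix_vector)
  \<comment> \<open>Only the symmetric part enters the quadratic form, and its kernel is spanned by
    the vector of ones because 0 is a simple eigenvalue.\<close>
  then have S: "x \<bullet> (S *v x) = 2 * (x \<bullet> (A_h N *v x))"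
    by (simp add: S_def matrix_vector_mult_add_rdistrib inner_add_right)
  then show "0 \<le> x \<bullet> (A_h N *v x)" using psd unfolding positive_semidefinite_def by (metis mult_le_cancel_left_pos mult_zero_right zero_less_numeral)
  assume "x \<bullet> (A_h N *v x) = 0"
  then have "S *v x = 0" using S psd_kernel[OF psd] by simp
  moreover have "S *v 1 = 0" using A1 by (simp add: S_def matrix_vector_mult_add_rdistrib transpose_matrix_vector)
  moreover have "(1 :: real^('k + 'm)) \<noteq> 0" by simp
  ultimately show "\<exists>s. x = s *\<^sub>R 1" using kernel_of_simple_zero_eigenvalue[OF simple] by metis
qed

lemma average_temperature_shift:
  "average_temperature N (T + s *\<^sub>R 1) = average_temperature N T + s"
proof -
  have "(\<Sum>i\<in>UNIV. volume N i * (T + s *\<^sub>R 1) $ i) = (\<Sum>i\<in>UNIV. volume N i * T $ i) + s * (\<Sum>i\<in>UNIV. volume N i)"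
    by (simp add: algebra_simps sum.distrib sum_distrib_left)
  then show ?thesis using total_volume_pos by (simp add: average_temperature_def add_divide_distrib)
qed

lemma average_temperature_diff:
  "average_temperature N (T - T') = average_temperature N T - average_temperature N T'"
  by (simp add: average_temperature_def diff_divide_distrib sum_subtractf algebra_simps)

text \<open>Only the distribution of a given average temperature is still free here, so that the
  heating network is a linear system with constant input.\<close>

definition core :: "('n, 'k, 'm, 's, 'r) chp_state \<Rightarrow> ('n, 'k, 'm, 's, 'r) chp_state set" where
  "core c = {z \<in> K. eta z = eta c \<and> freq z = freq c \<and> gen_state z = gen_state c \<and>
     src_state z = src_state c \<and> avg z = avg c}"

text \<open>The energy of the whole temperature profile, used inside \<open>core c\<close> only:
  elsewhere the heat input may differ from that at \<open>c\<close>.\<close>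

definition V_temp :: "('n, 'k, 'm, 's, 'r) chp_state \<Rightarrow> ('n, 'k, 'm, 's, 'r) chp_state \<Rightarrow> real" where
  "V_temp c z = (\<Sum>i\<in>UNIV. volume N i * (temp z $ i - temp c $ i)\<^sup>2 / 2)"

lemma compact_K: "compact K"
  using closed_constraint_set by (intro compact_Int_closed) auto

lemma F_continuous: "continuous_on K F"
  by (rule continuous_on_subset[OF vector_field_continuous]) (auto dest: M_state_space)

lemma compact_core: "compact (core c)"
proof -
  have eq: "core c = {z \<in> K. (eta z, freq z, gen_state z, src_state z, avg z) =
      (eta c, freq c, gen_state c, src_state c, avg c)}"
    by (auto simp: core_def)
  have "continuous_on K (\<lambda>z. (eta z, freq z, gen_state z, src_state z, avg z))"
    by (intro continuous_intros)
  then show ?thesis unfolding eq by (rule compact_slice[OF compact_K])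
qed

lemma core_subset: "core c \<subseteq> K" by (auto simp: core_def)

lemma coreD: "z \<in> core c \<Longrightarrow> eta z = eta c \<and> freq z = freq c \<and> gen_state z = gen_state c \<and>
     src_state z = src_state c \<and> avg z = avg c"
  by (simp add: core_def)

lemma V_temp_continuous: "continuous_on C (V_temp c)"
  unfolding V_temp_def divide_inverse by (intro continuous_intros)

lemma V_temp_nonneg: "0 \<le> V_temp c z"
  unfolding V_temp_def using volume_pos by (intro sum_nonneg) (simp add: less_imp_le)

lemma V_temp_zeroD:
  assumes "V_temp c z \<le> 0"
  shows "temp z = temp c"
proof -
  have nn: "0 \<le> volume N i * (temp z $ i - temp c $ i)\<^sup>2 / 2" for i
    using volume_pos[of i] by simp
  have 0: "(\<Sum>i\<in>UNIV. volume N i * (temp z $ i - temp c $ i)\<^sup>2 / 2) = 0"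
    using assms V_temp_nonneg[of c z] unfolding V_temp_def by simp
  have "volume N i * (temp z $ i - temp c $ i)\<^sup>2 / 2 = 0" for i
    by (rule sum_nonneg_0[OF _ nn 0]) auto
  then have "temp z $ i = temp c $ i" for i using volume_pos[of i] by (metis divide_eq_0_iff
    less_irrefl mult_eq_0_iff power_eq_0_iff right_minus_eq zero_neq_numeral)
  then show ?thesis by (simp add: vec_eq_iff)
qed

text \<open>The heat input equals that of the equilibrium \<open>c\<close> and cancels in the
  equation for the temperature difference, leaving the homogeneous system governed by
  \<open>- A_h N\<close>.\<close>

lemma V_temp_deriv:
  assumes y: "trajectory F (core c) I y" and t: "t \<in> I" and c: "c \<in> equilibria"
  shows "((\<lambda>t. V_temp c (y t)) has_real_derivative
    - ((temp (y t) - temp c) \<bullet> (A_h N *v (temp (y t) - temp c)))) (at t within I)"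
proof -
  define x where "x = temp (y t) - temp c"
  note core = coreD[OF trajectory_in[OF y t]]
  have gen: "heat_generation N (temp (y t)) (src_state (y t)) k = heat_generation N (temp c) (src_state c) k" for k
    using core by (simp add: heat_generation_def)
  then have "heat_input N md (y t) k = heat_input N md c k" for k
    using core by (simp add: heat_input_def)
  then have h: "(case i of Inl k \<Rightarrow> heat_input N md (y t) k | Inr _ \<Rightarrow> 0) =
      (case i of Inl k \<Rightarrow> heat_input N md c k | Inr _ \<Rightarrow> 0)" for i :: "'k + 'm"
    by (cases i) auto
  have c0: "(case i of Inl k \<Rightarrow> heat_input N md c k | Inr _ \<Rightarrow> 0) = (A_h N *v temp c) $ i" for i
  proof -
    have "temp_rate N md c $ i = 0" using field_zeroD(3)[OF equilibriaD(2)[OF c]] by simp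
    then show ?thesis using volume_pos[of i] by (simp add: temp_rate_def)
  qed
  have rate: "volume N i * temp_rate N md (y t) $ i = - (A_h N *v x) $ i" for i
    using volume_pos[of i] unfolding temp_rate_def h c0 x_def
    by (simp add: matrix_vector_mult_diff_distrib)
  have "((\<lambda>t. V_temp c (y t)) has_real_derivative (\<Sum>i\<in>UNIV. x $ i * (- (A_h N *v x) $ i))) (at t within I)"
    unfolding V_temp_def
  proof (rule DERIV_sum)
    fix i
    have "((\<lambda>t. temp (y t) $ i) has_real_derivative temp_rate N md (y t) $ i) (at t within I)"
      using has_vector_derivative_nth[OF vector_field_derivs(3)[OF trajectory_deriv[OF y t]]]
      by (simp add: has_real_derivative_iff_has_vector_derivative)
    then have "((\<lambda>t. volume N i * (temp (y t) $ i - temp c $ i)\<^sup>2 / 2) has_real_derivative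
        x $ i * (volume N i * temp_rate N md (y t) $ i)) (at t within I)"
      by (auto intro!: derivative_eq_intros simp: x_def)
    then show "((\<lambda>t. volume N i * (temp (y t) $ i - temp c $ i)\<^sup>2 / 2) has_real_derivative
        x $ i * (- (A_h N *v x) $ i)) (at t within I)"
      unfolding rate .
  qed
  moreover have "(\<Sum>i\<in>UNIV. x $ i * (- (A_h N *v x) $ i)) = - (x \<bullet> (A_h N *v x))"
    by (simp add: inner_vec_def sum_negf)
  ultimately show ?thesis by (simp add: x_def)
qed

lemma V_temp_decreasing:
  assumes "trajectory F (core c) {0..b} y" "0 \<le> b" "c \<in> equilibria"
  shows "V_temp c (y b) \<le> V_temp c (y 0)"
proof (rule trajectory_nonincreasing[OF assms(1,2)])
  fix t assume t: "t \<in> {0..b}"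
  show "\<exists>d\<le>0. ((\<lambda>t. V_temp c (y t)) has_real_derivative d) (at t within {0..b})"
    using V_temp_deriv[OF assms(1) t assms(3)] A_h_quadratic(1) neg_le_0_iff_le by blast
qed

text \<open>A vanishing derivative makes the temperature difference uniform, and equal averages make
  it zero.\<close>

lemma V_temp_constant:
  assumes y: "trajectory F (core c) {0..} y" and c: "c \<in> equilibria"
    and const: "\<And>t. 0 \<le> t \<Longrightarrow> V_temp c (y t) = V_temp c (y 0)"
  shows "V_temp c (y 0) \<le> 0"
proof -
  define x where "x = temp (y 0) - temp c"
  have t: "(0::real) \<in> {0..}" by simp
  have "- (x \<bullet> (A_h N *v x)) = 0"
    unfolding x_def by (rule constant_deriv_zero[OF const order_refl V_temp_deriv[OF y t c]])
  then obtain s where s: "x = s *\<^sub>R 1" using A_h_quadratic(2) by auto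
  have "average_temperature N x = 0"
    using coreD[OF trajectory_in[OF y t]] by (simp add: x_def average_temperature_diff)
  moreover have "average_temperature N x = s"
    using average_temperature_shift[of 0 s] unfolding s by (simp add: average_temperature_def)
  ultimately have "temp (y 0) = temp c" using s by (simp add: x_def)
  then show ?thesis by (simp add: V_temp_def)
qed

lemma core_eqI:
  assumes "z \<in> core c" "V_temp c z \<le> 0"
  shows "z = c"
  using coreD[OF assms(1)] V_temp_zeroD[OF assms(2)] by (simp add: prod_eq_iff)

section \<open>Energies and generation states along trajectories\<close>

lemma V_decreasing:
  assumes "c \<in> equilibria" "0 \<le> b" "trajectory F K {0..b} x"
  shows "V c (x b) \<le> V c (x 0)"
proof (rule trajectory_nonincreasing[OF assms(3,2)])
  fix t assume t: "t \<in> {0..b}"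
  obtain d where "((\<lambda>t. V c (x t)) has_real_derivative d) (at t within {0..b})" "d \<le> - damp (x t)"
    using V_deriv[OF assms(3) t assms(1)] by blast
  then show "\<exists>d\<le>0. ((\<lambda>t. V c (x t)) has_real_derivative d) (at t within {0..b})"
    using damp_nonneg[of "x t"] by (intro exI[of _ d]) linarith
qed

text \<open>With the pumps at their equilibrium power the exchange term disappears and the heating
  network dissipates by itself. Mode 1 relies on this once the electric side has settled.\<close>

lemma V_heat_deriv_isolated:
  assumes z: "trajectory F K I z" and t: "t \<in> I" and c: "c \<in> equilibria"
    and eq: "\<And>j. j \<in> pump_buses N \<Longrightarrow>
      pump_power N md (eta (z t)) (freq (z t)) j = pump_power N md (eta c) (freq c) j"
  obtains d where "((\<lambda>t. V_heat c (z t)) has_real_derivative d) (at t within I)" "d \<le> - damp_heat (z t)"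
proof -
  obtain d where d: "((\<lambda>t. V_heat c (z t)) has_real_derivative d) (at t within I)"
    "d \<le> - damp_heat (z t) + (avg (z t) - avg c) * (\<Sum>j\<in>pump_buses N. cop N j *
      (pump_power N md (eta (z t)) (freq (z t)) j - pump_power N md (eta c) (freq c) j))"
    by (rule V_heat_deriv[OF z t c])
  have "(\<Sum>j\<in>pump_buses N. cop N j *
      (pump_power N md (eta (z t)) (freq (z t)) j - pump_power N md (eta c) (freq c) j)) = 0"
    using eq by (intro sum.neutral) simp
  with d show thesis by (intro that) auto
qed

lemma V_heat_decreasing:
  assumes z: "trajectory F K {0..b} z" "0 \<le> b" and c: "c \<in> equilibria"
    and eq: "\<And>t j. t \<in> {0..b} \<Longrightarrow> j \<in> pump_buses N \<Longrightarrow>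
      pump_power N md (eta (z t)) (freq (z t)) j = pump_power N md (eta c) (freq c) j"
  shows "V_heat c (z b) \<le> V_heat c (z 0)"
proof (rule trajectory_nonincreasing[OF z])
  fix t assume t: "t \<in> {0..b}"
  obtain d where "((\<lambda>t. V_heat c (z t)) has_real_derivative d) (at t within {0..b})" "d \<le> - damp_heat (z t)"
    using V_heat_deriv_isolated[OF z(1) t c eq[OF t]] by blast
  then show "\<exists>d\<le>0. ((\<lambda>t. V_heat c (z t)) has_real_derivative d) (at t within {0..b})"
    using damp_heat_nonneg[of "z t"] by (intro exI[of _ d]) linarith
qed

lemma V_heat_constant:
  assumes z: "trajectory F K {0..} z" and c: "c \<in> equilibria"
    and eq: "\<And>t j. 0 \<le> t \<Longrightarrow> j \<in> pump_buses N \<Longrightarrow>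
      pump_power N md (eta (z t)) (freq (z t)) j = pump_power N md (eta c) (freq c) j"
    and const: "\<And>t. 0 \<le> t \<Longrightarrow> V_heat c (z t) = V_heat c (z 0)" and t: "0 \<le> t"
    and src: "source_edges N \<noteq> {}"
  shows "avg (z t) = avg zs"
proof -
  have t': "t \<in> {0..}" using t by simp
  obtain d where d: "((\<lambda>t. V_heat c (z t)) has_real_derivative d) (at t within {0..})" "d \<le> - damp_heat (z t)"
    using V_heat_deriv_isolated[OF z t' c eq[OF t]] by blast
  have "d = 0" by (rule constant_deriv_zero[OF const t d(1)])
  then have "damp_heat (z t) = 0" using d(2) damp_heat_nonneg[of "z t"] by simp
  then show ?thesis using src by (rule damp_heat_zeroD)
qed

lemma gen_state_converges:
  assumes y: "trajectory F K {0..} y" and j: "j \<in> gen_buses N"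
    and f: "\<And>t. 0 \<le> t \<Longrightarrow> freq (y t) $ j = freq zs $ j"
  shows "((\<lambda>t. gen_state (y t) $ j) \<longlongrightarrow> gen_state zs $ j) at_top"
proof (rule passive_system_converges[OF pe[OF j]])
  fix t :: real assume "0 \<le> t"
  then have t: "t \<in> {0..}" by simp
  show "gen_state (y t) $ j \<in> Xe j" using near_gen[OF trajectory_in[OF y t] j] by blast
  show "((\<lambda>t. gen_state (y t) $ j) has_vector_derivative - f_e N j (gen_state (y t) $ j) (freq zs $ j)) (at t within {0..})"
    using vector_field_derivs(4)[OF trajectory_deriv[OF y t] j] f[of t] t by simp
qed

lemma src_state_converges:
  assumes y: "trajectory F K {0..} y" and k: "k \<in> source_edges N"
    and f: "\<And>t. 0 \<le> t \<Longrightarrow> avg (y t) = avg zs"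
  shows "((\<lambda>t. src_state (y t) $ k) \<longlongrightarrow> src_state zs $ k) at_top"
proof (rule passive_system_converges[OF ph[OF k]])
  fix t :: real assume "0 \<le> t"
  then have t: "t \<in> {0..}" by simp
  show "src_state (y t) $ k \<in> Xh k" using near_src[OF trajectory_in[OF y t] k] by blast
  show "((\<lambda>t. src_state (y t) $ k) has_vector_derivative - f_h N k (src_state (y t) $ k) (avg zs)) (at t within {0..})"
    using vector_field_derivs(5)[OF trajectory_deriv[OF y t] k] f[of t] t by simp
qed

lemma src_state_limit:
  assumes y: "trajectory F K {0..} y" and f: "\<And>t. source_edges N \<noteq> {} \<Longrightarrow> 0 \<le> t \<Longrightarrow> avg (y t) = avg zs"
    and q: "q \<in> omega_limit y"
  shows "src_state q = src_state zs"
proof -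
  have yK: "y t \<in> K" if "0 \<le> t" for t using trajectory_in[OF y] that by simp
  have qK: "q \<in> K" using omega_limit_subset[where x = y, OF compact_imp_closed[OF compact_K] yK] q by blast
  have "src_state q $ k = src_state zs $ k" for k
  proof (cases "k \<in> source_edges N")
    case True
    have lim: "((\<lambda>t. src_state (y t) $ k) \<longlongrightarrow> src_state zs $ k) at_top"
      by (rule src_state_converges[OF y True f]) (use True in auto)
    show ?thesis
      by (rule omega_limit_eq_limit[where x = y and \<Phi> = "\<lambda>z. src_state z $ k",
            OF compact_imp_closed[OF compact_K] yK _ lim q])
        (assumption | intro continuous_intros)+
  next
    case False
    then show ?thesis using M_offD(3)[OF K_M[OF qK]] M_offD(3)[OF zs(1)] by simp
  qed
  then show ?thesis by (simp add: vec_eq_iff)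
qed

lemma gen_state_limit:
  assumes y: "trajectory F K {0..} y"
    and f: "\<And>t j. j \<notin> slack md \<Longrightarrow> 0 \<le> t \<Longrightarrow> freq (y t) $ j = freq zs $ j"
    and q: "q \<in> omega_limit y"
  shows "gen_state q = gen_state zs"
proof -
  have yK: "y t \<in> K" if "0 \<le> t" for t using trajectory_in[OF y] that by simp
  have qK: "q \<in> K" using omega_limit_subset[where x = y, OF compact_imp_closed[OF compact_K] yK] q by blast
  have "gen_state q $ j = gen_state zs $ j" for j
  proof (cases "j \<in> gen_buses N")
    case True
    have "j \<notin> slack md" using slack_not_gen[OF md] True by blast
    then have lim: "((\<lambda>t. gen_state (y t) $ j) \<longlongrightarrow> gen_state zs $ j) at_top"
      by (intro gen_state_converges[OF y True] f)
    show ?thesis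
      by (rule omega_limit_eq_limit[where x = y and \<Phi> = "\<lambda>z. gen_state z $ j",
            OF compact_imp_closed[OF compact_K] yK _ lim q])
        (assumption | intro continuous_intros)+
  next
    case False
    then show ?thesis using M_offD(2)[OF K_M[OF qK]] M_offD(2)[OF zs(1)] by simp
  qed
  then show ?thesis by (simp add: vec_eq_iff)
qed

lemma V_heat_at_limit:
  assumes "avg z = avg c" "src_state z = src_state c" "c \<in> equilibria"
  shows "V_heat c z = 0"
proof -
  have "Vh k (src_state z $ k) = 0" if "k \<in> source_edges N" for k
    using passive_systemD(2)[OF ph[OF that]] equilibriaD(5)[OF assms(3)] assms(2) by simp
  then show ?thesis using assms(1) by (simp add: V_heat_def)
qed

text \<open>In Mode 1 the heating network is driven by the electric network but does not act back on it.\<close>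

lemma backward_trajectory_trivial:
  assumes c: "c \<in> equilibria" and u: "trajectory (\<lambda>q. - F q) K {0..} u"
    and V0: "\<And>t. 0 \<le> t \<Longrightarrow> V c (u t) = 0"
  shows "u 0 = c"
proof -
  \<comment> \<open>On this set the electric variables are those of \<open>c\<close>, so the heat
    pumps deliver constant power.\<close>
  define K1 where "K1 = {z \<in> K. V c z = 0}"
  have K1: "compact K1" unfolding K1_def by (rule compact_slice[OF compact_K V_continuous(2)])
  have K1K: "K1 \<subseteq> K" by (auto simp: K1_def)
  have u1: "trajectory (\<lambda>q. - F q) K1 {0..} u"
    by (rule trajectory_codomain[OF u]) (use V0 trajectory_in[OF u] in \<open>auto simp: K1_def\<close>)
  have eq1: "eta z = eta c" "freq z = freq c" "gen_state z = gen_state c" if "z \<in> K1" for z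
    using V_zeroD[OF _ c, of z] that by (auto simp: K1_def)
  have heat0: "V_heat c (u s) = 0" if s: "0 \<le> s" for s
  proof (cases md)
    case (Mode2 j m)
    have "u s \<in> K" using trajectory_in[OF u] s by simp
    then show ?thesis using V_zeroD(4)[OF _ c V0[OF s] Mode2] by simp
  next
    case (Mode1 a)
    then have src: "source_edges N \<noteq> {}" using md by simp
    have us: "trajectory (\<lambda>q. - F q) K1 {0..} (\<lambda>t. u (s + t))"
      by (rule trajectory_shift[OF u1]) (use s in auto)
    \<comment> \<open>Backwards in time \<open>V_heat c\<close> does not decrease. A forward
      trajectory on which it is constant has the average temperature of \<open>zs\<close> and
      converging source states, so the constant is the value 0 at a limit point \<open>q\<close>.
      The shift by \<open>s\<close> gives the bound at every time.\<close>
    have "V_heat c (u (s + 0)) \<le> 0"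
    proof (rule backward_trajectory_le[OF K1 _ us])
      show "continuous_on K1 F" by (rule continuous_on_subset[OF F_continuous K1K])
      show "continuous_on K1 (V_heat c)" by (rule continuous_on_subset[OF V_continuous(1) K1K])
      show "V_heat c (y b) \<le> V_heat c (y 0)" if "0 \<le> b" and y: "trajectory F K1 {0..b} y" for y b
        by (rule V_heat_decreasing[OF trajectory_mono[OF y K1K] that(1) c])
          (simp only: eq1[OF trajectory_in[OF y]])
      fix y assume y: "trajectory F K1 {0..} y" and const: "\<And>t. 0 \<le> t \<Longrightarrow> V_heat c (y t) = V_heat c (y 0)"
      have yK1: "y t \<in> K1" if "0 \<le> t" for t using trajectory_in[OF y] that by simp
      then have yK: "y t \<in> K" if "0 \<le> t" for t using that K1K by blast
      note y' = trajectory_mono[OF y K1K]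
      have avg: "avg (y t) = avg zs" if t: "0 \<le> t" for t
        by (rule V_heat_constant[OF y' c _ const t src]) (use eq1[OF yK1] in auto)
      obtain q where q: "q \<in> omega_limit y"
        using omega_limit_nonempty[where x = y, OF compact_K yK] by blast
      have qK: "q \<in> K" using omega_limit_subset[where x = y, OF compact_imp_closed[OF compact_K] yK] q by blast
      have s: "src_state q = src_state zs" by (rule src_state_limit[OF y' avg q])
      have lim: "((\<lambda>t. avg (y t)) \<longlongrightarrow> avg zs) at_top"
        by (rule tendsto_at_top_constant) (rule avg)
      have a: "avg q = avg zs"
        by (rule omega_limit_eq_limit[where x = y and \<Phi> = avg, OF compact_imp_closed[OF compact_K] yK _ lim q])
          (assumption | intro continuous_intros)+
      have "V_heat c q = 0"
        using a s equilibriaD(5)[OF c] equilibriaD(7)[OF c src] by (intro V_heat_at_limit[OF _ _ c]) simp_all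
      moreover have lim': "((\<lambda>t. V_heat c (y t)) \<longlongrightarrow> V_heat c (y 0)) at_top"
        by (rule tendsto_at_top_constant) (rule const)
      have "V_heat c q = V_heat c (y 0)"
        by (rule omega_limit_eq_limit[where x = y, OF compact_imp_closed[OF compact_K] yK V_continuous(1) lim' q])
      ultimately show "V_heat c (y 0) \<le> 0" by simp
    qed
    then have "V_heat c (u s) \<le> 0" by (simp only: add_0_right)
    moreover have "u s \<in> K" using trajectory_in[OF u, of s] s by simp
    then have "0 \<le> V_heat c (u s)" by (rule V_heat_nonneg)
    ultimately show ?thesis by linarith
  qed
  have u2: "trajectory (\<lambda>q. - F q) (core c) {0..} u"
  proof (rule trajectory_codomain[OF u])
    fix t :: real assume t: "t \<in> {0..}"
    have uK: "u t \<in> K" using trajectory_in[OF u t] .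
    have "0 \<le> t" using t by simp
    note V_zeroD(1-3)[OF uK c V0[OF this]] V_heat_zeroD[OF uK c heat0[OF this]]
    with uK show "u t \<in> core c" unfolding core_def by blast
  qed
  \<comment> \<open>The same scheme once more: only the temperature distribution is left, with
    \<open>V_temp c\<close> as its energy.\<close>
  have "V_temp c (u 0) \<le> 0"
  proof (rule backward_trajectory_le[OF compact_core _ u2 V_temp_continuous])
    show "continuous_on (core c) F" by (rule continuous_on_subset[OF F_continuous core_subset])
    show "V_temp c (y b) \<le> V_temp c (y 0)" if "0 \<le> b" "trajectory F (core c) {0..b} y" for y b
      by (rule V_temp_decreasing[OF that(2,1) c])
    show "V_temp c (y 0) \<le> 0" if "trajectory F (core c) {0..} y" "\<And>t. 0 \<le> t \<Longrightarrow> V_temp c (y t) = V_temp c (y 0)" for y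
      by (rule V_temp_constant[OF that(1) c that(2)])
  qed
  moreover have "u 0 \<in> core c" using trajectory_in[OF u2] by simp
  ultimately show ?thesis using core_eqI by blast
qed

end

lemma decreasing_along_trajectory:
  fixes \<Phi> :: "'a::euclidean_space \<Rightarrow> real"
  assumes x: "trajectory F C {0..} x"
    and dec: "\<And>b y. 0 \<le> b \<Longrightarrow> trajectory F C {0..b} y \<Longrightarrow> \<Phi> (y b) \<le> \<Phi> (y 0)"
    and st: "0 \<le> s" "s \<le> t"
  shows "\<Phi> (x t) \<le> \<Phi> (x s)"
proof -
  have "trajectory F C {0..t - s} (\<lambda>u. x (s + u))"
    by (rule trajectory_shift[OF x]) (use st in auto)
  from dec[OF _ this] show ?thesis using st by simp
qed

lemma omega_limit_constant:
  fixes \<Phi> :: "'a::euclidean_space \<Rightarrow> real"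
  assumes C: "compact C" and x: "trajectory F C {0..} x" and \<Phi>: "continuous_on C \<Phi>"
    and dec: "\<And>b y. 0 \<le> b \<Longrightarrow> trajectory F C {0..b} y \<Longrightarrow> \<Phi> (y b) \<le> \<Phi> (y 0)"
    and q: "q \<in> omega_limit x" "q' \<in> omega_limit x"
  shows "\<Phi> q = \<Phi> q'"
proof -
  have xC: "x t \<in> C" if "0 \<le> t" for t using trajectory_in[OF x] that by simp
  have "((\<lambda>t. \<Phi> (x t)) \<longlongrightarrow> \<Phi> q) at_top" if "q \<in> omega_limit x" for q
    by (rule omega_limit_decreasing(1)[where x = x, OF compact_imp_closed[OF C] xC \<Phi> _ that])
      (assumption | rule decreasing_along_trajectory[OF x dec])+
  from tendsto_unique[OF _ this[OF q(1)] this[OF q(2)]] show ?thesis by simp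
qed

lemma linear_bounded_zero:
  fixes f :: "real \<Rightarrow> real"
  assumes "\<And>t. 0 \<le> t \<Longrightarrow> \<bar>f 0 + t * w\<bar> \<le> B"
  shows "w = 0"
proof (rule ccontr)
  assume w: "w \<noteq> 0"
  define t where "t = (B + \<bar>f 0\<bar> + 1) / \<bar>w\<bar>"
  have B: "0 \<le> B" using assms[of 0] by simp
  then have t: "0 \<le> t" using w by (simp add: t_def)
  have "\<bar>t * w\<bar> = B + \<bar>f 0\<bar> + 1" using w B t by (simp add: abs_mult) (simp add: t_def)
  moreover have "\<bar>t * w\<bar> \<le> \<bar>f 0 + t * w\<bar> + \<bar>f 0\<bar>" by linarith
  ultimately show False using assms[OF t] by linarith
qed

lemma deriv_constant_affine:
  fixes f :: "real \<Rightarrow> real"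
  assumes "\<And>t. 0 \<le> t \<Longrightarrow> (f has_real_derivative w) (at t within {0..})" "0 \<le> t"
  shows "f t = f 0 + t * w"
proof -
  have "\<exists>c. \<forall>t\<in>{0..}. f t - t * w = c"
  proof (rule has_field_derivative_zero_constant)
    fix t :: real assume "t \<in> {0..}"
    then have "(f has_real_derivative w) (at t within {0..})" using assms(1) by simp
    then show "((\<lambda>t. f t - t * w) has_real_derivative 0) (at t within {0..})"
      by (auto intro!: derivative_eq_intros)
  qed simp
  then obtain c where "\<And>t. 0 \<le> t \<Longrightarrow> f t - t * w = c" by auto
  from this[of t] this[of 0] assms(2) show ?thesis by simp
qed

context passive_chp
begin

section \<open>Settling of the variables on iterated limit sets\<close>

lemma omega_limit_in_K:
  assumes "trajectory F K {0..} x"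
  shows "omega_limit x \<subseteq> K"
proof (rule omega_limit_subset[OF compact_imp_closed[OF compact_K]])
  show "x t \<in> K" if "0 \<le> t" for t using trajectory_in[OF assms] that by simp
qed

lemma omega_limit_mono:
  assumes "trajectory F (omega_limit x) {0..} y"
  shows "omega_limit y \<subseteq> omega_limit x"
proof (rule omega_limit_subset[OF closed_omega_limit])
  show "y t \<in> omega_limit x" if "0 \<le> t" for t using trajectory_in[OF assms] that by simp
qed

lemma omega_limit_trajectory:
  assumes "trajectory F K {0..} x"
  obtains y where "trajectory F (omega_limit x) {0..} y"
proof -
  have "omega_limit x \<noteq> {}"
  proof (rule omega_limit_nonempty[OF compact_K])
    show "x t \<in> K" if "0 \<le> t" for t using trajectory_in[OF assms] that by simp
  qed
  then obtain q where "q \<in> omega_limit x" by blast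
  then show thesis using omega_limit_invariant[OF compact_K F_continuous assms] that by blast
qed

text \<open>LaSalle's argument with the energy centred at \<open>zs\<close>: it is constant along a
  trajectory from \<open>q\<close> inside the limit set, so there is no dissipation at
  \<open>q\<close>.\<close>

lemma damp_zero_on_limit:
  assumes x: "trajectory F K {0..} x" and q: "q \<in> omega_limit x"
  shows "damp q = 0"
proof -
  obtain y where y: "y 0 = q" "trajectory F (omega_limit x) {0..} y"
    using omega_limit_invariant[OF compact_K F_continuous x q] by blast
  have yK: "trajectory F K {0..} y" by (rule trajectory_mono[OF y(2) omega_limit_in_K[OF x]])
  have t0: "(0::real) \<in> {0..}" by simp
  obtain d where d: "((\<lambda>t. V zs (y t)) has_real_derivative d) (at 0 within {0..})" "d \<le> - damp (y 0)"
    using V_deriv[OF yK t0 zs_equilibrium] by blast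
  have const: "V zs (y t) = V zs q" if "0 \<le> t" for t
  proof (rule omega_limit_constant[OF compact_K x V_continuous(2) V_decreasing[OF zs_equilibrium] _ q])
    show "y t \<in> omega_limit x" using trajectory_in[OF y(2)] that by simp
  qed
  have "d = 0" by (rule constant_deriv_zero[OF const order_refl d(1)])
  then show ?thesis using d(2) y(1) damp_nonneg[of q] by simp
qed

text \<open>Off the slack bus the inflow is read off the swing equation. There is at most one slack
  bus, and its inflow follows because all inflows sum to zero.\<close>

lemma net_inflow_eq:
  assumes z: "z \<in> M" and f: "\<And>j. j \<notin> slack md \<Longrightarrow> freq z $ j = freq zs $ j"
    and g: "gen_state z = gen_state zs" and rate: "\<And>j. j \<in> gen_buses N \<Longrightarrow> freq_rate N md z j = 0"
  shows "net_inflow N (eta z) j = net_inflow N (eta zs) j"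
proof -
  have ns: "net_inflow N (eta z) i = net_inflow N (eta zs) i" if i: "i \<notin> slack md" for i
  proof -
    have "inertia N i * freq_rate N md z i = 0"
      using rate[of i] N by (cases "i \<in> gen_buses N") (simp_all add: chp_network_def)
    moreover have "inertia N i * freq_rate N md zs i = 0"
      using field_zeroD(2)[OF zs(2)] by simp
    moreover have "elec_generation N (freq z) (gen_state z) i = elec_generation N (freq zs) (gen_state zs) i"
      using f[OF i] g by (simp add: elec_generation_def)
    ultimately show ?thesis using swing_identity[OF z i] swing_identity[OF zs(1) i] f[OF i] by simp
  qed
  show ?thesis
  proof (cases "j \<in> slack md")
    case True
    then have sl: "slack md = {j}" by (cases md) auto
    have "net_inflow N \<eta> j = - (\<Sum>i\<in>UNIV - {j}. net_inflow N \<eta> i)" for \<eta>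
      using sum_net_inflow[of N \<eta>] sum.remove[of UNIV j "net_inflow N \<eta>"] by simp
    moreover have "(\<Sum>i\<in>UNIV - {j}. net_inflow N (eta z) i) = (\<Sum>i\<in>UNIV - {j}. net_inflow N (eta zs) i)"
      by (rule sum.cong[OF refl ns]) (simp add: sl)
    ultimately show ?thesis by simp
  next
    case False
    then show ?thesis by (rule ns)
  qed
qed

lemma pump_power_eq:
  assumes "\<And>j. j \<notin> slack md \<Longrightarrow> freq z $ j = freq c $ j"
    and "\<And>j. net_inflow N (eta z) j = net_inflow N (eta c) j"
  shows "pump_power N md (eta z) (freq z) j = pump_power N md (eta c) (freq c) j"
  using assms by (cases md) auto

lemma settled_heat_input:
  assumes z: "z \<in> M" and f: "\<And>j. j \<notin> slack md \<Longrightarrow> freq z $ j = freq zs $ j"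
    and net: "\<And>j. net_inflow N (eta z) j = net_inflow N (eta zs) j"
    and s: "src_state z = src_state zs" and a: "source_edges N \<noteq> {} \<Longrightarrow> avg z = avg zs"
  shows "heat_input N md z k = heat_input N md zs k"
proof -
  have "heat_generation N (temp z) (src_state z) k = heat_generation N (temp zs) (src_state zs) k"
  proof (cases "k \<in> source_edges N")
    case True
    then have "avg z = avg zs" using a by blast
    then show ?thesis using s by (simp add: heat_generation_def)
  qed (simp add: heat_generation_def)
  moreover have "pump_heat N md (eta z) (freq z) k = pump_heat N md (eta zs) (freq zs) k"
    unfolding pump_heat_def using pump_power_eq[OF f net] by simp
  ultimately show ?thesis by (simp add: heat_input_def)
qed

text \<open>Once the generation has settled, the slack frequency is constant, so that the angles drift
  linearly; being bounded, they are constant.\<close>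

lemma settled_core:
  assumes y: "trajectory F K {0..} y"
    and f: "\<And>t j. 0 \<le> t \<Longrightarrow> j \<notin> slack md \<Longrightarrow> freq (y t) $ j = freq zs $ j"
    and g: "\<And>t. 0 \<le> t \<Longrightarrow> gen_state (y t) = gen_state zs"
    and s: "\<And>t. 0 \<le> t \<Longrightarrow> src_state (y t) = src_state zs"
    and a: "\<And>t. 0 \<le> t \<Longrightarrow> source_edges N \<noteq> {} \<Longrightarrow> avg (y t) = avg zs"
  obtains c where "c \<in> equilibria" "\<forall>t\<ge>0. y t \<in> core c"
proof -
  have yK: "y t \<in> K" if "0 \<le> t" for t using trajectory_in[OF y] that by simp
  have yM: "y t \<in> M" if "0 \<le> t" for t using yK[OF that] by (rule K_M)
  have yd: "(y has_vector_derivative F (y t)) (at t within {0..})" if "0 \<le> t" for t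
    using trajectory_deriv[OF y] that by simp
  have rate: "freq_rate N md (y t) j = 0" if t: "0 \<le> t" and j: "j \<notin> slack md" for t j
    by (rule constant_deriv_zero[OF f t vector_field_derivs(2)[OF yd[OF t]]]) (use j in auto)
  have net: "net_inflow N (eta (y t)) j = net_inflow N (eta zs) j" if t: "0 \<le> t" for t j
    by (rule net_inflow_eq[OF yM[OF t] f[OF t] g[OF t] rate[OF t]])
      (use slack_not_gen[OF md] in auto)
  have heat: "heat_input N md (y t) k = heat_input N md zs k" if t: "0 \<le> t" for t k
    by (rule settled_heat_input[OF yM[OF t] f[OF t] net[OF t] s[OF t] a[OF t]])
  \<comment> \<open>The total heat input is that at \<open>zs\<close>, where it is balanced. The
    average temperature is thus constant, and with it the slack frequency.\<close>
  have avg_rate: "average_temperature N (temp_rate N md (y t)) = 0" if t: "0 \<le> t" for t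
  proof -
    have "(\<Sum>i\<in>UNIV. volume N i) * average_temperature N (temp_rate N md (y t))
        = (\<Sum>i\<in>UNIV. volume N i) * average_temperature N (temp_rate N md zs)"
      unfolding avg_temp_rate heat[OF t] by simp
    also have "\<dots> = 0" using field_zeroD(3)[OF zs(2)] by (simp add: average_temperature_def)
    finally show ?thesis using total_volume_pos by simp
  qed
  have avg_const: "avg (y t) = avg (y 0)" if t: "0 \<le> t" for t
  proof -
    have "((\<lambda>t. avg (y t)) has_real_derivative 0) (at t within {0..})" if "0 \<le> t" for t
      using average_temperature_deriv[OF vector_field_derivs(3)[OF yd[OF that]], of N] avg_rate[OF that] by simp
    from deriv_constant_affine[OF this t] show ?thesis by simp
  qed
  have freq_const: "freq (y t) = freq (y 0)" if t: "0 \<le> t" for t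
  proof -
    have "freq (y t) $ j = freq (y 0) $ j" for j
    proof (cases "j \<in> slack md")
      case True
      then obtain m where m: "md = Mode2 j m" by (cases md) auto
      show ?thesis using slack_freq[OF yM[OF t] m] slack_freq[OF yM[OF order_refl] m] avg_const[OF t] by simp
    next
      case False
      then show ?thesis using f[OF t] f[OF order_refl] by simp
    qed
    then show ?thesis by (simp add: vec_eq_iff)
  qed
  have affine: "eta (y t) $ e = eta (y 0) $ e + t * (freq (y 0) $ fst e - freq (y 0) $ snd e)"
    if t: "0 \<le> t" and e: "e \<in> lines N" for t e
    by (rule deriv_constant_affine[OF _ t]) (metis vector_field_derivs(1)[OF yd e] freq_const)
  have sync: "freq (y 0) $ fst e = freq (y 0) $ snd e" if e: "e \<in> lines N" for e
  proof -
    have "\<bar>eta (y 0) $ e + t * (freq (y 0) $ fst e - freq (y 0) $ snd e)\<bar> \<le> pi / 2" if t: "0 \<le> t" for t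
      using near_eta[OF yK[OF t] e] affine[OF t e] by simp
    from linear_bounded_zero[where f = "\<lambda>t. eta (y t) $ e", OF this] show ?thesis by simp
  qed
  have eta_const: "eta (y t) = eta (y 0)" if t: "0 \<le> t" for t
  proof -
    have "eta (y t) $ e = eta (y 0) $ e" for e
    proof (cases "e \<in> lines N")
      case True
      then show ?thesis using affine[OF t True] sync[OF True] by simp
    next
      case False
      then show ?thesis using M_offD(1)[OF yM[OF t]] M_offD(1)[OF yM[OF order_refl]] by simp
    qed
    then show ?thesis by (simp add: vec_eq_iff)
  qed
  \<comment> \<open>The temperatures along \<open>y\<close> may still vary, so \<open>c\<close>
    cannot adopt them. It takes the profile of \<open>zs\<close>, shifted uniformly to the average
    of \<open>y\<close>; the heat balance survives because \<open>A_h N\<close> annihilates uniform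
    shifts. If there are sources, the shift is zero.\<close>
  define c where "c = (eta (y 0), freq (y 0), gen_state zs, temp zs + (avg (y 0) - avg zs) *\<^sub>R 1, src_state zs)"
  have cs: "eta c = eta (y 0)" "freq c = freq (y 0)" "gen_state c = gen_state zs"
    "temp c = temp zs + (avg (y 0) - avg zs) *\<^sub>R 1" "src_state c = src_state zs"
    by (simp_all add: c_def)
  have ac: "avg c = avg (y 0)" unfolding cs average_temperature_shift by simp
  have cM: "c \<in> M"
  proof -
    have "c \<in> state_space N"
      using M_state_space[OF zs(1)] M_state_space[OF yM[OF order_refl]]
      unfolding state_space_def mem_Collect_eq cs by blast
    moreover have "residual N md c j = residual N md (y 0) j" for j
      unfolding residual_def cs(1,2) ac by simp
    ultimately show ?thesis using yM[OF order_refl] by (simp add: constraint_set_def)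
  qed
  have cf: "freq c $ j = freq zs $ j" if "j \<notin> slack md" for j using f[OF order_refl that] cs by simp
  have ca: "avg c = avg zs" if "source_edges N \<noteq> {}" using a[OF order_refl that] ac by simp
  have cn: "net_inflow N (eta c) j = net_inflow N (eta zs) j" for j
    unfolding cs by (rule net[OF order_refl])
  have cT: "temp_rate N md c = 0"
  proof -
    have "heat_input N md c k = heat_input N md zs k" for k
      by (rule settled_heat_input[OF cM cf cn cs(5) ca])
    then have h: "(case i of Inl k \<Rightarrow> heat_input N md c k | Inr _ \<Rightarrow> 0) =
        (case i of Inl k \<Rightarrow> heat_input N md zs k | Inr _ \<Rightarrow> 0)" for i :: "'k + 'm"
      by (cases i) auto
    have "A_h N *v 1 = 0" using N by (simp add: chp_network_def)
    then have "A_h N *v temp c = A_h N *v temp zs"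
      unfolding cs by (simp add: matrix_vector_right_distrib matrix_vector_mult_scaleR)
    then have "temp_rate N md c = temp_rate N md zs" unfolding temp_rate_def h by simp
    then show ?thesis using field_zeroD(3)[OF zs(2)] by simp
  qed
  have cR: "freq_rate N md c j = 0" for j
  proof (cases "j \<in> gen_buses N")
    case True
    then have "j \<notin> slack md" using slack_not_gen[OF md] by blast
    then have "freq_rate N md (y 0) j = 0" by (rule rate[OF order_refl])
    then show ?thesis using True g[OF order_refl] by (simp add: freq_rate_def cs)
  next
    case False
    have "inflow_rate N (eta c) (freq c) j = 0"
      using sync[of "(_, _)"] by (simp add: inflow_rate_def cs)
    then show ?thesis using False cT by (simp add: freq_rate_def average_temperature_def)
  qed
  have zsF: "f_e N j (gen_state zs $ j) (freq zs $ j) = 0" if "j \<in> gen_buses N" for j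
  proof -
    have "gen_state (F zs) $ j = 0" using zs(2) by simp
    then show ?thesis using that by (simp add: vector_field_def)
  qed
  have zsH: "f_h N k (src_state zs $ k) (avg zs) = 0" if "k \<in> source_edges N" for k
  proof -
    have "src_state (F zs) $ k = 0" using zs(2) by simp
    then show ?thesis using that by (simp add: vector_field_def)
  qed
  have "(if e \<in> lines N then freq c $ fst e - freq c $ snd e else 0) = 0" for e
    using sync by (simp add: cs)
  moreover have "(if j \<in> gen_buses N then - f_e N j (gen_state c $ j) (freq c $ j) else 0) = 0" for j
  proof (cases "j \<in> gen_buses N")
    case True
    then have "j \<notin> slack md" using slack_not_gen[OF md] by blast
    then show ?thesis using zsF[OF True] cf cs(3) by simp
  qed simp
  moreover have "(if k \<in> source_edges N then - f_h N k (src_state c $ k) (avg c) else 0) = 0" for k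
  proof (cases "k \<in> source_edges N")
    case True
    then have "avg c = avg zs" using ca by blast
    then show ?thesis using zsH[OF True] cs(5) by simp
  qed simp
  ultimately have cF: "F c = 0"
    unfolding vector_field_def cR cT by (simp add: zero_prod_def vec_eq_iff)
  have "c \<in> equilibria"
    unfolding equilibria_def using cM cF near_eta[OF yK[OF order_refl]] cs cf ca by simp
  moreover have "\<forall>t\<ge>0. y t \<in> core c"
  proof (intro allI impI)
    fix t :: real assume t: "0 \<le> t"
    show "y t \<in> core c"
    unfolding core_def using yK[OF t] eta_const[OF t] freq_const[OF t] g[OF t] s[OF t] avg_const[OF t] cs ac
    by simp
  qed
  ultimately show thesis by (rule that)
qed

text \<open>The frequencies settle on \<open>L\<close>, where the dissipation vanishes; the
  generation states and, given a source, the average temperature on \<open>L1\<close>; the source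
  states on \<open>L2\<close>, whose trajectory \<open>y2\<close> lies in a core; the temperature
  distribution on \<open>L3\<close>. Every stage supplies the constant inputs for the next. As the
  sets are nested, the point found belongs to the first limit set.\<close>

lemma limit_equilibrium:
  assumes x: "trajectory F K {0..} x"
  shows "\<exists>c\<in>equilibria. c \<in> omega_limit x"
proof -
  define L where "L = omega_limit x"
  have LK: "L \<subseteq> K" unfolding L_def by (rule omega_limit_in_K[OF x])
  have Lf: "freq q $ j = freq zs $ j" if "q \<in> L" "j \<notin> slack md" for q j
    by (rule damp_zeroD(1)[OF damp_zero_on_limit[OF x] that(2)]) (use that(1) L_def in simp)
  obtain y0 where y0: "trajectory F L {0..} y0" using omega_limit_trajectory[OF x] L_def by blast
  note y0K = trajectory_mono[OF y0 LK]
  have y0L: "y0 t \<in> L" if "0 \<le> t" for t using trajectory_in[OF y0] that by simp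
  define L1 where "L1 = omega_limit y0"
  have L1L: "L1 \<subseteq> L" unfolding L1_def L_def by (rule omega_limit_mono[OF y0[unfolded L_def]])
  have L1g: "gen_state q = gen_state zs" if "q \<in> L1" for q
    by (rule gen_state_limit[OF y0K Lf[OF y0L]]) (use that L1_def in simp_all)
  have L1a: "avg q = avg zs" if q: "q \<in> L1" and src: "source_edges N \<noteq> {}" for q
  proof (cases md)
    case (Mode2 j m)
    show ?thesis by (rule damp_zeroD(2)[OF damp_zero_on_limit[OF x] Mode2 src]) (use q L1L L_def in blast)
  next
    \<comment> \<open>In Mode 1 \<open>damp\<close> contains no temperatures. But on
      \<open>L\<close> the pumps have their equilibrium power, so \<open>V_heat zs\<close> does not
      increase along trajectories in \<open>L\<close> and is constant on the limit set
      \<open>L1\<close> of one of them, where its dissipation must vanish.\<close>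
    case (Mode1 m)
    have pp: "pump_power N md (eta z) (freq z) j = pump_power N md (eta zs) (freq zs) j" if "z \<in> L" for z j
      using Lf[OF that] Mode1 by simp
    have compL: "compact L"
      using compact_Int_closed[OF compact_K closed_omega_limit[of x]] LK by (simp add: L_def Int_absorb1)
    obtain w where w: "w 0 = q" "trajectory F L1 {0..} w"
      using omega_limit_invariant[OF compact_K F_continuous y0K] q L1_def by blast
    have wL: "w t \<in> L" if "0 \<le> t" for t using trajectory_in[OF w(2)] that L1L by auto
    have dec: "V_heat zs (y b) \<le> V_heat zs (y 0)" if "0 \<le> b" "trajectory F L {0..b} y" for b y
      by (rule V_heat_decreasing[OF trajectory_mono[OF that(2) LK] that(1) zs_equilibrium])
        (rule pp[OF trajectory_in[OF that(2)]])
    have "avg (w 0) = avg zs"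
    proof (rule V_heat_constant[OF _ zs_equilibrium _ _ order_refl src])
      show "trajectory F K {0..} w" by (rule trajectory_mono[OF w(2)]) (use L1L LK in blast)
      show "pump_power N md (eta (w t)) (freq (w t)) j = pump_power N md (eta zs) (freq zs) j" if "0 \<le> t" for t j
        by (rule pp[OF wL[OF that]])
      show "V_heat zs (w t) = V_heat zs (w 0)" if "0 \<le> t" for t
      proof (rule omega_limit_constant[OF compL y0 continuous_on_subset[OF V_continuous(1) LK] dec])
        show "w t \<in> omega_limit y0" "w 0 \<in> omega_limit y0"
          using trajectory_in[OF w(2)] that by (simp_all add: L1_def)
      qed
    qed
    then show ?thesis using w(1) by simp
  qed
  obtain y1 where y1: "trajectory F L1 {0..} y1" using omega_limit_trajectory[OF y0K] L1_def by blast
  have L1K: "L1 \<subseteq> K" using L1L LK by blast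
  note y1K = trajectory_mono[OF y1 L1K]
  have y1L: "y1 t \<in> L1" if "0 \<le> t" for t using trajectory_in[OF y1] that by simp
  define L2 where "L2 = omega_limit y1"
  have L2L: "L2 \<subseteq> L1" unfolding L2_def L1_def by (rule omega_limit_mono[OF y1[unfolded L1_def]])
  have L2s: "src_state q = src_state zs" if "q \<in> L2" for q
    by (rule src_state_limit[OF y1K L1a[OF y1L]]) (use that L2_def in simp_all)
  obtain y2 where y2: "trajectory F L2 {0..} y2" using omega_limit_trajectory[OF y1K] L2_def by blast
  have L2K: "L2 \<subseteq> K" using L2L L1K by blast
  note y2K = trajectory_mono[OF y2 L2K]
  have y2L: "y2 t \<in> L2" "y2 t \<in> L1" "y2 t \<in> L" if "0 \<le> t" for t
    using trajectory_in[OF y2] that L2L L1L by auto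
  obtain c where c: "c \<in> equilibria" and core': "\<forall>t\<ge>0. y2 t \<in> core c"
    by (rule settled_core[OF y2K Lf[OF y2L(3)] L1g[OF y2L(2)] L2s[OF y2L(1)] L1a[OF y2L(2)]])
  have core: "y2 t \<in> core c" if "0 \<le> t" for t using core' that by blast
  have y2c: "trajectory F (core c) {0..} y2" by (rule trajectory_codomain[OF y2]) (use core in simp)
  define L3 where "L3 = omega_limit y2"
  have L3c: "L3 \<subseteq> core c" unfolding L3_def
    by (rule omega_limit_subset[where x = y2, OF compact_imp_closed[OF compact_core] core])
  obtain y3 where y3: "trajectory F L3 {0..} y3" using omega_limit_trajectory[OF y2K] L3_def by blast
  have y3L: "y3 t \<in> L3" if "0 \<le> t" for t using trajectory_in[OF y3] that by simp
  have "V_temp c (y3 0) \<le> 0"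
  proof (rule V_temp_constant[OF trajectory_mono[OF y3 L3c] c])
    show "V_temp c (y3 t) = V_temp c (y3 0)" if "0 \<le> t" for t
      by (rule omega_limit_constant[OF compact_core y2c V_temp_continuous V_temp_decreasing[OF _ _ c]])
        (use y3L that L3_def in simp_all)
  qed
  then have "y3 0 = c" using core_eqI y3L[OF order_refl] L3c by blast
  then have "c \<in> L3" using y3L[OF order_refl] by simp
  moreover have "L3 \<subseteq> L2" unfolding L3_def L2_def by (rule omega_limit_mono[OF y2[unfolded L2_def]])
  ultimately show ?thesis using c L2L L1L L_def by blast
qed

end

section \<open>Convergence to an equilibrium\<close>

text \<open>No forward interval properly contains the half-line. This makes
  \<open>asymptotically_stable\<close>, which speaks of maximal solutions, applicable to the
  trajectories in limit sets.\<close>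

lemma solution_on_atLeast_maximal:
  assumes "solution_of R {0..} x"
  shows "maximal_solution R {0..} x"
proof -
  have "J = {0..}" if "forward_interval J" "{0..} \<subseteq> J" for J :: "real set"
    using that unfolding forward_interval_def
  proof (elim disjE exE conjE)
    fix \<tau> assume "J = {0..<\<tau>}" "0 < \<tau>"
    moreover have "\<tau> \<in> {0..}" using \<open>0 < \<tau>\<close> by simp
    then have "\<tau> \<in> J" using that(2) by blast
    ultimately show ?thesis by simp
  qed simp
  then show ?thesis using assms unfolding maximal_solution_def solution_of_def by blast
qed

lemma passive_system_exists:
  fixes S :: "'s::euclidean_space set"
  assumes as: "asymptotically_stable (generation_dynamics S f us) xs"
    and p: "locally_input_strictly_passive S f g us xs V" and m: "strict_local_min_on S V xs"
  obtains dV \<phi> X \<Omega> where "passive_system S f g us xs V dV \<phi> X \<Omega>"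
    "open \<Omega>" "us \<in> \<Omega>" "openin (top_of_set S) X" "xs \<in> X"
proof -
  obtain \<Omega> X0 dV \<phi> where \<Omega>: "open \<Omega>" "us \<in> \<Omega>" and X0: "openin (top_of_set S) X0" "xs \<in> X0"
    and V0: "V xs = 0" "\<forall>x\<in>X0. 0 \<le> V x"
    and dV: "\<forall>x\<in>X0. (V has_derivative (\<lambda>h. dV x \<bullet> h)) (at x within S)"
    and \<phi>: "\<phi> 0 = (0::real)" "\<forall>s. s \<noteq> 0 \<longrightarrow> 0 < \<phi> s"
    and pass: "\<forall>u\<in>\<Omega>. \<forall>x\<in>X0.
           dV x \<bullet> (- f x u) \<le> (- u + us) * ((- g x u) - (- g xs us)) - \<phi> (- u + us)"
    using p unfolding locally_input_strictly_passive_def by blast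
  obtain d where d: "0 < d" "\<forall>I x. maximal_solution (generation_dynamics S f us) I x \<and> dist (x 0) xs < d \<longrightarrow>
      I = {0..} \<and> (x \<longlongrightarrow> xs) at_top"
    using as unfolding asymptotically_stable_def by blast
  obtain d' where d': "0 < d'" "\<forall>x\<in>S. x \<noteq> xs \<and> dist x xs < d' \<longrightarrow> V xs < V x"
    using m unfolding strict_local_min_on_def eventually_at by blast
  \<comment> \<open>\<open>d\<close> is a radius of attraction and \<open>d'\<close> one of strict
    minimality; \<open>X\<close> is small enough for both and for passivity.\<close>
  define X where "X = X0 \<inter> ball xs (min d d')"
  have XS: "X \<subseteq> S" using openin_imp_subset[OF X0(1)] by (auto simp: X_def)
  have Xd: "x \<in> X0" "dist x xs < d" "dist x xs < d'" if "x \<in> X" for x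
    using that by (auto simp: X_def dist_commute)
  have "passive_system S f g us xs V dV \<phi> X \<Omega>"
    unfolding passive_system_def
  proof (intro conjI ballI allI impI)
    show "X \<subseteq> S" by (rule XS)
    show "V xs = 0" "\<phi> 0 = 0" by fact+
    show "0 < \<phi> s" if "s \<noteq> 0" for s using \<phi>(2) that by blast
    show "(x \<longlongrightarrow> xs) at_top"
      if x: "solution_of (generation_dynamics S f us) {0..} x \<and> x 0 \<in> X" for x
      using d(2) solution_on_atLeast_maximal Xd(2) x by blast
    fix x assume x: "x \<in> X"
    show "0 \<le> V x" using V0(2) Xd(1)[OF x] by blast
    show "x = xs" if "V x = 0"
    proof (rule ccontr)
      assume "x \<noteq> xs"
      then have "V xs < V x" using d'(2) x XS Xd(3)[OF x] by blast
      then show False using that V0(1) by simp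
    qed
    show "(V has_derivative (\<lambda>h. dV x \<bullet> h)) (at x within S)" using dV Xd(1)[OF x] by blast
    show "dV x \<bullet> (- f x u) \<le> (- u + us) * ((- g x u) - (- g xs us)) - \<phi> (- u + us)" if "u \<in> \<Omega>" for u
      using pass that Xd(1)[OF x] by blast
  qed
  moreover have "openin (top_of_set S) X"
    unfolding X_def by (rule openin_Int_open[OF X0(1)]) simp
  moreover have "xs \<in> X" using X0 d d' by (simp add: X_def)
  ultimately show thesis using \<Omega> that by blast
qed

text \<open>The five objects belonging to one system depend on each other, so they are chosen
  together as a nested tuple.\<close>

lemma passive_systems_exist:
  fixes S :: "'i \<Rightarrow> 's::euclidean_space set"
  assumes as: "\<And>j. j \<in> A \<Longrightarrow> asymptotically_stable (generation_dynamics (S j) (f j) (us j)) (xs j)"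
    and p: "\<forall>j\<in>A. \<exists>V. locally_input_strictly_passive (S j) (f j) (g j) (us j) (xs j) V \<and>
          strict_local_min_on (S j) V (xs j)"
  obtains V dV \<phi> X \<Omega> where
    "\<forall>j\<in>A. passive_system (S j) (f j) (g j) (us j) (xs j) (V j) (dV j) (\<phi> j) (X j) (\<Omega> j)"
    "\<forall>j\<in>A. open (\<Omega> j) \<and> us j \<in> \<Omega> j \<and> openin (top_of_set (S j)) (X j) \<and> xs j \<in> X j"
proof -
  have "\<forall>j\<in>A. \<exists>q. passive_system (S j) (f j) (g j) (us j) (xs j)
        (fst q) (fst (snd q)) (fst (snd (snd q))) (fst (snd (snd (snd q)))) (snd (snd (snd (snd q)))) \<and>
      open (snd (snd (snd (snd q)))) \<and> us j \<in> snd (snd (snd (snd q))) \<and>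
      openin (top_of_set (S j)) (fst (snd (snd (snd q)))) \<and> xs j \<in> fst (snd (snd (snd q)))"
  proof
    fix j assume j: "j \<in> A"
    then obtain V where V: "locally_input_strictly_passive (S j) (f j) (g j) (us j) (xs j) V"
      "strict_local_min_on (S j) V (xs j)" using p by blast
    obtain dV \<phi> X \<Omega> where "passive_system (S j) (f j) (g j) (us j) (xs j) V dV \<phi> X \<Omega>"
      "open \<Omega>" "us j \<in> \<Omega>" "openin (top_of_set (S j)) X" "xs j \<in> X"
      by (rule passive_system_exists[OF as[OF j] V])
    then show "\<exists>q. passive_system (S j) (f j) (g j) (us j) (xs j)
        (fst q) (fst (snd q)) (fst (snd (snd q))) (fst (snd (snd (snd q)))) (snd (snd (snd (snd q)))) \<and>
      open (snd (snd (snd (snd q)))) \<and> us j \<in> snd (snd (snd (snd q))) \<and>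
      openin (top_of_set (S j)) (fst (snd (snd (snd q)))) \<and> xs j \<in> fst (snd (snd (snd q)))"
      by (intro exI[of _ "(V, dV, \<phi>, X, \<Omega>)"]) simp
  qed
  from bchoice[OF this] obtain q where q: "\<forall>j\<in>A. passive_system (S j) (f j) (g j) (us j) (xs j)
        (fst (q j)) (fst (snd (q j))) (fst (snd (snd (q j)))) (fst (snd (snd (snd (q j))))) (snd (snd (snd (snd (q j))))) \<and>
      open (snd (snd (snd (snd (q j))))) \<and> us j \<in> snd (snd (snd (snd (q j)))) \<and>
      openin (top_of_set (S j)) (fst (snd (snd (snd (q j))))) \<and> xs j \<in> fst (snd (snd (snd (q j))))" ..
  show thesis
    by (rule that[of "\<lambda>j. fst (q j)" "\<lambda>j. fst (snd (q j))" "\<lambda>j. fst (snd (snd (q j)))"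
          "\<lambda>j. fst (snd (snd (snd (q j))))" "\<lambda>j. snd (snd (snd (snd (q j))))"]; use q in blast)
qed

lemma eventually_open_preimage:
  fixes h :: "'z::topological_space \<Rightarrow> 's::topological_space"
  assumes "open X" "h p \<in> X" "continuous_on UNIV h"
  shows "eventually (\<lambda>z. h z \<in> X) (nhds p)"
  using eventually_nhds_in_open[OF open_vimage[OF assms(1,3)], of p] assms(2) by simp

text \<open>Relative openness gives a neighbourhood only up to membership in \<open>S\<close>, which
  the constraint set provides later.\<close>

lemma eventually_openin_preimage:
  fixes h :: "'z::topological_space \<Rightarrow> 's::topological_space"
  assumes "openin (top_of_set S) X" "h p \<in> X" "continuous_on UNIV h"
  shows "eventually (\<lambda>z. h z \<in> S \<longrightarrow> h z \<in> X) (nhds p)"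
proof -
  obtain T where T: "open T" "X = S \<inter> T" using assms(1) unfolding openin_open by blast
  have "h p \<in> T" using assms(2) T(2) by blast
  from eventually_open_preimage[where h = h, OF T(1) this assms(3)] show ?thesis
    by (rule eventually_mono) (simp add: T(2))
qed

text \<open>The assumption does not mention the rates at buses without inertia. They vanish because
  equal frequencies at the ends of all lines make \<open>inflow_rate\<close> zero and constant
  temperatures do the same for the rate at a slack bus.\<close>

lemma (in chp_model) equilibrium_vector_field:
  assumes "chp_dynamics N md z 0"
  shows "z \<in> constraint_set N md" "vector_field N md z = 0"
proof -
  have *: "z \<in> constraint_set N md \<and>
    (\<forall>e\<in>lines N. 0 = freq z $ fst e - freq z $ snd e) \<and>
    (\<forall>j\<in>gen_buses N. 0 = freq_rate N md z j \<and> 0 = - f_e N j (gen_state z $ j) (freq z $ j)) \<and>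
    0 = temp_rate N md z \<and>
    (\<forall>k\<in>source_edges N. 0 = - f_h N k (src_state z $ k) (average_temperature N (temp z)))"
    using assms unfolding chp_dynamics_iff[OF N md] fst_zero snd_zero zero_index .
  note R = *[THEN conjunct1] *[THEN conjunct2, THEN conjunct1]
    *[THEN conjunct2, THEN conjunct2, THEN conjunct1]
    *[THEN conjunct2, THEN conjunct2, THEN conjunct2, THEN conjunct1]
    *[THEN conjunct2, THEN conjunct2, THEN conjunct2, THEN conjunct2]
  show "z \<in> constraint_set N md" by (rule R(1))
  have l: "freq z $ fst e = freq z $ snd e" if "e \<in> lines N" for e using bspec[OF R(2) that] by simp
  have T: "temp_rate N md z = 0" by (rule R(4)[symmetric])
  have "freq_rate N md z j = 0" for j
  proof (cases "j \<in> gen_buses N")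
    case True
    then show ?thesis using bspec[OF R(3)] by metis
  next
    case False
    have "inflow_rate N (eta z) (freq z) j = 0" using l[of "(_, _)"] by (simp add: inflow_rate_def)
    then show ?thesis using False T by (simp add: freq_rate_def average_temperature_def)
  qed
  moreover have "(if e \<in> lines N then freq z $ fst e - freq z $ snd e else 0) = 0" for e using l by simp
  moreover have "(if j \<in> gen_buses N then - f_e N j (gen_state z $ j) (freq z $ j) else 0) = 0" for j
    using bspec[OF R(3), of j] by (cases "j \<in> gen_buses N") (simp_all only: if_True if_False)
  moreover have "(if k \<in> source_edges N then - f_h N k (src_state z $ k) (average_temperature N (temp z)) else 0) = 0" for k
    using bspec[OF R(5), of k] by (cases "k \<in> source_edges N") (simp_all only: if_True if_False)
  ultimately show "vector_field N md z = 0"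
    unfolding vector_field_def T by (simp add: zero_prod_def vec_eq_iff)
qed

theorem corollary9:
  fixes N :: "('n::finite, 'k::finite, 'm::finite, 's::euclidean_space, 'r::euclidean_space) chp"
    and md :: "'n hp_mode"
    and \<eta>s :: "real^('n \<times> 'n)" and \<omega>s :: "real^'n" and xes :: "'s^'n"
    and Ts :: "real^('k + 'm)" and xhs :: "'r^'k"
  assumes "chp_network N" and "valid_mode N md"
    and "equilibrium (chp_dynamics N md) (\<eta>s, \<omega>s, xes, Ts, xhs)"
    and "\<forall>e\<in>lines N. \<bar>\<eta>s $ e\<bar> < pi / 2"
    and "\<forall>j\<in>gen_buses N.
           unique_equilibrium_output (S_e N j) (f_e N j) (g_e N j) (\<omega>s $ j) \<and>
           asymptotically_stable (generation_dynamics (S_e N j) (f_e N j) (\<omega>s $ j)) (xes $ j)"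
    and "\<forall>k\<in>source_edges N.
           unique_equilibrium_output (S_h N k) (f_h N k) (g_h N k) (average_temperature N Ts) \<and>
           asymptotically_stable
             (generation_dynamics (S_h N k) (f_h N k) (average_temperature N Ts)) (xhs $ k)"
    and "\<forall>j\<in>gen_buses N. \<exists>Vs.
           locally_input_strictly_passive (S_e N j) (f_e N j) (g_e N j) (\<omega>s $ j) (xes $ j) Vs \<and>
           strict_local_min_on (S_e N j) Vs (xes $ j)"
    and "\<forall>k\<in>source_edges N. \<exists>Vs.
           locally_input_strictly_passive (S_h N k) (f_h N k) (g_h N k)
             (average_temperature N Ts) (xhs $ k) Vs \<and>
           strict_local_min_on (S_h N k) Vs (xhs $ k)"
  shows "\<exists>U. open U \<and> (\<eta>s, \<omega>s, xes, Ts, xhs) \<in> U \<and>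
           (\<forall>I z. maximal_solution (chp_dynamics N md) I z \<and> z 0 \<in> U \<longrightarrow>
              I = {0..} \<and>
              (\<exists>ze. equilibrium (chp_dynamics N md) ze \<and> (z \<longlongrightarrow> ze) at_top))"
proof -
  define zs where "zs = (\<eta>s, \<omega>s, xes, Ts, xhs)"
  have zsc: "eta zs = \<eta>s" "freq zs = \<omega>s" "gen_state zs = xes" "temp zs = Ts" "src_state zs = xhs"
    by (simp_all add: zs_def)
  interpret chp_model N md by unfold_locales (rule assms)+
  have eq: "chp_dynamics N md zs 0" using assms(3) by (simp add: equilibrium_def zs_def)
  note zs = equilibrium_vector_field[OF eq]
  obtain Ve dVe \<phi>e Xe \<Omega>e where
    pe: "\<forall>j\<in>gen_buses N. passive_system (S_e N j) (f_e N j) (g_e N j) (\<omega>s $ j) (xes $ j) (Ve j) (dVe j) (\<phi>e j) (Xe j) (\<Omega>e j)"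
    and oe: "\<forall>j\<in>gen_buses N. open (\<Omega>e j) \<and> \<omega>s $ j \<in> \<Omega>e j \<and> openin (top_of_set (S_e N j)) (Xe j) \<and> xes $ j \<in> Xe j"
    by (rule passive_systems_exist[OF _ assms(7)]) (use assms(5) in blast)
  obtain Vh dVh \<phi>h Xh \<Omega>h where
    ph: "\<forall>k\<in>source_edges N. passive_system (S_h N k) (f_h N k) (g_h N k) (average_temperature N Ts) (xhs $ k)
       (Vh k) (dVh k) (\<phi>h k) (Xh k) (\<Omega>h k)"
    and oh: "\<forall>k\<in>source_edges N. open (\<Omega>h k) \<and> average_temperature N Ts \<in> \<Omega>h k \<and>
       openin (top_of_set (S_h N k)) (Xh k) \<and> xhs $ k \<in> Xh k"
    by (rule passive_systems_exist[where us = "\<lambda>_. average_temperature N Ts", OF _ assms(8)]) (use assms(6) in blast)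
  have "eventually (\<lambda>z. \<forall>e\<in>lines N. \<bar>eta z $ e\<bar> < pi / 2) (nhds zs)"
  proof (rule eventually_ball_finite, simp, intro ballI)
    fix e assume "e \<in> lines N"
    then have "eta zs $ e \<in> {- (pi / 2)<..<pi / 2}" using assms(4) by (fastforce simp: zsc abs_less_iff)
    then have "eventually (\<lambda>z. eta z $ e \<in> {- (pi / 2)<..<pi / 2}) (nhds zs)"
      by (rule eventually_open_preimage[where h = "\<lambda>z. eta z $ e" and p = zs, rotated]) (intro continuous_intros | simp)+
    then show "eventually (\<lambda>z. \<bar>eta z $ e\<bar> < pi / 2) (nhds zs)" by eventually_elim auto
  qed
  moreover have "eventually (\<lambda>z. \<forall>j\<in>gen_buses N. (gen_state z $ j \<in> S_e N j \<longrightarrow> gen_state z $ j \<in> Xe j) \<and>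
      freq z $ j \<in> \<Omega>e j) (nhds zs)"
  proof (rule eventually_ball_finite, simp, intro ballI eventually_conj)
    fix j assume "j \<in> gen_buses N"
    then have o: "open (\<Omega>e j)" "freq zs $ j \<in> \<Omega>e j" "openin (top_of_set (S_e N j)) (Xe j)" "gen_state zs $ j \<in> Xe j"
      using oe by (simp_all add: zsc)
    show "eventually (\<lambda>z. gen_state z $ j \<in> S_e N j \<longrightarrow> gen_state z $ j \<in> Xe j) (nhds zs)"
      by (rule eventually_openin_preimage[where h = "\<lambda>z. gen_state z $ j" and p = zs, OF o(3,4)])
        (intro continuous_intros)
    show "eventually (\<lambda>z. freq z $ j \<in> \<Omega>e j) (nhds zs)"
      by (rule eventually_open_preimage[where h = "\<lambda>z. freq z $ j" and p = zs, OF o(1,2)]) (intro continuous_intros)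
  qed
  moreover have "eventually (\<lambda>z. \<forall>k\<in>source_edges N. (src_state z $ k \<in> S_h N k \<longrightarrow> src_state z $ k \<in> Xh k) \<and>
      average_temperature N (temp z) \<in> \<Omega>h k) (nhds zs)"
  proof (rule eventually_ball_finite, simp, intro ballI eventually_conj)
    fix k assume "k \<in> source_edges N"
    then have o: "open (\<Omega>h k)" "average_temperature N (temp zs) \<in> \<Omega>h k" "openin (top_of_set (S_h N k)) (Xh k)"
      "src_state zs $ k \<in> Xh k"
      using oh by (simp_all add: zsc)
    show "eventually (\<lambda>z. src_state z $ k \<in> S_h N k \<longrightarrow> src_state z $ k \<in> Xh k) (nhds zs)"
      by (rule eventually_openin_preimage[where h = "\<lambda>z. src_state z $ k" and p = zs, OF o(3,4)])
        (intro continuous_intros)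
    show "eventually (\<lambda>z. average_temperature N (temp z) \<in> \<Omega>h k) (nhds zs)"
      by (rule eventually_open_preimage[where h = "\<lambda>z. average_temperature N (temp z)" and p = zs, OF o(1,2)]) (intro continuous_intros)
  qed
  ultimately have "eventually (\<lambda>z. (\<forall>e\<in>lines N. \<bar>eta z $ e\<bar> < pi / 2) \<and>
      (\<forall>j\<in>gen_buses N. (gen_state z $ j \<in> S_e N j \<longrightarrow> gen_state z $ j \<in> Xe j) \<and> freq z $ j \<in> \<Omega>e j) \<and>
      (\<forall>k\<in>source_edges N. (src_state z $ k \<in> S_h N k \<longrightarrow> src_state z $ k \<in> Xh k) \<and>
        average_temperature N (temp z) \<in> \<Omega>h k)) (nhds zs)"
    by (intro eventually_conj)
  then obtain d where d: "0 < d" and near: "\<And>z. dist z zs < d \<Longrightarrow> (\<forall>e\<in>lines N. \<bar>eta z $ e\<bar> < pi / 2) \<and>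
      (\<forall>j\<in>gen_buses N. (gen_state z $ j \<in> S_e N j \<longrightarrow> gen_state z $ j \<in> Xe j) \<and> freq z $ j \<in> \<Omega>e j) \<and>
      (\<forall>k\<in>source_edges N. (src_state z $ k \<in> S_h N k \<longrightarrow> src_state z $ k \<in> Xh k) \<and>
        average_temperature N (temp z) \<in> \<Omega>h k)"
    unfolding eventually_nhds_metric by blast
  \<comment> \<open>Half the radius puts the closed ball inside the open ball of radius
    \<open>d\<close>, where the local conditions hold.\<close>
  interpret passive_chp N md zs "d / 2" Ve dVe \<phi>e Xe \<Omega>e Vh dVh \<phi>h Xh \<Omega>h
  proof
    show "zs \<in> constraint_set N md" "vector_field N md zs = 0" by (rule zs)+
    show "0 < d / 2" using d by simp
    show "passive_system (S_e N j) (f_e N j) (g_e N j) (freq zs $ j) (gen_state zs $ j) (Ve j) (dVe j) (\<phi>e j) (Xe j) (\<Omega>e j)"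
      if "j \<in> gen_buses N" for j using pe that by (simp add: zsc)
    show "passive_system (S_h N k) (f_h N k) (g_h N k) (average_temperature N (temp zs)) (src_state zs $ k)
        (Vh k) (dVh k) (\<phi>h k) (Xh k) (\<Omega>h k)"
      if "k \<in> source_edges N" for k using ph that by (simp add: zsc)
    fix z assume z: "z \<in> cball zs (d / 2) \<inter> constraint_set N md"
    then have "dist z zs < d" using d by (simp add: dist_commute)
    note n = near[OF this]
    show "\<bar>eta z $ e\<bar> < pi / 2" if "e \<in> lines N" for e using n that by blast
    have zS: "z \<in> state_space N" using z constraint_subset by blast
    show "gen_state z $ j \<in> Xe j \<and> freq z $ j \<in> \<Omega>e j" if j: "j \<in> gen_buses N" for j
      using n j state_in_subspace(1)[OF zS j] by blast
    show "src_state z $ k \<in> Xh k \<and> average_temperature N (temp z) \<in> \<Omega>h k" if k: "k \<in> source_edges N" for k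
      using n k state_in_subspace(2)[OF zS k] by blast
  qed
  have "\<exists>\<delta>>0. \<forall>I x. forward_interval I \<and> trajectory F M I x \<and> dist (x 0) zs < \<delta> \<and>
      (\<forall>J y. forward_interval J \<and> trajectory F M J y \<and> I \<subseteq> J \<and> (\<forall>t\<in>I. y t = x t) \<longrightarrow> J = I) \<longrightarrow>
      I = {0..} \<and> (\<exists>c\<in>equilibria. (x \<longlongrightarrow> c) at_top)"
  proof (rule lyapunov_family_convergence[where V = V and r = "d / 2" and K = K])
    show "V c (x b) \<le> V c (x 0)" if "c \<in> equilibria" "0 \<le> b" "trajectory F K {0..b} x" for c x b
      by (rule V_decreasing[OF that])
    show "u 0 = c" if "c \<in> equilibria" "trajectory (\<lambda>q. - F q) K {0..} u" "\<And>t. 0 \<le> t \<Longrightarrow> V c (u t) = 0" for c u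
      by (rule backward_trajectory_trivial[OF that])
    show "0 \<le> V c q" if "c \<in> equilibria" "q \<in> K" for c q by (rule V_nonneg[OF that(2,1)])
    show "V c c = 0" if "c \<in> equilibria" for c by (rule V_center[OF that])
    show "continuous_on K (V c)" for c by (rule V_continuous)
    show "\<exists>c\<in>equilibria. c \<in> omega_limit x" if "trajectory F K {0..} x" for x by (rule limit_equilibrium[OF that])
    show "\<exists>e>0. \<exists>x. x 0 = q \<and> trajectory F M {0..e} x" if "q \<in> M" for q by (rule vector_field_viable[OF that])
  qed (rule closed_constraint_set r zs zs_equilibrium refl F_continuous)+
  then obtain \<delta> where \<delta>: "0 < \<delta>" and conv: "\<forall>I x. forward_interval I \<and> trajectory F M I x \<and> dist (x 0) zs < \<delta> \<and>
      (\<forall>J y. forward_interval J \<and> trajectory F M J y \<and> I \<subseteq> J \<and> (\<forall>t\<in>I. y t = x t) \<longrightarrow> J = I) \<longrightarrow>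
      I = {0..} \<and> (\<exists>c\<in>equilibria. (x \<longlongrightarrow> c) at_top)" by blast
  show ?thesis
  proof (intro exI[of _ "ball zs \<delta>"] conjI allI impI)
    show "open (ball zs \<delta>)" by simp
    show "(\<eta>s, \<omega>s, xes, Ts, xhs) \<in> ball zs \<delta>" using \<delta> by (simp add: zs_def[symmetric])
    fix I z assume z: "maximal_solution (chp_dynamics N md) I z \<and> z 0 \<in> ball zs \<delta>"
    then have sol: "solution_of (chp_dynamics N md) I z" by (simp add: maximal_solution_def)
    have max: "\<forall>J y. solution_of (chp_dynamics N md) J y \<and> I \<subseteq> J \<and> (\<forall>t\<in>I. y t = z t) \<longrightarrow> J = I"
      using z unfolding maximal_solution_def by (elim conjE)
    have I: "forward_interval I" using sol by (simp add: solution_of_def)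
    \<comment> \<open>On forward intervals, solutions and trajectories of the vector field in
      \<open>M\<close> are the same, so maximality carries over from one notion to the
      other.\<close>
    have lim: "I = {0..} \<and> (\<exists>c\<in>equilibria. (z \<longlongrightarrow> c) at_top)"
    proof (rule conv[THEN spec, THEN spec, THEN mp], intro conjI allI impI I solution_trajectory[OF sol]; (elim conjE)?)
      show "dist (z 0) zs < \<delta>" using z by (simp add: dist_commute)
      fix J y assume J: "forward_interval J" "trajectory F M J y" "I \<subseteq> J" "\<forall>t\<in>I. y t = z t"
      have "solution_of (chp_dynamics N md) J y" by (rule trajectory_solution[OF J(1,2)])
      then show "J = I" using max[THEN spec, THEN spec, of J y] J(3,4) by simp
    qed
    show "I = {0..}" using lim by (rule conjunct1)
    obtain c where c: "c \<in> equilibria" "(z \<longlongrightarrow> c) at_top" using lim[THEN conjunct2] ..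
    have "equilibrium (chp_dynamics N md) c"
      using dynamics_vector_field[OF equilibriaD(1)[OF c(1)]] equilibriaD(2)[OF c(1)]
      by (simp add: equilibrium_def)
    then show "\<exists>ze. equilibrium (chp_dynamics N md) ze \<and> (z \<longlongrightarrow> ze) at_top"
      using c(2) by (intro exI[of _ c] conjI)
  qed
qed

end
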